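(* Let $L,M\ge 0$ be integers, $\beta\neq 0$, ${\bf c}=(c_1,\dots,c_L)$, ${\bf d}=(d_1,\dots,d_M)$ nonzero complex parameters (generic, so that all the Gamma-function values and the quantities $\rho_i$ below are defined and nonzero, and the pole sets described below are separated by the contours), and let $$G_{{\bf c},{\bf d}}(z)=\frac{\prod_{i=1}^L(1+c_iz)}{\prod_{j=1}^M(1-d_jz)},\qquad \kappa_{{\bf c},{\bf d}}=(-1)^M\frac{\prod_{l=1}^L\beta c_l}{\prod_{m=1}^M\beta d_m}.$$ For $k\in\mathbf Z$ define the Laurent series $$\phi_k^{({\bf c},{\bf d},\beta)}(x)=\beta x^{1-k}\sum_{j=0}^\infty\frac{\rho_{j-k}}{j!}\Big(\frac{x}{\beta}\Big)^j,$$ and the functions $$\tilde\phi_k^{({\bf c},{\bf d},\beta)}(x)=\frac{C_k}{2\pi i}\int_{\mathcal C_k}\frac{\Gamma(1-k-s)\prod_{l=1}^L\Gamma\big(s+\frac1{\beta c_l}\big)\,(-\kappa_{{\bf c},{\bf d}}x)^s}{\prod_{m=1}^M\Gamma\big(s-\frac1{\beta d_m}\big)}\,ds,\qquad C_k=\frac{\prod_{j=1}^M\Gamma(-\frac1{\beta d_j})}{(-\beta)^{k-1}\prod_{l=1}^L\Gamma(\frac1{\beta c_l})},$$ (i.e. $C_k$ times the Meijer $G$-function $G^{1,L}_{L,M+1}\big({1-\frac1{\beta c_1},\dots,1-\frac1{\beta c_L}\atop 1-k,\,1+\frac1{\beta d_1},\dots,1+\frac1{\beta d_M}}\big|-\kappa_{{\bf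 c},{\bf d}}x\big)$), where the contour $\mathcal C_k$ separates the poles $1-k,2-k,3-k,\dots$ (to its right) from the poles $\{-i-\frac1{\beta c_j}\}_{j=1,\dots,L,\ i\in\mathbf N}$ (to its left); for $L\le M+1$ it starts at $+\infty$ below the real axis, encircles the poles on the real axis clockwise and returns to $+\infty$, while for $L\ge M+1$ it may be taken to run from $-i\infty$ to $+i\infty$ (the integral then converging for $|\arg(-\kappa_{{\bf c},{\bf d}}x)|<\frac{(L-M+1)\pi}{2}$). Then the functions $\tilde\phi_k=\tilde\phi_k^{({\bf c},{\bf d},\beta)}$ satisfy, for all $k\in\mathbf Z$, $$\beta(\mathcal D+k-1)\tilde\phi_k=\tilde\phi_{k-1},\qquad \beta x\,G_{{\bf c},{\bf d}}(\beta\mathcal D)\tilde\phi_k=\tilde\phi_{k-1},\qquad \big(xG_{{\bf c},{\bf d}}(\beta\mathcal D)-\mathcal D\big)\tilde\phi_k=(k-1)\tilde\phi_k,$$ where $\mathcal D=x\frac{d}{dx}$. Moreover: (i) if $L\le M$, the Laurent series $\phi_k^{({\bf c},{\bf d},\beta)}(x)$ converges absolutely for all $x\in\mathbf C\setminus\{0\}$ and $\tilde\phi_k^{({\bf c},{\bf d},\beta)}(x)=\phi_k^{({\bf c},{\bf d},\beta)}(x)$; (ii) if $L=M+1$, the series $\phi_k^{({\bf c},{\bf d},\beta)}(x)$ converges to $\tilde\phi_k^{({\bf c},{\bf d},\beta)}(x)$ in the punctured disc $0<|\kappa_{{\bf c},{\bf d}}x|<1$; (iii) if $L>M+1$, the (formal)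 series $\phi_k^{({\bf c},{\bf d},\beta)}(x)$ is the asymptotic series (in the sense of Poincaré, as $x\to0$) of $\tilde\phi_k^{({\bf c},{\bf d},\beta)}(x)$ within the angular sector $0<\arg(-\kappa_{{\bf c},{\bf d}}x)<(L-M+1)\frac{\pi}{2}$.
   Context: Set $r_i=\beta G_{{\bf c},{\bf d}}(i\beta)$ for $i\in\mathbf Z$ (assumed nonzero), $\rho_0=1$, $\rho_i=\prod_{k=1}^i r_k$ and $\rho_{-i}=\prod_{k=0}^{i-1}r_{-k}^{-1}$ for $i\in\mathbf N^+$; explicitly $\rho_i=\beta^i\prod_{k=1}^i\frac{\prod_l(1+k\beta c_l)}{\prod_m(1-k\beta d_m)}$ and $\rho_{-i}=\beta^{-i}\prod_{k=1}^{i-1}\frac{\prod_m(1+k\beta d_m)}{\prod_l(1-k\beta c_l)}$. The operator $G_{{\bf c},{\bf d}}(\beta\mathcal D)$ acts on powers by $G_{{\bf c},{\bf d}}(\beta\mathcal D)x^s=G_{{\bf c},{\bf d}}(\beta s)x^s$ (equivalently, $\prod_l(1+\beta c_l\mathcal D)$ composed with the inverse of $\prod_m(1-\beta d_m\mathcal D)$), and is applied under the integral sign for $\tilde\phi_k$. Up to the prefactor $\beta\rho_{-k}(\kappa_{{\bf c},{\bf d}}x)^{1-k}$, the series $\phi_k^{({\bf c},{\bf d},\beta)}$ is the generalized hypergeometric series ${}_LF_M\big({1-k+\frac1{\beta c_1},\dots,1-k+\frac1{\beta c_L}\atop 1-k-\frac1{\beta d_1},\dots,1-k-\frac1{\beta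 d_M}}\big|\kappa_{{\bf c},{\bf d}}x\big)$. *)

theory Defs
  imports "HOL-Complex_Analysis.Complex_Analysis" "HOL-Library.Landau_Symbols"
begin

text \<open>Parameters: L M :: nat, beta :: complex, c d :: nat => complex
  (c_1..c_L is represented by c 0 .. c (L-1), likewise for d).\<close>

definition Gcd :: "nat \<Rightarrow> nat \<Rightarrow> (nat \<Rightarrow> complex) \<Rightarrow> (nat \<Rightarrow> complex) \<Rightarrow> complex \<Rightarrow> complex" where
  "Gcd L M c d z = (\<Prod>i<L. 1 + c i * z) / (\<Prod>j<M. 1 - d j * z)"

definition kappa :: "nat \<Rightarrow> nat \<Rightarrow> complex \<Rightarrow> (nat \<Rightarrow> complex) \<Rightarrow> (nat \<Rightarrow> complex) \<Rightarrow> complex" where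
  "kappa L M \<beta> c d = (-1) ^ M * (\<Prod>l<L. \<beta> * c l) / (\<Prod>m<M. \<beta> * d m)"

definition rr :: "nat \<Rightarrow> nat \<Rightarrow> complex \<Rightarrow> (nat \<Rightarrow> complex) \<Rightarrow> (nat \<Rightarrow> complex) \<Rightarrow> int \<Rightarrow> complex" where
  "rr L M \<beta> c d i = \<beta> * Gcd L M c d (of_int i * \<beta>)"

definition rho :: "nat \<Rightarrow> nat \<Rightarrow> complex \<Rightarrow> (nat \<Rightarrow> complex) \<Rightarrow> (nat \<Rightarrow> complex) \<Rightarrow> int \<Rightarrow> complex" where
  "rho L M \<beta> c d i =
     (if 0 \<le> i then (\<Prod>k\<in>{1..nat i}. rr L M \<beta> c d (int k))
      else (\<Prod>k\<in>{0..<nat (- i)}. inverse (rr L M \<beta> c d (- int k))))"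

definition phi_term :: "nat \<Rightarrow> nat \<Rightarrow> complex \<Rightarrow> (nat \<Rightarrow> complex) \<Rightarrow> (nat \<Rightarrow> complex) \<Rightarrow> int \<Rightarrow> complex \<Rightarrow> nat \<Rightarrow> complex" where
  "phi_term L M \<beta> c d k x j =
     \<beta> * x powi (1 - k) * (rho L M \<beta> c d (int j - k) / fact j) * (x / \<beta>) ^ j"

definition phi :: "nat \<Rightarrow> nat \<Rightarrow> complex \<Rightarrow> (nat \<Rightarrow> complex) \<Rightarrow> (nat \<Rightarrow> complex) \<Rightarrow> int \<Rightarrow> complex \<Rightarrow> complex" where
  "phi L M \<beta> c d k x = (\<Sum>j. phi_term L M \<beta> c d k x j)"

text \<open>The variable: zeta is a logarithm of -kappa x (a point of the universal cover of C-{0}),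
  so (-kappa x)^s = exp (s zeta), x = - exp zeta / kappa, and D = x d/dx = d/dzeta.\<close>
definition xof :: "nat \<Rightarrow> nat \<Rightarrow> complex \<Rightarrow> (nat \<Rightarrow> complex) \<Rightarrow> (nat \<Rightarrow> complex) \<Rightarrow> complex \<Rightarrow> complex" where
  "xof L M \<beta> c d \<zeta> = - exp \<zeta> / kappa L M \<beta> c d"

definition Ck :: "nat \<Rightarrow> nat \<Rightarrow> complex \<Rightarrow> (nat \<Rightarrow> complex) \<Rightarrow> (nat \<Rightarrow> complex) \<Rightarrow> int \<Rightarrow> complex" where
  "Ck L M \<beta> c d k = (\<Prod>j<M. Gamma (- 1 / (\<beta> * d j)))
       / ((- \<beta>) powi (k - 1) * (\<Prod>l<L. Gamma (1 / (\<beta> * c l))))"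

text \<open>Mellin-Barnes integrand; exp (s * zeta) stands for (-kappa x)^s.\<close>
definition integrand :: "nat \<Rightarrow> nat \<Rightarrow> complex \<Rightarrow> (nat \<Rightarrow> complex) \<Rightarrow> (nat \<Rightarrow> complex) \<Rightarrow> int \<Rightarrow> complex \<Rightarrow> complex \<Rightarrow> complex" where
  "integrand L M \<beta> c d k \<zeta> s =
     Gamma (1 - of_int k - s) * (\<Prod>l<L. Gamma (s + 1 / (\<beta> * c l))) * exp (s * \<zeta>)
       / (\<Prod>m<M. Gamma (s - 1 / (\<beta> * d m)))"

definition line_integral :: "(complex \<Rightarrow> complex) \<Rightarrow> (real \<Rightarrow> complex) \<Rightarrow> complex" where
  "line_integral f \<gamma> = integral UNIV (\<lambda>t. f (\<gamma> t) * vector_derivative \<gamma> (at t))"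

definition phitilde :: "nat \<Rightarrow> nat \<Rightarrow> complex \<Rightarrow> (nat \<Rightarrow> complex) \<Rightarrow> (nat \<Rightarrow> complex) \<Rightarrow> (real \<Rightarrow> complex) \<Rightarrow> int \<Rightarrow> complex \<Rightarrow> complex" where
  "phitilde L M \<beta> c d \<gamma> k \<zeta> =
     Ck L M \<beta> c d k / (2 * of_real pi * \<i>) * line_integral (integrand L M \<beta> c d k \<zeta>) \<gamma>"

text \<open>G(beta D) phitilde_k, with G(beta D) applied under the integral sign (G(beta D) x^s = G(beta s) x^s).\<close>
definition GD_phitilde :: "nat \<Rightarrow> nat \<Rightarrow> complex \<Rightarrow> (nat \<Rightarrow> complex) \<Rightarrow> (nat \<Rightarrow> complex) \<Rightarrow> (real \<Rightarrow> complex) \<Rightarrow> int \<Rightarrow> complex \<Rightarrow> complex" where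
  "GD_phitilde L M \<beta> c d \<gamma> k \<zeta> =
     Ck L M \<beta> c d k / (2 * of_real pi * \<i>) *
       line_integral (\<lambda>s. Gcd L M c d (\<beta> * s) * integrand L M \<beta> c d k \<zeta> s) \<gamma>"

definition right_poles :: "int \<Rightarrow> complex set" where
  "right_poles k = {of_int (1 - k) + of_nat n | n. True}"

definition left_poles :: "nat \<Rightarrow> complex \<Rightarrow> (nat \<Rightarrow> complex) \<Rightarrow> complex set" where
  "left_poles L \<beta> c = {- of_nat i - 1 / (\<beta> * c l) | i l. l < L}"

definition regular_contour :: "(real \<Rightarrow> complex) \<Rightarrow> bool" where
  "regular_contour \<gamma> \<longleftrightarrow> (\<forall>T. \<gamma> piecewise_C1_differentiable_on {-T..T})"

definition trunc_path :: "(real \<Rightarrow> complex) \<Rightarrow> real \<Rightarrow> real \<Rightarrow> complex" where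
  "trunc_path \<gamma> R = (\<lambda>u. \<gamma> (- R + 2 * R * u))"

definition hankel_contour :: "nat \<Rightarrow> complex \<Rightarrow> (nat \<Rightarrow> complex) \<Rightarrow> int \<Rightarrow> (real \<Rightarrow> complex) \<Rightarrow> bool" where
  "hankel_contour L \<beta> c k \<gamma> \<longleftrightarrow>
     regular_contour \<gamma> \<and>
     (\<forall>p \<in> right_poles k \<union> left_poles L \<beta> c. p \<notin> range \<gamma>) \<and>
     (\<exists>T \<eta>. 0 < T \<and> 0 < \<eta> \<and> (\<forall>t\<ge>T. \<gamma> t = of_real t + \<i> * of_real \<eta>)
                                \<and> (\<forall>t\<le>-T. \<gamma> t = of_real (- t) - \<i> * of_real \<eta>)) \<and>
     (\<forall>p \<in> right_poles k. eventually (\<lambda>R.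
          winding_number (trunc_path \<gamma> R +++ linepath (\<gamma> R) (\<gamma> (- R))) p = -1) at_top) \<and>
     (\<forall>p \<in> left_poles L \<beta> c. eventually (\<lambda>R.
          winding_number (trunc_path \<gamma> R +++ linepath (\<gamma> R) (\<gamma> (- R))) p = 0) at_top)"

definition vclose :: "(real \<Rightarrow> complex) \<Rightarrow> real \<Rightarrow> real \<Rightarrow> complex" where
  "vclose \<gamma> R = trunc_path \<gamma> R +++ linepath (\<gamma> R) (Complex R R) +++
                 linepath (Complex R R) (Complex R (- R)) +++ linepath (Complex R (- R)) (\<gamma> (- R))"

definition vertical_contour :: "nat \<Rightarrow> complex \<Rightarrow> (nat \<Rightarrow> complex) \<Rightarrow> int \<Rightarrow> (real \<Rightarrow> complex) \<Rightarrow> bool" where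
  "vertical_contour L \<beta> c k \<gamma> \<longleftrightarrow>
     regular_contour \<gamma> \<and>
     (\<forall>p \<in> right_poles k \<union> left_poles L \<beta> c. p \<notin> range \<gamma>) \<and>
     (\<exists>T a. 0 < T \<and> (\<forall>t. T \<le> \<bar>t\<bar> \<longrightarrow> \<gamma> t = Complex a t)) \<and>
     (\<forall>p \<in> right_poles k. eventually (\<lambda>R. winding_number (vclose \<gamma> R) p = -1) at_top) \<and>
     (\<forall>p \<in> left_poles L \<beta> c. eventually (\<lambda>R. winding_number (vclose \<gamma> R) p = 0) at_top)"

definition relations_hold :: "nat \<Rightarrow> nat \<Rightarrow> complex \<Rightarrow> (nat \<Rightarrow> complex) \<Rightarrow> (nat \<Rightarrow> complex)
     \<Rightarrow> (int \<Rightarrow> real \<Rightarrow> complex) \<Rightarrow> complex set \<Rightarrow> bool" where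
  "relations_hold L M \<beta> c d \<gamma> \<Omega> \<longleftrightarrow>
     (\<forall>k. \<forall>\<zeta>\<in>\<Omega>.
        phitilde L M \<beta> c d (\<gamma> k) k field_differentiable (at \<zeta>) \<and>
        \<beta> * (deriv (phitilde L M \<beta> c d (\<gamma> k) k) \<zeta> + of_int (k - 1) * phitilde L M \<beta> c d (\<gamma> k) k \<zeta>)
          = phitilde L M \<beta> c d (\<gamma> (k - 1)) (k - 1) \<zeta> \<and>
        \<beta> * xof L M \<beta> c d \<zeta> * GD_phitilde L M \<beta> c d (\<gamma> k) k \<zeta>
          = phitilde L M \<beta> c d (\<gamma> (k - 1)) (k - 1) \<zeta> \<and>
        xof L M \<beta> c d \<zeta> * GD_phitilde L M \<beta> c d (\<gamma> k) k \<zeta> - deriv (phitilde L M \<beta> c d (\<gamma> k) k) \<zeta>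
          = of_int (k - 1) * phitilde L M \<beta> c d (\<gamma> k) k \<zeta>)"

end

theory Submission
  imports Defs "HOL-Real_Asymp.Real_Asymp"
begin

text \<open>
  Write the integrand as \<open>\<Gamma>(1 - k - s) H(s)\<close> with \<open>H\<close> holomorphic off the left poles. By the residue
  theorem the integral over a Hankel contour truncated at a half-integer \<open>b\<close> is, up to a vertical
  segment at \<open>Re s = b\<close>, the sum of the residues at the right poles below \<open>b\<close>. The reflection formula
  and the ratio of the integrand at \<open>s + 1\<close> and \<open>s\<close> give geometric decay, so that the contour integral
  equals the full residue series, which is \<open>\<phi>\<^sub>k\<close>. For a vertical contour the same argument moves the
  contour to the line \<open>Re s = b\<close> at the cost of finitely many residues, where exponential decay of the
  Gamma function in vertical strips replaces the geometric decay. The line integral is then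
  differentiated under the integral sign, tends to 0 as \<open>b\<close> grows if \<open>L = M + 1\<close>, and is the remainder
  of the asymptotic series if \<open>L > M + 1\<close>. The three relations are the functional equations of the Gamma
  factors, since every contour that separates the poles yields the same residue expansion.
\<close>

section \<open>Decay of the Gamma function in vertical strips\<close>

lemma norm_Gamma_div_Gamma_Re_LIMSEQ:
  fixes z :: complex
  assumes "Re z > 0"
  shows "(\<lambda>n. \<Prod>i\<le>n. (Re z + real i) / norm (z + of_nat i)) \<longlonglongrightarrow> norm (Gamma z) / Gamma (Re z)"
proof -
  have "norm (Gamma_series z n) / Gamma_series (Re z) n = (\<Prod>i\<le>n. (Re z + real i) / norm (z + of_nat i))" for n
    by (simp add: Gamma_series_def norm_mult norm_divide pochhammer_prod prod_dividef
        atLeast0_lessThan_Suc lessThan_Suc_atMost atLeast0LessThan flip: prod_norm prod.lessThan_Suc)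
  moreover have "(\<lambda>n. norm (Gamma_series z n) / Gamma_series (Re z) n) \<longlonglongrightarrow> norm (Gamma z) / Gamma (Re z)"
    using Gamma_real_pos[OF assms] by (intro tendsto_intros) auto
  ultimately show ?thesis by simp
qed

text \<open>This comparison with the line \<open>Re z = 1/2\<close>, where the modulus is explicit, replaces Stirling's formula.\<close>

lemma norm_Gamma_div_Gamma_Re_mono:
  fixes z :: complex
  assumes "Re z > 0" "\<delta> \<ge> 0"
  shows "norm (Gamma z) / Gamma (Re z) \<le> norm (Gamma (z + of_real \<delta>)) / Gamma (Re z + \<delta>)"
proof (rule LIMSEQ_le)
  show "(\<lambda>n. \<Prod>i\<le>n. (Re z + real i) / norm (z + of_nat i)) \<longlonglongrightarrow> norm (Gamma z) / Gamma (Re z)"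
    by (rule norm_Gamma_div_Gamma_Re_LIMSEQ) fact
  show "(\<lambda>n. \<Prod>i\<le>n. (Re z + \<delta> + real i) / norm (z + of_real \<delta> + of_nat i))
          \<longlonglongrightarrow> norm (Gamma (z + of_real \<delta>)) / Gamma (Re z + \<delta>)"
    using norm_Gamma_div_Gamma_Re_LIMSEQ[of "z + of_real \<delta>"] assms by simp
  have "(Re z + real i) / norm (z + of_nat i) \<le> (Re z + \<delta> + real i) / norm (z + of_real \<delta> + of_nat i)" for i
  proof -
    let ?w = "z + of_nat i"
    have Re_le: "Re z + real i \<le> norm ?w" and pos: "0 < norm ?w" "0 < norm (?w + of_real \<delta>)"
      using assms complex_Re_le_cmod[of ?w] complex_Re_le_cmod[of "?w + of_real \<delta>"] by auto
    have "(Re z + real i) * norm (?w + of_real \<delta>) \<le> (Re z + real i) * (norm ?w + \<delta>)"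
      using norm_triangle_ineq[of ?w "of_real \<delta>"] assms by (intro mult_left_mono) auto
    also have "\<dots> \<le> (Re z + \<delta> + real i) * norm ?w"
      using mult_right_mono[OF Re_le assms(2)] by (simp add: algebra_simps)
    finally show ?thesis using pos by (simp add: field_simps)
  qed
  thus "\<exists>N. \<forall>n\<ge>N. (\<Prod>i\<le>n. (Re z + real i) / norm (z + of_nat i))
          \<le> (\<Prod>i\<le>n. (Re z + \<delta> + real i) / norm (z + of_real \<delta> + of_nat i))"
    using assms by (intro exI allI impI prod_mono) auto
qed

lemma norm_sin_squared_sinh: "(norm (sin z))\<^sup>2 = (sin (Re z))\<^sup>2 + (sinh (Im z))\<^sup>2" for z :: complex
  using norm_cos_squared[of "of_real pi / 2 - z"]
  by (simp add: sin_cos_eq[of z] sin_cos_eq[of "Re z"] sinh_def exp_minus power2_eq_square field_simps)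

lemma norm_Gamma_half_squared: "(norm (Gamma (Complex (1/2) t)))\<^sup>2 = pi / cosh (pi * t)"
proof -
  let ?z = "Complex (1/2) t"
  have "1 - ?z = cnj ?z" by (simp add: complex_eq_iff)
  hence "norm (Gamma ?z) * norm (Gamma ?z) = pi / norm (sin (of_real pi * ?z))"
    using arg_cong[OF Gamma_reflection_complex[of ?z], of norm] by (simp add: norm_mult norm_divide flip: cnj_Gamma)
  moreover have "(norm (sin (of_real pi * ?z)))\<^sup>2 = (cosh (pi * t))\<^sup>2"
    unfolding norm_sin_squared_sinh by (simp add: cosh_square_eq)
  ultimately show ?thesis by (simp add: power2_eq_square[of "norm (Gamma _)"] cosh_real_nonneg)
qed

lemma norm_Gamma_half_le: "norm (Gamma (Complex (1/2) t)) \<le> sqrt (2 * pi) * exp (- (pi/2) * \<bar>t\<bar>)"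
proof (rule power2_le_imp_le)
  have "exp (pi * \<bar>t\<bar>) / 2 \<le> cosh (pi * \<bar>t\<bar>)" by (simp add: cosh_def)
  also have "\<dots> = cosh (pi * t)" by (simp add: abs_mult flip: cosh_real_abs[of "pi * t"])
  finally have "pi / cosh (pi * t) \<le> pi / (exp (pi * \<bar>t\<bar>) / 2)" by (intro divide_left_mono) auto
  also have "\<dots> = (sqrt (2 * pi) * exp (- (pi/2) * \<bar>t\<bar>))\<^sup>2"
    by (simp add: power_mult_distrib exp_minus field_simps flip: exp_double)
  finally show "(norm (Gamma (Complex (1/2) t)))\<^sup>2 \<le> (sqrt (2 * pi) * exp (- (pi/2) * \<bar>t\<bar>))\<^sup>2"
    unfolding norm_Gamma_half_squared .
qed auto

lemma norm_Gamma_le_norm_Gamma_add_nat: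
  fixes z :: complex
  assumes "\<bar>Im z\<bar> \<ge> 1"
  shows "norm (Gamma z) \<le> norm (Gamma (z + of_nat n))"
proof -
  have nonpole: "z \<notin> \<int>\<^sub>\<le>\<^sub>0" using assms by (auto elim!: nonpos_Ints_cases)
  have "1 \<le> norm (z + of_nat i)" for i using assms abs_Im_le_cmod[of "z + of_nat i"] by simp
  hence "1 \<le> norm (pochhammer z n)" unfolding pochhammer_prod prod_norm[symmetric] by (intro prod_ge_1)
  hence "1 * norm (Gamma z) \<le> norm (pochhammer z n) * norm (Gamma z)" by (intro mult_right_mono) auto
  also have "\<dots> = norm (Gamma (z + of_nat n))"
    using nonpole by (simp add: pochhammer_Gamma Gamma_eq_zero_iff norm_divide)
  finally show ?thesis by simp
qed

lemma norm_Gamma_half_add_nat_le: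
  "norm (Gamma (Complex (1/2) t + of_nat m)) \<le> (real m + 1 + \<bar>t\<bar>) ^ m * (sqrt (2 * pi) * exp (- (pi/2) * \<bar>t\<bar>))"
proof -
  let ?z = "Complex (1/2) t"
  have nonpole: "?z \<notin> \<int>\<^sub>\<le>\<^sub>0" by (auto elim!: nonpos_Ints_cases simp: complex_eq_iff)
  have "norm (?z + of_nat i) \<le> real m + 1 + \<bar>t\<bar>" if "i < m" for i
    using cmod_le[of "?z + of_nat i"] that by simp
  hence "norm (pochhammer ?z m) \<le> (\<Prod>i=0..<m. real m + 1 + \<bar>t\<bar>)"
    unfolding pochhammer_prod prod_norm[symmetric] by (intro prod_mono) auto
  hence "norm (pochhammer ?z m) * norm (Gamma ?z) \<le> (real m + 1 + \<bar>t\<bar>) ^ m * (sqrt (2 * pi) * exp (- (pi/2) * \<bar>t\<bar>))"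
    by (intro mult_mono norm_Gamma_half_le) auto
  moreover have "Gamma (?z + of_nat m) = pochhammer ?z m * Gamma ?z"
    using nonpole by (simp add: pochhammer_Gamma Gamma_eq_zero_iff)
  ultimately show ?thesis by (simp add: norm_mult)
qed

lemma norm_Gamma_strip_le:
  obtains K m where "\<And>z :: complex. \<bar>Re z\<bar> \<le> S \<Longrightarrow> \<bar>Im z\<bar> \<ge> 1 \<Longrightarrow>
    norm (Gamma z) \<le> K * ((real m + 1 + \<bar>Im z\<bar>) ^ m * exp (- (pi/2) * \<bar>Im z\<bar>))"
proof -
  define n where "n = nat \<lceil>\<bar>S\<bar>\<rceil> + 1"
  define m where "m = 2 * n"
  have n: "real n \<ge> \<bar>S\<bar> + 1" unfolding n_def by linarith
  have "compact (Gamma ` {1..real m})"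
    by (intro compact_continuous_image continuous_intros) (auto elim!: nonpos_Ints_cases)
  then obtain B where B: "\<And>x. x \<in> {1..real m} \<Longrightarrow> norm (Gamma x) \<le> B"
    unfolding bounded_iff using compact_imp_bounded bounded_iff by (metis imageI)
  have Gamma_pos: "Gamma (real m + 1/2) > 0" by (intro Gamma_real_pos) auto
  show ?thesis
  proof (rule that[of "B * sqrt (2 * pi) / Gamma (real m + 1/2)" m])
    fix z :: complex assume z: "\<bar>Re z\<bar> \<le> S" "\<bar>Im z\<bar> \<ge> 1"
    define w where "w = z + of_nat n"
    define \<delta> where "\<delta> = real m + 1/2 - Re w"
    have w: "1 \<le> Re w" "Re w \<le> real m" "Im w = Im z" using z n by (auto simp: w_def m_def)
    have w\<delta>: "w + of_real \<delta> = Complex (1/2) (Im z) + of_nat m" "Re w + \<delta> = real m + 1/2"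
      using w by (auto simp: complex_eq_iff \<delta>_def)
    have "norm (Gamma z) \<le> norm (Gamma w)"
      unfolding w_def by (rule norm_Gamma_le_norm_Gamma_add_nat) fact
    also have "\<dots> \<le> norm (Gamma (w + of_real \<delta>)) / Gamma (Re w + \<delta>) * Gamma (Re w)"
      using norm_Gamma_div_Gamma_Re_mono[of w \<delta>] w Gamma_real_pos[of "Re w"] by (simp add: \<delta>_def field_simps)
    also have "\<dots> \<le> ((real m + 1 + \<bar>Im z\<bar>) ^ m * (sqrt (2 * pi) * exp (- (pi/2) * \<bar>Im z\<bar>))) / Gamma (real m + 1/2) * B"
      unfolding w\<delta> using B[of "Re w"] w Gamma_pos
      by (intro mult_mono divide_right_mono norm_Gamma_half_add_nat_le) auto
    finally show "norm (Gamma z) \<le> B * sqrt (2 * pi) / Gamma (real m + 1/2)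
        * ((real m + 1 + \<bar>Im z\<bar>) ^ m * exp (- (pi/2) * \<bar>Im z\<bar>))"
      by (simp add: mult_ac)
  qed
qed

definition strip_ends :: "real \<Rightarrow> complex filter" where
  "strip_ends S = inf (filtercomap (\<lambda>s. \<bar>Im s\<bar>) at_top) (principal {s. \<bar>Re s\<bar> \<le> S})"

lemma eventually_strip_ends:
  "eventually P (strip_ends S) \<longleftrightarrow> (\<exists>T. \<forall>s. \<bar>Re s\<bar> \<le> S \<longrightarrow> T \<le> \<bar>Im s\<bar> \<longrightarrow> P s)"
  unfolding strip_ends_def eventually_inf_principal eventually_filtercomap_at_top_linorder by auto

text \<open>Only rates \<open>\<nu> < \<mu>\<close> are required, so that polynomial factors are absorbed.\<close>

definition strip_decay :: "real \<Rightarrow> (complex \<Rightarrow> complex) \<Rightarrow> bool" where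
  "strip_decay \<mu> h \<longleftrightarrow> (\<forall>\<nu><\<mu>. \<forall>S. (\<lambda>s. norm (h s)) \<in> O[strip_ends S](\<lambda>s. exp (- \<nu> * \<bar>Im s\<bar>)))"

lemma strip_decayD:
  "strip_decay \<mu> h \<Longrightarrow> \<nu> < \<mu> \<Longrightarrow> (\<lambda>s. norm (h s)) \<in> O[strip_ends S](\<lambda>s. exp (- \<nu> * \<bar>Im s\<bar>))"
  unfolding strip_decay_def by blast

lemma strip_decayE:
  assumes "strip_decay \<mu> h" "\<nu> < \<mu>"
  obtains C T where "C > 0" "\<And>s. \<bar>Re s\<bar> \<le> S \<Longrightarrow> T \<le> \<bar>Im s\<bar> \<Longrightarrow> norm (h s) \<le> C * exp (- \<nu> * \<bar>Im s\<bar>)"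
proof -
  obtain C where "C > 0" "\<forall>\<^sub>F s in strip_ends S. norm (h s) \<le> C * exp (- \<nu> * \<bar>Im s\<bar>)"
    using strip_decayD[OF assms, of S] by (elim landau_o.bigE) auto
  thus ?thesis using that unfolding eventually_strip_ends by metis
qed

lemma strip_decay_mult:
  assumes "strip_decay \<mu> f" "strip_decay \<mu>' g"
  shows "strip_decay (\<mu> + \<mu>') (\<lambda>s. f s * g s)"
  unfolding strip_decay_def
proof (intro allI impI)
  fix \<nu> S assume "\<nu> < \<mu> + \<mu>'"
  define e where "e = (\<mu> + \<mu>' - \<nu>) / 2"
  have "\<mu> - e < \<mu>" "\<mu>' - e < \<mu>'" and \<nu>: "\<nu> = (\<mu> - e) + (\<mu>' - e)"
    using \<open>\<nu> < \<mu> + \<mu>'\<close> by (auto simp: e_def field_simps)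
  hence "(\<lambda>s. norm (f s) * norm (g s)) \<in> O[strip_ends S](\<lambda>s. exp (- (\<mu> - e) * \<bar>Im s\<bar>) * exp (- (\<mu>' - e) * \<bar>Im s\<bar>))"
    by (intro landau_o.big.mult strip_decayD[OF assms(1)] strip_decayD[OF assms(2)])
  thus "(\<lambda>s. norm (f s * g s)) \<in> O[strip_ends S](\<lambda>s. exp (- \<nu> * \<bar>Im s\<bar>))"
    unfolding norm_mult exp_add[symmetric] by (simp add: \<nu> algebra_simps)
qed

lemma strip_decay_of_bound:
  assumes "\<And>s. norm (h s) \<le> C * exp (- \<mu> * \<bar>Im s\<bar>)"
  shows "strip_decay \<mu> h"
  unfolding strip_decay_def
proof (intro allI impI bigoI)
  fix \<nu> S assume "\<nu> < \<mu>"
  have "norm (norm (h s)) \<le> \<bar>C\<bar> * norm (exp (- \<nu> * \<bar>Im s\<bar>))" for s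
  proof -
    have "norm (h s) \<le> C * exp (- \<mu> * \<bar>Im s\<bar>)" by (rule assms)
    also have "\<dots> \<le> \<bar>C\<bar> * exp (- \<nu> * \<bar>Im s\<bar>)" using \<open>\<nu> < \<mu>\<close> by (intro mult_mono) (auto intro: mult_right_mono)
    finally show ?thesis by simp
  qed
  thus "\<forall>\<^sub>F s in strip_ends S. norm (norm (h s)) \<le> \<bar>C\<bar> * norm (exp (- \<nu> * \<bar>Im s\<bar>))" by simp
qed

lemma strip_decay_prod:
  assumes "\<And>l. strip_decay \<mu> (h l)"
  shows "strip_decay (real n * \<mu>) (\<lambda>s. \<Prod>l<n. h l s)"
proof (induction n)
  case 0
  show ?case by (auto intro: strip_decay_of_bound[of _ 1])
next
  case (Suc n)
  have "strip_decay (real n * \<mu> + \<mu>) (\<lambda>s. (\<Prod>l<n. h l s) * h n s)" by (intro strip_decay_mult Suc assms)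
  thus ?case by (simp add: algebra_simps)
qed

lemma strip_decay_compose:
  assumes h: "strip_decay \<mu> h" and Re: "\<And>s. \<bar>Re (g s)\<bar> \<le> \<bar>Re s\<bar> + r"
    and Im: "\<And>s. \<bar>\<bar>Im (g s)\<bar> - \<bar>Im s\<bar>\<bar> \<le> r"
  shows "strip_decay \<mu> (\<lambda>s. h (g s))"
  unfolding strip_decay_def
proof (intro allI impI)
  fix \<nu> S assume "\<nu> < \<mu>"
  then obtain C T where C: "C > 0"
    and bound: "\<And>s. \<bar>Re s\<bar> \<le> S + r \<Longrightarrow> T \<le> \<bar>Im s\<bar> \<Longrightarrow> norm (h s) \<le> C * exp (- \<nu> * \<bar>Im s\<bar>)"
    using strip_decayE[OF h] by metis
  show "(\<lambda>s. norm (h (g s))) \<in> O[strip_ends S](\<lambda>s. exp (- \<nu> * \<bar>Im s\<bar>))"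
  proof (rule bigoI[where c = "C * exp (\<bar>\<nu>\<bar> * r)"], unfold eventually_strip_ends, intro exI allI impI)
    fix s assume s: "\<bar>Re s\<bar> \<le> S" "T + r \<le> \<bar>Im s\<bar>"
    have "- \<nu> * (\<bar>Im (g s)\<bar> - \<bar>Im s\<bar>) \<le> \<bar>\<nu>\<bar> * \<bar>\<bar>Im (g s)\<bar> - \<bar>Im s\<bar>\<bar>"
      using abs_ge_self[of "- \<nu> * (\<bar>Im (g s)\<bar> - \<bar>Im s\<bar>)"] by (simp only: abs_mult abs_minus_cancel)
    also have "\<dots> \<le> \<bar>\<nu>\<bar> * r" using Im by (intro mult_left_mono) auto
    finally have "C * exp (- \<nu> * \<bar>Im (g s)\<bar>) \<le> C * exp (\<bar>\<nu>\<bar> * r + - \<nu> * \<bar>Im s\<bar>)"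
      using C by (intro mult_left_mono) (auto simp: algebra_simps)
    moreover have "norm (h (g s)) \<le> C * exp (- \<nu> * \<bar>Im (g s)\<bar>)"
      using s Re[of s] Im[of s] by (intro bound) auto
    ultimately show "norm (norm (h (g s))) \<le> C * exp (\<bar>\<nu>\<bar> * r) * norm (exp (- \<nu> * \<bar>Im s\<bar>))"
      unfolding exp_add mult.assoc[symmetric] by simp
  qed
qed

lemma strip_decay_shift: "strip_decay \<mu> h \<Longrightarrow> strip_decay \<mu> (\<lambda>s. h (s + a))"
  by (erule strip_decay_compose[where r = "norm a"])
     (use abs_Re_le_cmod[of a] abs_Im_le_cmod[of a] in auto)

lemma strip_decay_reflect: "strip_decay \<mu> h \<Longrightarrow> strip_decay \<mu> (\<lambda>s. h (a - s))"
  by (erule strip_decay_compose[where r = "norm a"])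
     (use abs_Re_le_cmod[of a] abs_Im_le_cmod[of a] in auto)

lemma strip_decay_exp: "strip_decay (- \<bar>Im \<zeta>\<bar>) (\<lambda>s. exp (s * \<zeta>))"
  unfolding strip_decay_def
proof (intro allI impI)
  fix \<nu> S assume \<nu>: "\<nu> < - \<bar>Im \<zeta>\<bar>"
  show "(\<lambda>s. norm (exp (s * \<zeta>))) \<in> O[strip_ends S](\<lambda>s. exp (- \<nu> * \<bar>Im s\<bar>))"
  proof (rule bigoI[where c = "exp (S * \<bar>Re \<zeta>\<bar>)"], unfold eventually_strip_ends, intro exI[of _ 0] allI impI)
    fix s :: complex assume s: "\<bar>Re s\<bar> \<le> S"
    have "Re (s * \<zeta>) \<le> \<bar>Re s * Re \<zeta>\<bar> + \<bar>Im s * Im \<zeta>\<bar>" by simp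
    also have "\<dots> \<le> S * \<bar>Re \<zeta>\<bar> + - \<nu> * \<bar>Im s\<bar>"
      unfolding abs_mult mult.commute[of "\<bar>Im s\<bar>"] using s \<nu> by (intro add_mono mult_right_mono) auto
    finally show "norm (norm (exp (s * \<zeta>))) \<le> exp (S * \<bar>Re \<zeta>\<bar>) * norm (exp (- \<nu> * \<bar>Im s\<bar>))"
      by (simp flip: exp_add)
  qed
qed

lemma strip_decay_Gamma: "strip_decay (pi/2) Gamma"
  unfolding strip_decay_def
proof (intro allI impI)
  fix \<nu> S :: real assume "\<nu> < pi/2"
  obtain K m where bound: "\<And>z :: complex. \<bar>Re z\<bar> \<le> S \<Longrightarrow> \<bar>Im z\<bar> \<ge> 1 \<Longrightarrow>
      norm (Gamma z) \<le> K * ((real m + 1 + \<bar>Im z\<bar>) ^ m * exp (- (pi/2) * \<bar>Im z\<bar>))"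
    using norm_Gamma_strip_le by metis
  have lim: "filterlim (\<lambda>s. \<bar>Im s\<bar>) at_top (strip_ends S)"
    unfolding strip_ends_def by (rule filterlim_mono[OF filterlim_filtercomap order_refl inf_le1])
  have "(\<lambda>t. (real m + 1 + t) ^ m * exp (- (pi/2) * t)) \<in> O(\<lambda>t. exp (- \<nu> * t))"
    using \<open>\<nu> < pi/2\<close> by real_asymp
  hence "(\<lambda>s. (real m + 1 + \<bar>Im s\<bar>) ^ m * exp (- (pi/2) * \<bar>Im s\<bar>)) \<in> O[strip_ends S](\<lambda>s. exp (- \<nu> * \<bar>Im s\<bar>))"
    by (rule landau_o.big.compose[OF _ lim])
  moreover have "(\<lambda>s. norm (Gamma s)) \<in> O[strip_ends S](\<lambda>s. (real m + 1 + \<bar>Im s\<bar>) ^ m * exp (- (pi/2) * \<bar>Im s\<bar>))"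
    by (rule bigoI[where c = K], unfold eventually_strip_ends, intro exI[of _ 1]) (use bound in auto)
  ultimately show "(\<lambda>s. norm (Gamma s)) \<in> O[strip_ends S](\<lambda>s. exp (- \<nu> * \<bar>Im s\<bar>))"
    by (rule landau_o.big_trans[rotated])
qed

lemma rGamma_conv_Gamma_reflect:
  fixes z :: complex
  assumes "1 - z \<notin> \<int>\<^sub>\<le>\<^sub>0"
  shows "rGamma z = Gamma (1 - z) * (sin (of_real pi * z) / of_real pi)"
proof -
  have "Gamma (1 - z) * rGamma (1 - z) = 1"
    using Gamma_nonzero[OF assms] by (simp add: rGamma_inverse_Gamma)
  thus ?thesis by (simp add: mult.left_commute[of "Gamma _"] flip: rGamma_reflection_complex)
qed

lemma strip_decay_rGamma: "strip_decay (- pi/2) rGamma"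
  unfolding strip_decay_def
proof (intro allI impI)
  fix \<nu> S :: real assume "\<nu> < - pi/2"
  let ?reflected = "\<lambda>s::complex. Gamma (1 - s) * (sin (of_real pi * s) / of_real pi)"
  have "norm (sin (of_real pi * s) / of_real pi) \<le> 1 / pi * exp (- (- pi) * \<bar>Im s\<bar>)" for s :: complex
    using cmod_sin_le_exp[of 1 "of_real pi * s"] by (simp add: norm_divide divide_right_mono abs_mult)
  hence "strip_decay (pi/2 + - pi) ?reflected"
    by (intro strip_decay_mult strip_decay_reflect strip_decay_Gamma strip_decay_of_bound)
  hence "(\<lambda>s. norm (?reflected s)) \<in> O[strip_ends S](\<lambda>s. exp (- \<nu> * \<bar>Im s\<bar>))"
    by (rule strip_decayD) (use \<open>\<nu> < - pi/2\<close> in simp)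
  moreover have "\<forall>\<^sub>F s in strip_ends S. norm (?reflected s) = norm (rGamma s)"
  proof (unfold eventually_strip_ends, intro exI[of _ 1] allI impI)
    fix s :: complex assume "1 \<le> \<bar>Im s\<bar>"
    hence "1 - s \<notin> \<int>\<^sub>\<le>\<^sub>0" by (auto elim!: nonpos_Ints_cases simp: complex_eq_iff)
    from rGamma_conv_Gamma_reflect[OF this] show "norm (?reflected s) = norm (rGamma s)" by (rule arg_cong[OF sym])
  qed
  ultimately show "(\<lambda>s. norm (rGamma s)) \<in> O[strip_ends S](\<lambda>s. exp (- \<nu> * \<bar>Im s\<bar>))"
    by (simp only: landau_o.big.in_cong)
qed

section \<open>Exponentially decaying functions on the real line\<close>

lemma integrable_exp_minus_abs:
  fixes \<delta> :: real
  assumes "\<delta> > 0"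
  shows "(\<lambda>t. exp (- \<delta> * \<bar>t\<bar>)) integrable_on UNIV"
proof -
  have right: "(\<lambda>t. exp (- \<delta> * \<bar>t\<bar>)) absolutely_integrable_on {0..}"
    by (rule nonnegative_absolutely_integrable_1[OF integrable_eq[OF integrable_on_exp_minus_to_infinity[OF assms, of 0]]]) auto
  hence left: "(\<lambda>t. exp (- \<delta> * \<bar>t\<bar>)) absolutely_integrable_on {..0}"
    using has_absolute_integral_reflect_real[of "{..0}" "{0..}" "\<lambda>t. exp (- \<delta> * \<bar>t\<bar>)"] by auto
  have "{..0} \<union> {0..} = (UNIV::real set)" "{..0} \<inter> {0..} = {0::real}" by auto
  thus ?thesis
    using integrable_Un[OF _ set_lebesgue_integral_eq_integral(1)[OF left] set_lebesgue_integral_eq_integral(1)[OF right]]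
    by (simp add: negligible_finite)
qed

lemma integral_symmetric_tendsto:
  fixes g :: "real \<Rightarrow> 'a :: euclidean_space"
  assumes "g integrable_on UNIV"
  shows "((\<lambda>R. integral {-R..R} g) \<longlongrightarrow> integral UNIV g) at_top"
proof (rule tendstoI)
  fix e :: real assume "e > 0"
  then obtain B where B: "B > 0" "\<And>a b. ball 0 B \<subseteq> cbox a b \<Longrightarrow>
     \<exists>z. (g has_integral z) (cbox a b) \<and> norm (z - integral UNIV g) < e"
    using has_integral_altD[OF integrable_integral[OF assms] _ \<open>e > 0\<close>] by auto
  show "\<forall>\<^sub>F R in at_top. dist (integral {-R..R} g) (integral UNIV g) < e"
    using eventually_ge_at_top[of B]
  proof eventually_elim
    case (elim R)
    have "ball 0 B \<subseteq> cbox (-R) R" using elim by (auto simp: dist_real_def)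
    from B(2)[OF this] show ?case by (auto simp: dist_norm dest: integral_unique)
  qed
qed

lemma integral_symmetric_tendsto_sequentially:
  fixes g :: "real \<Rightarrow> 'a :: euclidean_space"
  assumes "g integrable_on UNIV"
  shows "(\<lambda>n. integral {-real n..real n} g) \<longlonglongrightarrow> integral UNIV g"
  by (rule filterlim_compose[OF integral_symmetric_tendsto[OF assms] filterlim_real_sequentially])

lemma norm_integral_outside_interval_le:
  fixes g :: "real \<Rightarrow> 'a :: euclidean_space" and a b :: real
  assumes g: "g integrable_on UNIV" and B: "B integrable_on UNIV" and bound: "\<And>t. norm (g t) \<le> B t"
  shows "norm (integral UNIV g - integral {a..b} g) \<le> integral UNIV B - integral {a..b} B"
proof -
  have inside: "(\<lambda>t. if t \<in> {a..b} then f t else 0) integrable_on UNIV"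
    if "f integrable_on UNIV" for f :: "real \<Rightarrow> 'b :: euclidean_space"
    unfolding integrable_restrict_UNIV by (rule integrable_on_subinterval[OF that]) auto
  have outside: "integral UNIV f - integral {a..b} f = integral UNIV (\<lambda>t. f t - (if t \<in> {a..b} then f t else 0))"
    if "f integrable_on UNIV" for f :: "real \<Rightarrow> 'b :: euclidean_space"
    by (subst integral_diff[OF that inside[OF that]]) (simp only: integral_restrict_UNIV)
  show ?thesis unfolding outside[OF g] outside[OF B]
    using bound by (intro integral_norm_bound_integral integrable_diff inside g B) auto
qed

lemma integrable_on_UNIV_exp_tails:
  fixes g :: "real \<Rightarrow> 'a :: euclidean_space"
  assumes local: "\<And>R. R > 0 \<Longrightarrow> g integrable_on {-R..R}"
    and tails: "\<And>t. T \<le> \<bar>t\<bar> \<Longrightarrow> norm (g t) \<le> C * exp (- \<delta> * \<bar>t\<bar>)" and "\<delta> > 0"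
  shows "g integrable_on UNIV"
proof -
  have subinterval: "g integrable_on cbox a b" for a b
    by (rule integrable_on_subcbox[OF local[of "max \<bar>a\<bar> \<bar>b\<bar> + 1"]]) auto
  define m where "m = (\<lambda>t. if t \<in> {-T..T} then g t else 0)"
  have m: "m integrable_on UNIV"
    unfolding m_def integrable_restrict_UNIV using subinterval[of "-T" T] by simp
  have "(\<lambda>t. g t - m t) integrable_on UNIV"
  proof (rule integrable_on_all_intervals_UNIV)
    show "(\<lambda>t. g t - m t) integrable_on cbox a b" for a b
      by (intro integrable_diff subinterval integrable_on_subcbox[OF m]) auto
    show "norm (g t - m t) \<le> \<bar>C\<bar> * exp (- \<delta> * \<bar>t\<bar>)" for t
    proof (cases "t \<in> {-T..T}")
      case False
      hence "norm (g t - m t) \<le> C * exp (- \<delta> * \<bar>t\<bar>)" using tails[of t] by (auto simp: m_def)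
      also have "\<dots> \<le> \<bar>C\<bar> * exp (- \<delta> * \<bar>t\<bar>)" by (intro mult_right_mono) auto
      finally show ?thesis .
    qed (simp add: m_def)
    show "(\<lambda>t. \<bar>C\<bar> * exp (- \<delta> * \<bar>t\<bar>)) integrable_on UNIV"
      by (intro integrable_on_mult_right integrable_exp_minus_abs \<open>\<delta> > 0\<close>)
  qed
  from integrable_add[OF this m] show ?thesis by simp
qed

definition exp_decay :: "real \<Rightarrow> (real \<Rightarrow> complex) \<Rightarrow> bool" where
  "exp_decay \<mu> h \<longleftrightarrow> continuous_on UNIV h \<and> (\<forall>\<nu><\<mu>. \<exists>C. \<forall>t. norm (h t) \<le> C * exp (- \<nu> * \<bar>t\<bar>))"

lemma exp_decay_continuous: "exp_decay \<mu> h \<Longrightarrow> continuous_on S h"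
  unfolding exp_decay_def using continuous_on_subset by blast

lemma exp_decayE:
  assumes "exp_decay \<mu> h" "\<nu> < \<mu>"
  obtains C where "C \<ge> 0" "\<And>t. norm (h t) \<le> C * exp (- \<nu> * \<bar>t\<bar>)"
proof -
  obtain C where C: "\<And>t. norm (h t) \<le> C * exp (- \<nu> * \<bar>t\<bar>)" using assms unfolding exp_decay_def by blast
  show ?thesis using that C order_trans[OF norm_ge_zero C[of 0]] by simp
qed

lemma exp_decay_integrable:
  assumes "exp_decay \<mu> h" "\<mu> > 0"
  shows "h integrable_on UNIV"
proof -
  obtain C where "\<And>t. norm (h t) \<le> C * exp (- (\<mu>/2) * \<bar>t\<bar>)"
    using exp_decayE[OF assms(1), of "\<mu>/2"] assms(2) by auto
  thus ?thesis
    using assms by (intro integrable_on_UNIV_exp_tails[where C = C and \<delta> = "\<mu>/2" and T = 0] integrable_continuous_real)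
      (auto intro: exp_decay_continuous)
qed

lemma strip_decay_imp_exp_decay:
  assumes decay: "strip_decay \<mu> f" and cont: "continuous_on UNIV (\<lambda>t. f (Complex b t))"
  shows "exp_decay \<mu> (\<lambda>t. f (Complex b t))"
  unfolding exp_decay_def
proof (intro conjI cont allI impI)
  fix \<nu> assume "\<nu> < \<mu>"
  then obtain C T where tails: "\<And>s. \<bar>Re s\<bar> \<le> \<bar>b\<bar> \<Longrightarrow> T \<le> \<bar>Im s\<bar> \<Longrightarrow> norm (f s) \<le> C * exp (- \<nu> * \<bar>Im s\<bar>)"
    using strip_decayE[OF decay] by metis
  have "compact ((\<lambda>t. f (Complex b t) * of_real (exp (\<nu> * \<bar>t\<bar>))) ` {-T..T})"
    by (intro compact_continuous_image continuous_intros continuous_on_subset[OF cont]) auto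
  then obtain K where K: "\<And>t. t \<in> {-T..T} \<Longrightarrow> norm (f (Complex b t) * of_real (exp (\<nu> * \<bar>t\<bar>))) \<le> K"
    using compact_imp_bounded bounded_iff by (metis (no_types, lifting) imageI)
  have "norm (f (Complex b t)) \<le> max C K * exp (- \<nu> * \<bar>t\<bar>)" for t
  proof (cases "T \<le> \<bar>t\<bar>")
    case True
    have "norm (f (Complex b t)) \<le> C * exp (- \<nu> * \<bar>t\<bar>)" using tails[of "Complex b t"] True by simp
    also have "\<dots> \<le> max C K * exp (- \<nu> * \<bar>t\<bar>)" by (intro mult_right_mono) auto
    finally show ?thesis .
  next
    case False
    hence "t \<in> {-T..T}" by auto
    hence "norm (f (Complex b t)) \<le> K * exp (- \<nu> * \<bar>t\<bar>)" using K[of t] by (auto simp: norm_mult exp_minus field_simps)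
    also have "\<dots> \<le> max C K * exp (- \<nu> * \<bar>t\<bar>)" by (intro mult_right_mono) auto
    finally show ?thesis .
  qed
  thus "\<exists>C. \<forall>t. norm (f (Complex b t)) \<le> C * exp (- \<nu> * \<bar>t\<bar>)" by blast
qed

lemma exp_decay_cmult:
  assumes h: "exp_decay \<mu> h"
  shows "exp_decay \<mu> (\<lambda>t. a * h t)"
  unfolding exp_decay_def
proof (intro conjI allI impI)
  show "continuous_on UNIV (\<lambda>t. a * h t)" by (intro continuous_intros exp_decay_continuous[OF h])
  fix \<nu> assume "\<nu> < \<mu>"
  then obtain C where "\<And>t. norm (h t) \<le> C * exp (- \<nu> * \<bar>t\<bar>)" using exp_decayE[OF h] by metis
  hence "norm (a * h t) \<le> norm a * (C * exp (- \<nu> * \<bar>t\<bar>))" for t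
    unfolding norm_mult by (intro mult_left_mono) auto
  thus "\<exists>C. \<forall>t. norm (a * h t) \<le> C * exp (- \<nu> * \<bar>t\<bar>)" by (intro exI[of _ "norm a * C"]) (simp add: mult.assoc)
qed

lemma exp_decay_Complex_mult:
  assumes h: "exp_decay \<mu> h"
  shows "exp_decay \<mu> (\<lambda>t. Complex b t * h t)"
  unfolding exp_decay_def
proof (intro conjI allI impI)
  show "continuous_on UNIV (\<lambda>t. Complex b t * h t)"
    by (intro continuous_intros exp_decay_continuous[OF h])
  fix \<nu> assume "\<nu> < \<mu>"
  define \<epsilon> where "\<epsilon> = (\<mu> - \<nu>) / 2"
  have \<epsilon>: "\<epsilon> > 0" "\<nu> + \<epsilon> < \<mu>" using \<open>\<nu> < \<mu>\<close> by (auto simp: \<epsilon>_def field_simps)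
  obtain C where C: "C \<ge> 0" "\<And>t. norm (h t) \<le> C * exp (- (\<nu> + \<epsilon>) * \<bar>t\<bar>)" using exp_decayE[OF h \<epsilon>(2)] by metis
  have "norm (Complex b t * h t) \<le> ((\<bar>b\<bar> + 1 / \<epsilon>) * C) * exp (- \<nu> * \<bar>t\<bar>)" for t
  proof -
    have "\<epsilon> * \<bar>t\<bar> \<le> exp (\<epsilon> * \<bar>t\<bar>)" using exp_ge_add_one_self[of "\<epsilon> * \<bar>t\<bar>"] by linarith
    hence "\<bar>t\<bar> \<le> 1 / \<epsilon> * exp (\<epsilon> * \<bar>t\<bar>)" using \<epsilon>(1) by (simp add: field_simps)
    moreover have "\<bar>b\<bar> * 1 \<le> \<bar>b\<bar> * exp (\<epsilon> * \<bar>t\<bar>)" using \<epsilon>(1) by (intro mult_left_mono) auto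
    ultimately have "norm (Complex b t) \<le> (\<bar>b\<bar> + 1 / \<epsilon>) * exp (\<epsilon> * \<bar>t\<bar>)"
      using cmod_le[of "Complex b t"] by (simp add: distrib_right)
    hence "norm (Complex b t * h t) \<le> ((\<bar>b\<bar> + 1 / \<epsilon>) * exp (\<epsilon> * \<bar>t\<bar>)) * (C * exp (- (\<nu> + \<epsilon>) * \<bar>t\<bar>))"
      unfolding norm_mult using C \<epsilon>(1) by (intro mult_mono) auto
    also have "\<dots> = ((\<bar>b\<bar> + 1 / \<epsilon>) * C) * (exp (\<epsilon> * \<bar>t\<bar>) * exp (- (\<nu> + \<epsilon>) * \<bar>t\<bar>))" by (simp only: mult_ac)
    also have "exp (\<epsilon> * \<bar>t\<bar>) * exp (- (\<nu> + \<epsilon>) * \<bar>t\<bar>) = exp (- \<nu> * \<bar>t\<bar>)"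
      unfolding exp_add[symmetric] by (simp add: algebra_simps)
    finally show ?thesis .
  qed
  thus "\<exists>C. \<forall>t. norm (Complex b t * h t) \<le> C * exp (- \<nu> * \<bar>t\<bar>)" by blast
qed

definition line_transform :: "real \<Rightarrow> (real \<Rightarrow> complex) \<Rightarrow> complex \<Rightarrow> complex" where
  "line_transform b h \<zeta> = integral UNIV (\<lambda>t. h t * exp (Complex b t * \<zeta>))"

lemma norm_mult_exp_line_le:
  fixes z :: complex
  assumes "norm z \<le> C * exp (- \<nu> * \<bar>t\<bar>)" "\<bar>Im \<zeta>\<bar> \<le> \<theta>" "C \<ge> 0"
  shows "norm (z * exp (Complex b t * \<zeta>)) \<le> C * exp (b * Re \<zeta>) * exp (- (\<nu> - \<theta>) * \<bar>t\<bar>)"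
proof -
  have "- (t * Im \<zeta>) \<le> \<bar>t\<bar> * \<bar>Im \<zeta>\<bar>" using abs_ge_minus_self[of "t * Im \<zeta>"] by (simp add: abs_mult)
  also have "\<dots> \<le> \<bar>t\<bar> * \<theta>" using assms(2) by (intro mult_left_mono) auto
  finally have "Re (Complex b t * \<zeta>) \<le> b * Re \<zeta> + \<bar>t\<bar> * \<theta>" by simp
  hence "norm (z * exp (Complex b t * \<zeta>)) \<le> (C * exp (- \<nu> * \<bar>t\<bar>)) * exp (b * Re \<zeta> + \<bar>t\<bar> * \<theta>)"
    unfolding norm_mult using assms(1,3) by (intro mult_mono) auto
  also have "\<dots> = C * exp (b * Re \<zeta>) * (exp (- \<nu> * \<bar>t\<bar>) * exp (\<bar>t\<bar> * \<theta>))"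
    unfolding exp_add by simp
  also have "exp (- \<nu> * \<bar>t\<bar>) * exp (\<bar>t\<bar> * \<theta>) = exp (- (\<nu> - \<theta>) * \<bar>t\<bar>)"
    unfolding exp_add[symmetric] by (simp add: algebra_simps)
  finally show ?thesis .
qed

lemma exp_decay_mult_exp_line:
  assumes h: "exp_decay \<mu> h"
  shows "exp_decay (\<mu> - \<bar>Im \<zeta>\<bar>) (\<lambda>t. h t * exp (Complex b t * \<zeta>))"
  unfolding exp_decay_def
proof (intro conjI allI impI)
  show "continuous_on UNIV (\<lambda>t. h t * exp (Complex b t * \<zeta>))"
    by (intro continuous_intros exp_decay_continuous[OF h])
  fix \<nu> assume "\<nu> < \<mu> - \<bar>Im \<zeta>\<bar>"
  then obtain C where "C \<ge> 0" "\<And>t. norm (h t) \<le> C * exp (- (\<nu> + \<bar>Im \<zeta>\<bar>) * \<bar>t\<bar>)"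
    using exp_decayE[OF h, of "\<nu> + \<bar>Im \<zeta>\<bar>"] by auto
  from norm_mult_exp_line_le[OF this(2) order_refl this(1), where \<zeta> = \<zeta> and b = b]
  show "\<exists>C. \<forall>t. norm (h t * exp (Complex b t * \<zeta>)) \<le> C * exp (- \<nu> * \<bar>t\<bar>)" by auto
qed

lemma line_transform_integrable:
  assumes "exp_decay \<mu> h" "\<bar>Im \<zeta>\<bar> < \<mu>"
  shows "(\<lambda>t. h t * exp (Complex b t * \<zeta>)) integrable_on UNIV"
  by (rule exp_decay_integrable[OF exp_decay_mult_exp_line[OF assms(1)]]) (use assms(2) in simp)

lemma line_transform_add:
  assumes "exp_decay \<mu> g" "exp_decay \<mu> h" "\<bar>Im \<zeta>\<bar> < \<mu>"
  shows "line_transform b (\<lambda>t. g t + h t) \<zeta> = line_transform b g \<zeta> + line_transform b h \<zeta>"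
  unfolding line_transform_def distrib_right by (intro integral_add line_transform_integrable[OF _ assms(3)] assms)

lemma line_transform_cmult: "line_transform b (\<lambda>t. a * h t) \<zeta> = a * line_transform b h \<zeta>"
  unfolding line_transform_def mult.assoc by (rule integral_mult_right)

lemma norm_line_transform_le:
  assumes h: "exp_decay \<mu> h" and "\<theta> < \<mu>"
  obtains C where "C \<ge> 0" "\<And>\<zeta>. \<bar>Im \<zeta>\<bar> \<le> \<theta> \<Longrightarrow> norm (line_transform b h \<zeta>) \<le> C * exp (b * Re \<zeta>)"
proof -
  obtain \<nu> where \<nu>: "\<theta> < \<nu>" "\<nu> < \<mu>" using dense[OF \<open>\<theta> < \<mu>\<close>] by blast
  obtain C where C: "C \<ge> 0" "\<And>t. norm (h t) \<le> C * exp (- \<nu> * \<bar>t\<bar>)" using exp_decayE[OF h \<nu>(2)] by metis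
  define K where "K = integral UNIV (\<lambda>t. exp (- (\<nu> - \<theta>) * \<bar>t\<bar>))"
  have K: "(\<lambda>t. exp (- (\<nu> - \<theta>) * \<bar>t\<bar>)) integrable_on UNIV" using \<nu> by (intro integrable_exp_minus_abs) auto
  show ?thesis
  proof (rule that[of "C * K"])
    show "C * K \<ge> 0" using C(1) K by (auto simp: K_def intro!: mult_nonneg_nonneg integral_nonneg)
    fix \<zeta> :: complex assume "\<bar>Im \<zeta>\<bar> \<le> \<theta>"
    hence "norm (line_transform b h \<zeta>) \<le> integral UNIV (\<lambda>t. C * exp (b * Re \<zeta>) * exp (- (\<nu> - \<theta>) * \<bar>t\<bar>))"
      unfolding line_transform_def using C \<nu> K
      by (intro integral_norm_bound_integral line_transform_integrable[OF h] norm_mult_exp_line_le integrable_on_mult_right) auto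
    also have "\<dots> = C * K * exp (b * Re \<zeta>)" unfolding K_def integral_mult_right by (simp only: mult_ac)
    finally show "norm (line_transform b h \<zeta>) \<le> C * K * exp (b * Re \<zeta>)" .
  qed
qed

lemma uniform_limit_line_transform:
  assumes h: "exp_decay \<mu> h" and "\<theta> < \<mu>"
    and S: "\<And>\<zeta>. \<zeta> \<in> S \<Longrightarrow> \<bar>Im \<zeta>\<bar> \<le> \<theta> \<and> \<bar>Re \<zeta>\<bar> \<le> r"
  shows "uniform_limit S (\<lambda>n \<zeta>. integral {-real n..real n} (\<lambda>t. h t * exp (Complex b t * \<zeta>))) (line_transform b h) sequentially"
proof (rule uniform_limitI)
  fix e :: real assume "e > 0"
  obtain \<nu> where \<nu>: "\<theta> < \<nu>" "\<nu> < \<mu>" using dense[OF \<open>\<theta> < \<mu>\<close>] by blast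
  obtain C where C: "C \<ge> 0" "\<And>t. norm (h t) \<le> C * exp (- \<nu> * \<bar>t\<bar>)" using exp_decayE[OF h \<nu>(2)] by metis
  define B where "B = (\<lambda>t. C * exp (\<bar>b\<bar> * r) * exp (- (\<nu> - \<theta>) * \<bar>t\<bar>))"
  have B: "B integrable_on UNIV"
    unfolding B_def by (intro integrable_on_mult_right integrable_exp_minus_abs) (use \<nu> in simp)
  have bound: "norm (h t * exp (Complex b t * \<zeta>)) \<le> B t" if "\<zeta> \<in> S" for \<zeta> t
  proof -
    have "b * Re \<zeta> \<le> \<bar>b\<bar> * \<bar>Re \<zeta>\<bar>" using abs_ge_self[of "b * Re \<zeta>"] by (simp add: abs_mult)
    also have "\<dots> \<le> \<bar>b\<bar> * r" using S[OF that] by (intro mult_left_mono) auto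
    finally have "C * exp (b * Re \<zeta>) * exp (- (\<nu> - \<theta>) * \<bar>t\<bar>) \<le> B t"
      unfolding B_def using C(1) by (intro mult_right_mono mult_left_mono) auto
    thus ?thesis using norm_mult_exp_line_le[OF C(2) _ C(1)] S[OF that] order_trans by blast
  qed
  have "(\<lambda>n. integral UNIV B - integral {-real n..real n} B) \<longlonglongrightarrow> integral UNIV B - integral UNIV B"
    by (intro tendsto_intros integral_symmetric_tendsto_sequentially B)
  hence "\<forall>\<^sub>F n in sequentially. integral UNIV B - integral {-real n..real n} B < e"
    using \<open>e > 0\<close> by (intro order_tendstoD(2)) auto
  thus "\<forall>\<^sub>F n in sequentially. \<forall>\<zeta>\<in>S.
     dist (integral {-real n..real n} (\<lambda>t. h t * exp (Complex b t * \<zeta>))) (line_transform b h \<zeta>) < e"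
  proof eventually_elim
    case (elim n)
    show ?case
    proof
      fix \<zeta> assume "\<zeta> \<in> S"
      have "(\<lambda>t. h t * exp (Complex b t * \<zeta>)) integrable_on UNIV"
        using S[OF \<open>\<zeta> \<in> S\<close>] \<open>\<theta> < \<mu>\<close> by (intro line_transform_integrable[OF h]) auto
      from norm_integral_outside_interval_le[OF this B bound[OF \<open>\<zeta> \<in> S\<close>], of "- real n" "real n"] elim
      show "dist (integral {-real n..real n} (\<lambda>t. h t * exp (Complex b t * \<zeta>))) (line_transform b h \<zeta>) < e"
        by (simp add: line_transform_def dist_norm norm_minus_commute)
    qed
  qed
qed

lemma has_field_derivative_integral_exp_line:
  assumes "continuous_on {a..a'} h"
  shows "((\<lambda>\<zeta>. integral {a..a'} (\<lambda>t. h t * exp (Complex b t * \<zeta>))) has_field_derivative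
          integral {a..a'} (\<lambda>t. Complex b t * h t * exp (Complex b t * \<zeta>))) (at \<zeta>)"
proof -
  have "((\<lambda>\<zeta>. integral (cbox a a') (\<lambda>t. h t * exp (Complex b t * \<zeta>))) has_field_derivative
          integral (cbox a a') (\<lambda>t. Complex b t * h t * exp (Complex b t * \<zeta>))) (at \<zeta> within UNIV)"
  proof (rule leibniz_rule_field_derivative)
    show "((\<lambda>\<zeta>. h t * exp (Complex b t * \<zeta>)) has_field_derivative Complex b t * h t * exp (Complex b t * \<zeta>)) (at \<zeta> within UNIV)" for \<zeta> t
      by (auto intro!: derivative_eq_intros)
    show "(\<lambda>t. h t * exp (Complex b t * \<zeta>)) integrable_on cbox a a'" for \<zeta>
      unfolding cbox_interval using assms by (intro integrable_continuous_real continuous_intros)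
    show "continuous_on (UNIV \<times> cbox a a') (\<lambda>(\<zeta>, t). Complex b t * h t * exp (Complex b t * \<zeta>))"
      unfolding split_beta cbox_interval
      by (intro continuous_intros continuous_on_compose2[OF assms continuous_on_snd]) auto
  qed auto
  thus ?thesis by simp
qed

lemma has_field_derivative_line_transform:
  assumes h: "exp_decay \<mu> h" and \<zeta>: "\<bar>Im \<zeta>\<bar> < \<mu>"
  shows "(line_transform b h has_field_derivative line_transform b (\<lambda>t. Complex b t * h t) \<zeta>) (at \<zeta>)"
proof -
  define J where "J = (\<lambda>n \<zeta>. integral {-real n..real n} (\<lambda>t. h t * exp (Complex b t * \<zeta>)))"
  define J' where "J' = (\<lambda>n \<zeta>. integral {-real n..real n} (\<lambda>t. Complex b t * h t * exp (Complex b t * \<zeta>)))"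
  define S where "S = {z. \<bar>Im z\<bar> < \<mu>}"
  have S: "open S" unfolding S_def by (intro open_Collect_less continuous_intros)
  have "\<exists>g'. \<forall>z\<in>S. (line_transform b h has_field_derivative g' z) (at z) \<and> (\<lambda>n. J' n z) \<longlonglongrightarrow> g' z"
  proof (rule has_complex_derivative_uniform_sequence[OF S])
    show "(J n has_field_derivative J' n z) (at z)" for n z
      unfolding J_def J'_def by (intro has_field_derivative_integral_exp_line exp_decay_continuous[OF h])
    fix z assume "z \<in> S"
    define r where "r = (\<mu> - \<bar>Im z\<bar>) / 2"
    have r: "r > 0" "\<bar>Im z\<bar> + r < \<mu>" using \<open>z \<in> S\<close> by (auto simp: S_def r_def field_simps)
    have near: "\<bar>Im w\<bar> \<le> \<bar>Im z\<bar> + r \<and> \<bar>Re w\<bar> \<le> \<bar>Re z\<bar> + r" if "w \<in> cball z r" for w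
      using abs_Im_le_cmod[of "z - w"] abs_Re_le_cmod[of "z - w"] that by (auto simp: dist_norm)
    hence "uniform_limit (cball z r) J (line_transform b h) sequentially"
      unfolding J_def by (rule uniform_limit_line_transform[OF h r(2)])
    moreover have "cball z r \<subseteq> S" using near r(2) unfolding S_def by force
    ultimately show "\<exists>d>0. cball z d \<subseteq> S \<and> uniform_limit (cball z d) J (line_transform b h) sequentially"
      using r(1) by blast
  qed
  moreover have "\<zeta> \<in> S" using \<zeta> by (simp add: S_def)
  ultimately obtain D where D: "(line_transform b h has_field_derivative D) (at \<zeta>)" "(\<lambda>n. J' n \<zeta>) \<longlonglongrightarrow> D" by blast
  have "(\<lambda>n. J' n \<zeta>) \<longlonglongrightarrow> line_transform b (\<lambda>t. Complex b t * h t) \<zeta>"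
    unfolding J'_def line_transform_def
    by (intro integral_symmetric_tendsto_sequentially line_transform_integrable[OF exp_decay_Complex_mult[OF h] \<zeta>])
  with D show ?thesis using LIMSEQ_unique by blast
qed

section \<open>Poles and residues of the kernel\<close>

definition right_pole :: "int \<Rightarrow> nat \<Rightarrow> complex" where
  "right_pole k n = of_int (1 - k) + of_nat n"

definition gap_abscissa :: "int \<Rightarrow> nat \<Rightarrow> real" where
  "gap_abscissa k N = 1 - of_int k + real N - 1/2"

definition gamma_kernel :: "int \<Rightarrow> (complex \<Rightarrow> complex) \<Rightarrow> complex \<Rightarrow> complex" where
  "gamma_kernel k H s = Gamma (1 - of_int k - s) * H s"

text \<open>Minus the residue of the kernel: the contours run clockwise around the right poles.\<close>

definition residue_term :: "int \<Rightarrow> (complex \<Rightarrow> complex) \<Rightarrow> nat \<Rightarrow> complex" where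
  "residue_term k H n = (-1) ^ n / fact n * H (right_pole k n)"

lemma Re_right_pole [simp]: "Re (right_pole k n) = 1 - of_int k + real n"
  and Im_right_pole [simp]: "Im (right_pole k n) = 0"
  by (simp_all add: right_pole_def)

lemma right_pole_pred: "right_pole (k - 1) n = right_pole k n + 1"
  and right_pole_pred_Suc: "right_pole (k - 1) n = right_pole k (Suc n)"
  by (simp_all add: right_pole_def)

lemma gap_abscissa_pred: "gap_abscissa (k - 1) N = gap_abscissa k N + 1"
  and gap_abscissa_pred_Suc: "gap_abscissa (k - 1) N = gap_abscissa k (Suc N)"
  by (simp_all add: gap_abscissa_def)

lemma Re_right_pole_less_gap_iff: "Re (right_pole k n) < gap_abscissa k N \<longleftrightarrow> n < N"
proof -
  have "n < N \<Longrightarrow> real n + 1 \<le> real N" "\<not> n < N \<Longrightarrow> real n \<ge> real N" by linarith+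
  thus ?thesis by (cases "n < N") (auto simp: gap_abscissa_def)
qed

lemma gap_abscissa_at_top: "filterlim (gap_abscissa k) at_top sequentially"
  unfolding gap_abscissa_def by real_asymp

lemma eventually_gap_abscissa_gt: "\<forall>\<^sub>F N in sequentially. x < gap_abscissa k N"
  using gap_abscissa_at_top[of k] unfolding filterlim_at_top_dense by blast

lemma gap_line_not_Ints:
  assumes "Re s = gap_abscissa k N"
  shows "s \<notin> \<int>"
proof
  assume "s \<in> \<int>"
  then obtain i where "s = of_int i" by (elim Ints_cases)
  hence "real_of_int (2 * i) = real_of_int (2 * (1 - k) + 2 * int N - 1)"
    using assms by (simp add: gap_abscissa_def)
  hence "2 * i = 2 * (1 - k) + 2 * int N - 1" using of_int_eq_iff by blast
  thus False by presburger
qed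

lemma right_poles_eq_range: "right_poles k = range (right_pole k)"
  by (auto simp: right_poles_def right_pole_def)

lemma right_poles_iff: "s \<in> right_poles k \<longleftrightarrow> 1 - of_int k - s \<in> \<int>\<^sub>\<le>\<^sub>0"
proof
  assume "1 - of_int k - s \<in> \<int>\<^sub>\<le>\<^sub>0"
  then obtain n where "1 - of_int k - s = - of_nat n" by (auto elim!: nonpos_Ints_cases')
  hence "s = of_int (1 - k) + of_nat n" by (simp add: algebra_simps)
  thus "s \<in> right_poles k" unfolding right_poles_def by blast
qed (auto simp: right_poles_def)

lemma right_poles_subset_Ints: "right_poles k \<subseteq> \<int>"
  by (auto simp: right_poles_def)

lemma sparse_Ints: "(\<int> :: complex set) sparse_in UNIV"
proof (intro uniform_discrete_imp_sparse uniformI2[of 1])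
  fix x y :: complex assume "x \<in> \<int>" "y \<in> \<int>" "x \<noteq> y"
  then obtain i j where "x = of_int i" "y = of_int j" "i \<noteq> j" by (auto elim!: Ints_cases)
  hence "dist x y = of_int \<bar>i - j\<bar>" by (simp add: dist_norm flip: of_int_diff)
  thus "1 \<le> dist x y" using \<open>i \<noteq> j\<close> by linarith
qed simp

lemma sparse_right_poles: "right_poles k sparse_in UNIV"
  using sparse_in_subset2[OF sparse_Ints right_poles_subset_Ints] .

lemma sparse_left_poles: "left_poles L \<beta> c sparse_in UNIV"
proof (rule sparse_in_subset2)
  show "(\<Union>l<L. (+) (- 1 / (\<beta> * c l)) ` \<int>) sparse_in UNIV"
    by (intro sparse_in_UN_finite sparse_in_translate'[OF sparse_Ints]) (auto simp: image_iff algebra_simps intro: exI[of _ "_ + _"])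
  show "left_poles L \<beta> c \<subseteq> (\<Union>l<L. (+) (- 1 / (\<beta> * c l)) ` \<int>)"
    by (force simp: left_poles_def image_iff)
qed

lemma finite_left_poles_Re_ge: "finite (left_poles L \<beta> c \<inter> {s. A \<le> Re s})"
proof (rule finite_subset)
  show "left_poles L \<beta> c \<inter> {s. A \<le> Re s} \<subseteq>
      (\<Union>l<L. (\<lambda>i. - of_nat i - 1 / (\<beta> * c l)) ` {..nat \<lceil>- A - Re (1 / (\<beta> * c l))\<rceil>})"
  proof
    fix p assume "p \<in> left_poles L \<beta> c \<inter> {s. A \<le> Re s}"
    then obtain i l where p: "p = - of_nat i - 1 / (\<beta> * c l)" "l < L" "A \<le> Re p"
      by (auto simp: left_poles_def)
    hence "real i \<le> - A - Re (1 / (\<beta> * c l))" by simp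
    hence "i \<le> nat \<lceil>- A - Re (1 / (\<beta> * c l))\<rceil>" by linarith
    thus "p \<in> (\<Union>l<L. (\<lambda>i. - of_nat i - 1 / (\<beta> * c l)) ` {..nat \<lceil>- A - Re (1 / (\<beta> * c l))\<rceil>})"
      using p by blast
  qed
qed auto

lemma Re_left_pole_le:
  assumes "p \<in> left_poles L \<beta> c"
  shows "Re p \<le> (\<Sum>l<L. norm (1 / (\<beta> * c l)))"
proof -
  obtain i l where p: "p = - of_nat i - 1 / (\<beta> * c l)" "l < L" using assms by (auto simp: left_poles_def)
  have "Re p \<le> norm (1 / (\<beta> * c l))" using complex_Re_le_cmod[of "- (1 / (\<beta> * c l))"] p by simp
  also have "\<dots> \<le> (\<Sum>l<L. norm (1 / (\<beta> * c l)))"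
    by (rule member_le_sum[of l "{..<L}" "\<lambda>l. norm (1 / (\<beta> * c l))"]) (use p in auto)
  finally show ?thesis .
qed

lemma holomorphic_gamma_kernel:
  assumes "H holomorphic_on - X"
  shows "gamma_kernel k H holomorphic_on - (right_poles k \<union> X)"
  unfolding gamma_kernel_def
  by (intro holomorphic_intros holomorphic_on_subset[OF assms]) (auto simp: right_poles_iff)

lemma gamma_kernel_shift: "gamma_kernel k (\<lambda>s. H (s + 1)) = (\<lambda>s. gamma_kernel (k - 1) H (s + 1))"
  by (simp add: gamma_kernel_def fun_eq_iff algebra_simps)

lemma gamma_kernel_pred:
  assumes "s \<notin> \<int>"
  shows "gamma_kernel (k - 1) H s = - (s + of_int (k - 1)) * gamma_kernel k H s"
proof -
  have "1 - of_int k - s \<notin> \<int>" using assms Ints_diff[of "1 - of_int k" "1 - of_int k - s"] by auto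
  hence "1 - of_int k - s \<notin> \<int>\<^sub>\<le>\<^sub>0" using nonpos_Ints_subset_Ints by blast
  hence "Gamma (1 - of_int k - s + 1) = (1 - of_int k - s) * Gamma (1 - of_int k - s)" by (rule Gamma_plus1)
  moreover have "1 - of_int k - s + 1 = 1 - of_int (k - 1) - s" "1 - of_int k - s = - (s + of_int (k - 1))" by simp_all
  ultimately show ?thesis by (simp only: gamma_kernel_def mult.assoc)
qed

lemma residue_term_shift: "residue_term k (\<lambda>s. H (s + 1)) = residue_term (k - 1) H"
  by (simp add: residue_term_def right_pole_pred fun_eq_iff)

lemma residue_gamma_kernel:
  assumes hol: "H holomorphic_on - X" and X: "X sparse_in UNIV" "right_pole k n \<notin> X"
  shows "residue (gamma_kernel k H) (right_pole k n) = - residue_term k H n"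
proof (rule residue_simple')
  let ?p = "right_pole k n"
  let ?U = "- ((right_poles k \<union> X) - {?p})"
  have "(right_poles k \<union> X) - {?p} sparse_in UNIV"
    by (rule sparse_in_subset2[OF sparse_in_union'[OF sparse_right_poles X(1)]]) auto
  thus "open ?U" by (intro open_Compl sparse_in_UNIV_imp_closed)
  show "?p \<in> ?U" by simp
  show "gamma_kernel k H holomorphic_on ?U - {?p}"
    by (rule holomorphic_on_subset[OF holomorphic_gamma_kernel[OF hol]]) (auto simp: right_poles_eq_range)
  have "isCont H ?p"
    using holomorphic_on_imp_continuous_on[OF hol] open_Compl[OF sparse_in_UNIV_imp_closed[OF X(1)]] X(2)
    by (auto simp: continuous_on_eq_continuous_at)
  hence H_tendsto: "H \<midarrow>?p\<rightarrow> H ?p" by (simp add: isCont_def)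
  have "filterlim (\<lambda>w. 1 - of_int k - w) (at (- of_nat n)) (at ?p)"
  proof (rule filterlim_atI)
    show "((\<lambda>w. 1 - of_int k - w) \<longlongrightarrow> - of_nat n) (at ?p)"
      by (auto intro!: tendsto_eq_intros simp: right_pole_def)
    show "\<forall>\<^sub>F w in at ?p. 1 - of_int k - w \<noteq> - of_nat n"
      by (auto simp: eventually_at_filter right_pole_def algebra_simps)
  qed
  from filterlim_compose[OF Gamma_residues this]
  have "(\<lambda>w. Gamma (1 - of_int k - w) * (1 - of_int k - w + of_nat n)) \<midarrow>?p\<rightarrow> (- 1) ^ n / fact n" .
  hence "(\<lambda>w. - (Gamma (1 - of_int k - w) * (1 - of_int k - w + of_nat n) * H w)) \<midarrow>?p\<rightarrow> - residue_term k H n"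
    unfolding residue_term_def by (intro tendsto_intros H_tendsto)
  moreover have "(\<lambda>w. - (Gamma (1 - of_int k - w) * (1 - of_int k - w + of_nat n) * H w))
      = (\<lambda>w. gamma_kernel k H w * (w - ?p))"
    by (auto simp: gamma_kernel_def right_pole_def algebra_simps)
  ultimately show "(\<lambda>w. gamma_kernel k H w * (w - ?p)) \<midarrow>?p\<rightarrow> - residue_term k H n" by simp
qed

lemma Residue_theorem_sparse:
  assumes hol: "f holomorphic_on - X" and X: "X sparse_in UNIV"
    and P: "valid_path P" "pathfinish P = pathstart P" "path_image P \<inter> X = {}"
  shows "contour_integral P f
    = 2 * of_real pi * \<i> * (\<Sum>p\<in>{p \<in> X. winding_number P p \<noteq> 0}. winding_number P p * residue f p)"
proof -
  obtain r where r: "path_image P \<subseteq> ball 0 r"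
    using bounded_subset_ballD[OF bounded_path_image[OF valid_path_imp_path[OF P(1)]]] by metis
  have far: "winding_number P z = 0" if "z \<notin> ball 0 r" for z
    using r P that by (intro winding_number_zero_outside[of P "ball 0 r"]) (auto simp: valid_path_imp_path)
  have fin: "finite (cball 0 r \<inter> X)"
    by (intro sparse_in_compact_finite sparse_in_subset[OF X]) auto
  have "contour_integral P f = 2 * pi * \<i> * (\<Sum>p\<in>cball 0 r \<inter> X. winding_number P p * residue f p)"
  proof (rule Residue_theorem[where S = "ball 0 r"])
    show "f holomorphic_on ball 0 r - cball 0 r \<inter> X" by (rule holomorphic_on_subset[OF hol]) auto
    show "path_image P \<subseteq> ball 0 r - cball 0 r \<inter> X" using r P(3) by auto
  qed (use fin P far in auto)
  also have "(\<Sum>p\<in>cball 0 r \<inter> X. winding_number P p * residue f p)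
      = (\<Sum>p\<in>{p \<in> X. winding_number P p \<noteq> 0}. winding_number P p * residue f p)"
    using far by (intro sum.mono_neutral_right fin) force+
  finally show ?thesis by simp
qed

lemma contour_integral_gamma_kernel_loop:
  assumes hol: "H holomorphic_on - X" and X: "X sparse_in UNIV" "right_poles k \<inter> X = {}"
    and P: "valid_path P" "pathfinish P = pathstart P" "path_image P \<inter> (right_poles k \<union> X) = {}"
    and inside: "\<And>n. n < N \<Longrightarrow> winding_number P (right_pole k n) = -1"
    and outside: "\<And>n. N \<le> n \<Longrightarrow> winding_number P (right_pole k n) = 0"
    and outside_X: "\<And>p. p \<in> X \<Longrightarrow> winding_number P p = 0"
  shows "contour_integral P (gamma_kernel k H) = 2 * of_real pi * \<i> * (\<Sum>n<N. residue_term k H n)"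
proof -
  have winding: "winding_number P (right_pole k n) = (if n < N then -1 else 0)" for n
    using inside outside by simp
  have "{p \<in> right_poles k \<union> X. winding_number P p \<noteq> 0} = right_pole k ` {..<N}"
    using outside_X winding by (auto simp: right_poles_eq_range split: if_splits)
  hence "contour_integral P (gamma_kernel k H)
      = 2 * of_real pi * \<i> * (\<Sum>p\<in>right_pole k ` {..<N}. winding_number P p * residue (gamma_kernel k H) p)"
    using Residue_theorem_sparse[OF holomorphic_gamma_kernel[OF hol] sparse_in_union'[OF sparse_right_poles X(1)] P] by simp
  also have "(\<Sum>p\<in>right_pole k ` {..<N}. winding_number P p * residue (gamma_kernel k H) p)
      = (\<Sum>n<N. winding_number P (right_pole k n) * residue (gamma_kernel k H) (right_pole k n))"
    by (subst sum.reindex) (auto simp: inj_on_def right_pole_def)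
  also have "\<dots> = (\<Sum>n<N. residue_term k H n)"
  proof (intro sum.cong refl)
    fix n assume "n \<in> {..<N}"
    moreover have "right_pole k n \<notin> X" using X(2) by (auto simp: right_poles_eq_range)
    ultimately show "winding_number P (right_pole k n) * residue (gamma_kernel k H) (right_pole k n) = residue_term k H n"
      by (simp add: inside residue_gamma_kernel[OF hol X(1)])
  qed
  finally show ?thesis .
qed

section \<open>Integrals along infinite contours\<close>

definition pullback :: "(complex \<Rightarrow> complex) \<Rightarrow> (real \<Rightarrow> complex) \<Rightarrow> real \<Rightarrow> complex" where
  "pullback f \<gamma> t = f (\<gamma> t) * vector_derivative \<gamma> (at t)"

lemma line_integral_eq_pullback: "line_integral f \<gamma> = integral UNIV (pullback f \<gamma>)"
  unfolding line_integral_def pullback_def ..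

lemma trunc_path_eq_subpath: "trunc_path \<gamma> R = subpath (- R) R \<gamma>"
  by (simp add: trunc_path_def subpath_def fun_eq_iff algebra_simps)

lemma regular_contour_piecewise_C1:
  assumes "regular_contour \<gamma>"
  shows "\<gamma> piecewise_C1_differentiable_on {a..b}"
proof -
  have "{a..b} \<subseteq> {-(max \<bar>a\<bar> \<bar>b\<bar>)..max \<bar>a\<bar> \<bar>b\<bar>}" by auto
  thus ?thesis using assms unfolding regular_contour_def by (meson piecewise_C1_differentiable_on_subset)
qed

lemma regular_contour_continuous:
  assumes "regular_contour \<gamma>"
  shows "continuous_on {a..b} \<gamma>"
  using regular_contour_piecewise_C1[OF assms] by (simp add: piecewise_C1_differentiable_on_def)

lemma regular_contour_bounded:
  assumes "regular_contour \<gamma>"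
  obtains K where "\<And>t. \<bar>t\<bar> \<le> T \<Longrightarrow> norm (\<gamma> t) \<le> K"
proof -
  have "bounded (\<gamma> ` {-T..T})"
    by (intro compact_imp_bounded compact_continuous_image regular_contour_continuous assms) auto
  thus ?thesis using that unfolding bounded_iff by (force simp: abs_le_iff)
qed

lemma regular_contour_differentiable_off_finite:
  assumes "regular_contour \<gamma>"
  obtains S where "finite S" "\<And>t. t \<in> {a..b} - S \<Longrightarrow> \<gamma> differentiable (at t)"
  using regular_contour_piecewise_C1[OF assms, of a b]
  unfolding piecewise_C1_differentiable_on_def C1_differentiable_on_eq by blast

lemma valid_path_subpath_regular_contour:
  assumes "regular_contour \<gamma>" "a \<le> b"
  shows "valid_path (subpath a b \<gamma>)"
proof -
  have "(\<gamma> \<circ> (\<lambda>x. (b - a) *\<^sub>R x + a)) piecewise_C1_differentiable_on {0..1}"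
    by (rule piecewise_C1_differentiable_affine)
       (use assms in \<open>auto simp: image_affinity_atLeastAtMost intro: regular_contour_piecewise_C1\<close>)
  thus ?thesis by (simp add: valid_path_def subpath_def o_def)
qed

lemma path_subpath_regular_contour: "regular_contour \<gamma> \<Longrightarrow> a \<le> b \<Longrightarrow> path (subpath a b \<gamma>)"
  by (intro valid_path_imp_path valid_path_subpath_regular_contour)

lemma path_image_subpath_real: "a \<le> b \<Longrightarrow> path_image (subpath a b \<gamma>) = \<gamma> ` {a..b}"
  by (simp add: path_image_subpath_gen closed_segment_eq_real_ivl)

text \<open>A path that is piecewise C1 in the sense of the library may have infinite length, so over bounded
  parameter intervals the integrals are only Henstock-Kurzweil integrals; absolute integrability is
  available on the straight ends alone.\<close>

lemma has_integral_pullback_subpath: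
  assumes \<gamma>: "regular_contour \<gamma>" and "a < b" and f: "f contour_integrable_on subpath a b \<gamma>"
  shows "(pullback f \<gamma> has_integral contour_integral (subpath a b \<gamma>) f) {a..b}"
proof -
  let ?g = "subpath a b \<gamma>" and ?m = "\<lambda>u. (b - a) *\<^sub>R u + a"
  obtain S where S: "finite S" "\<And>t. t \<in> {a..b} - S \<Longrightarrow> \<gamma> differentiable (at t)"
    using regular_contour_differentiable_off_finite[OF \<gamma>] by metis
  have "finite (?m -` S)" using S(1) \<open>a < b\<close> by (intro finite_vimageI) (auto simp: inj_on_def)
  moreover have "pullback f \<gamma> (?m u) = f (?g u) * vector_derivative ?g (at u) /\<^sub>R (b - a)"
    if "u \<in> {0..1} - ?m -` S" for u
  proof -
    have "0 \<le> (b - a) * u" "(b - a) * u \<le> b - a" using that \<open>a < b\<close> by (auto intro: mult_left_le)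
    hence "?m u \<in> {a..b}" by simp
    hence "(\<gamma> has_vector_derivative vector_derivative \<gamma> (at (?m u))) (at (?m u))"
      using S(2) that by (auto simp: vector_derivative_works)
    moreover have "(?m has_vector_derivative (b - a)) (at u)" by (auto intro!: derivative_eq_intros)
    ultimately have "(\<gamma> \<circ> ?m has_vector_derivative (b - a) *\<^sub>R vector_derivative \<gamma> (at (?m u))) (at u)"
      by (intro vector_diff_chain_at)
    hence "vector_derivative ?g (at u) = (b - a) *\<^sub>R vector_derivative \<gamma> (at (?m u))"
      by (simp add: subpath_def o_def vector_derivative_at)
    thus ?thesis using \<open>a < b\<close> by (simp add: pullback_def subpath_def)
  qed
  moreover have "((\<lambda>u. f (?g u) * vector_derivative ?g (at u) /\<^sub>R (b - a)) has_integral contour_integral ?g f /\<^sub>R (b - a)) {0..1}"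
    using has_contour_integral_integral[OF f] unfolding has_contour_integral by (rule has_integral_cmul)
  ultimately have "((\<lambda>u. pullback f \<gamma> (?m u)) has_integral contour_integral ?g f /\<^sub>R (b - a)) {0..1}"
    by (rule has_integral_spike_finite)
  thus ?thesis
    using has_integral_affinity_iff[of "b - a" "pullback f \<gamma>" a "contour_integral ?g f" a b] \<open>a < b\<close> by simp
qed

lemma vector_derivative_eq_if_eq_on_open:
  assumes "open S" "t \<in> S" "\<And>x. x \<in> S \<Longrightarrow> \<gamma> x = h x" "(h has_vector_derivative D) (at t)"
  shows "vector_derivative \<gamma> (at t) = D"
  using has_vector_derivative_transform_within_open[OF assms(4,1,2)] assms(3) by (metis vector_derivative_at)

lemma has_vector_derivative_Complex:
  "((\<lambda>t. Complex t y) has_vector_derivative 1) (at t)"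
  "((\<lambda>t. Complex (-t) y) has_vector_derivative -1) (at t)"
  "((\<lambda>t. Complex x t) has_vector_derivative \<i>) (at t)"
  unfolding Complex_eq by (auto intro!: derivative_eq_intros)

lemma norm_contour_integral_linepath_le:
  assumes "\<And>z. z \<in> closed_segment a b \<Longrightarrow> norm (f z) \<le> B" "0 \<le> B"
  shows "norm (contour_integral (linepath a b) f) \<le> B * norm (b - a)"
  using contour_integral_bound_linepath[of f a b B] not_integrable_contour_integral[of f "linepath a b"] assms
  by (cases "f contour_integrable_on linepath a b") auto

lemma strip_decay_horizontal_integral_tendsto_0:
  assumes decay: "strip_decay \<mu> f" "\<mu> > 0" and y: "filterlim (\<lambda>x. \<bar>y x\<bar>) at_top F"
  shows "((\<lambda>x. contour_integral (linepath (Complex a (y x)) (Complex b (y x))) f) \<longlongrightarrow> 0) F"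
proof -
  obtain C T where C: "C > 0"
    and bound: "\<And>s. \<bar>Re s\<bar> \<le> \<bar>a\<bar> + \<bar>b\<bar> \<Longrightarrow> T \<le> \<bar>Im s\<bar> \<Longrightarrow> norm (f s) \<le> C * exp (- (\<mu>/2) * \<bar>Im s\<bar>)"
    using strip_decayE[OF decay(1), of "\<mu>/2"] decay(2) by auto
  have "((\<lambda>r. C * exp (- (\<mu>/2) * r) * \<bar>b - a\<bar>) \<longlongrightarrow> 0) at_top" using decay(2) by real_asymp
  from filterlim_compose[OF this y]
  have "((\<lambda>x. C * exp (- (\<mu>/2) * \<bar>y x\<bar>) * \<bar>b - a\<bar>) \<longlongrightarrow> 0) F" .
  moreover have "\<forall>\<^sub>F x in F. norm (contour_integral (linepath (Complex a (y x)) (Complex b (y x))) f)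
      \<le> C * exp (- (\<mu>/2) * \<bar>y x\<bar>) * \<bar>b - a\<bar>"
  proof -
    have "\<forall>\<^sub>F x in F. T \<le> \<bar>y x\<bar>" using y by (simp add: filterlim_at_top)
    thus ?thesis
    proof eventually_elim
      case (elim x)
      have "norm (f z) \<le> C * exp (- (\<mu>/2) * \<bar>y x\<bar>)" if "z \<in> closed_segment (Complex a (y x)) (Complex b (y x))" for z
        using bound[of z] elim that by (auto simp: closed_segment_same_Im closed_segment_eq_real_ivl split: if_splits)
      hence "norm (contour_integral (linepath (Complex a (y x)) (Complex b (y x))) f)
          \<le> C * exp (- (\<mu>/2) * \<bar>y x\<bar>) * norm (Complex b (y x) - Complex a (y x))"
        by (intro norm_contour_integral_linepath_le) (use C in auto)
      thus ?case by (simp add: cmod_def)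
    qed
  qed
  ultimately show ?thesis by (rule Lim_null_comparison[rotated])
qed

lemma countable_if_discrete:
  fixes Z :: "'a :: second_countable_topology set"
  assumes "discrete Z"
  shows "countable Z"
proof -
  obtain B :: "'a set set" where B: "countable B" "topological_basis B"
    using ex_countable_basis by blast
  have "Z \<subseteq> (\<lambda>V. THE t. V \<inter> Z = {t}) ` B"
  proof
    fix t assume "t \<in> Z"
    then obtain U where U: "open U" "U \<inter> Z = {t}"
      using isolated_inE[OF discreteD[OF assms]] by metis
    then obtain V where V: "V \<in> B" "t \<in> V" "V \<subseteq> U" using B(2) by (metis IntD1 insertI1 topological_basisE)
    hence "V \<inter> Z = {t}" using U by blast
    hence "(THE t. V \<inter> Z = {t}) = t" by auto
    thus "t \<in> (\<lambda>V. THE t. V \<inter> Z = {t}) ` B" using V by force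
  qed
  thus ?thesis using B countable_subset by blast
qed

lemma eventually_neq_if_vector_derivative_nonzero:
  fixes \<gamma> :: "real \<Rightarrow> 'a :: real_normed_vector"
  assumes D: "(\<gamma> has_vector_derivative D) (at t)" and "D \<noteq> 0"
  shows "\<forall>\<^sub>F x in at t. \<gamma> x \<noteq> \<gamma> t"
proof -
  obtain d where d: "d > 0" "\<And>x. norm (x - t) < d \<Longrightarrow> norm (\<gamma> x - \<gamma> t - (x - t) *\<^sub>R D) \<le> norm D / 2 * norm (x - t)"
    using D \<open>D \<noteq> 0\<close> unfolding has_vector_derivative_def has_derivative_at_alt by (meson half_gt_zero zero_less_norm_iff)
  have "\<gamma> x \<noteq> \<gamma> t" if "x \<noteq> t" "dist x t < d" for x
  proof
    assume "\<gamma> x = \<gamma> t"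
    hence "norm (x - t) * norm D \<le> norm (x - t) * (norm D / 2)" using d(2)[of x] that(2) by (simp add: dist_norm)
    hence "norm D \<le> norm D / 2" using that(1) by (simp add: mult_le_cancel_left)
    thus False using \<open>D \<noteq> 0\<close> by simp
  qed
  thus ?thesis using d(1) unfolding eventually_at by blast
qed

lemma countable_regular_contour_moving_preimage:
  assumes "regular_contour \<gamma>"
  shows "countable {t. \<gamma> t = q \<and> vector_derivative \<gamma> (at t) \<noteq> 0}"
proof -
  define Z where "Z = {t. \<gamma> t = q \<and> \<gamma> differentiable (at t) \<and> vector_derivative \<gamma> (at t) \<noteq> 0}"
  have "discrete Z"
  proof (rule discreteI)
    fix t assume "t \<in> Z"
    hence "\<forall>\<^sub>F x in at t. \<gamma> x \<noteq> \<gamma> t"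
      by (intro eventually_neq_if_vector_derivative_nonzero) (auto simp: Z_def vector_derivative_works)
    hence "\<forall>\<^sub>F x in at t. x \<notin> Z" by eventually_elim (use \<open>t \<in> Z\<close> in \<open>auto simp: Z_def\<close>)
    thus "t isolated_in Z" using \<open>t \<in> Z\<close> by (simp add: isolated_in_altdef)
  qed
  hence Z: "countable Z" by (rule countable_if_discrete)
  have "\<exists>S. finite S \<and> (\<forall>t\<in>{-real n..real n} - S. \<gamma> differentiable (at t))" for n :: nat
    using regular_contour_differentiable_off_finite[OF assms] by metis
  then obtain S where S: "\<And>n::nat. finite (S n)" "\<And>n t. t \<in> {-real n..real n} - S n \<Longrightarrow> \<gamma> differentiable (at t)"
    by metis
  have "countable (\<Union>n. S n)" using S(1) by (auto intro: countable_finite)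
  moreover have "{t. \<gamma> t = q \<and> vector_derivative \<gamma> (at t) \<noteq> 0} \<subseteq> Z \<union> (\<Union>n. S n)"
  proof
    fix t assume t: "t \<in> {t. \<gamma> t = q \<and> vector_derivative \<gamma> (at t) \<noteq> 0}"
    obtain n :: nat where "\<bar>t\<bar> \<le> real n" using real_arch_simple by blast
    hence "t \<in> {-real n..real n}" by auto
    thus "t \<in> Z \<union> (\<Union>n. S n)" using S(2)[of t n] t by (auto simp: Z_def)
  qed
  ultimately show ?thesis using Z by (meson countable_Un countable_subset)
qed

lemma line_integral_cong_off_finite:
  assumes reg: "regular_contour \<gamma>" and X: "finite X" and eq: "\<And>t. \<gamma> t \<notin> X \<Longrightarrow> f (\<gamma> t) = g (\<gamma> t)"
  shows "line_integral f \<gamma> = line_integral g \<gamma>"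
  unfolding line_integral_def
proof (rule integral_spike)
  let ?N = "\<Union>q\<in>X. {t. \<gamma> t = q \<and> vector_derivative \<gamma> (at t) \<noteq> 0}"
  have "countable ?N"
    by (intro countable_UN countable_finite[OF X] countable_regular_contour_moving_preimage[OF reg])
  thus "negligible ?N"
    by (simp add: negligible_iff_null_sets null_sets_completionI countable_imp_null_set_lborel)
  fix t assume "t \<in> UNIV - ?N"
  thus "g (\<gamma> t) * vector_derivative \<gamma> (at t) = f (\<gamma> t) * vector_derivative \<gamma> (at t)"
    using eq[of t] by (cases "\<gamma> t \<in> X") auto
qed

section \<open>Closing a contour on the right\<close>

lemma winding_number_eq_in_simply_connected:
  assumes "simply_connected S" "p \<notin> S"
    and "path g" "path_image g \<subseteq> S" "path h" "path_image h \<subseteq> S"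
    and "pathstart g = pathstart h" "pathfinish g = pathfinish h"
  shows "winding_number g p = winding_number h p"
proof -
  have "homotopic_paths S g h" using assms by (simp add: simply_connected_eq_homotopic_paths)
  hence "homotopic_paths (- {p}) g h" by (rule homotopic_paths_subset) (use assms(2) in auto)
  thus ?thesis by (rule winding_number_homotopic_paths)
qed

lemma simply_connected_slit_plane: "simply_connected {z. Im z \<noteq> Im p \<or> Re p < Re z}"
proof -
  have "(+) p ` (- (complex_of_real ` {..0})) = {z. Im z \<noteq> Im p \<or> Re p < Re z}"
  proof (intro set_eqI iffI)
    fix z assume "z \<in> {z. Im z \<noteq> Im p \<or> Re p < Re z}"
    hence "z - p \<in> - (complex_of_real ` {..0})" by (auto simp: complex_slot_left_eq)
    hence "p + (z - p) \<in> (+) p ` (- (complex_of_real ` {..0}))" by (rule imageI)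
    thus "z \<in> (+) p ` (- (complex_of_real ` {..0}))" by simp
  qed (auto simp: complex_slot_left_eq)
  thus ?thesis
    using homeomorphic_simply_connected_eq[OF homeomorphic_translation, of "- (complex_of_real ` {..0})" p]
      simply_connected_slotted_complex_plane_left[of 0] by simp
qed

lemma winding_number_subpath_add:
  assumes "regular_contour \<gamma>" "p \<notin> range \<gamma>" "u \<le> v" "v \<le> w"
  shows "winding_number (subpath u v \<gamma>) p + winding_number (subpath v w \<gamma>) p = winding_number (subpath u w \<gamma>) p"
proof (cases "u = w")
  case True
  have "p \<noteq> \<gamma> v" using assms(2) by blast
  thus ?thesis using True assms by simp
next
  case False
  define x where "x = (v - u) / (w - u)"
  let ?g = "subpath u w \<gamma>"
  have g: "path ?g" "p \<notin> path_image ?g"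
    using assms by (auto intro: path_subpath_regular_contour simp: path_image_subpath_real)
  have x: "(w - u) * x = v - u" "x \<in> {0..1}" using assms False by (auto simp: x_def)
  have reparam: "(w - u) * (x * t) = (v - u) * t" "(w - u) * ((1 - x) * t + x) + u = (w - v) * t + v" for t
  proof -
    show first: "(w - u) * (x * t) = (v - u) * t" by (simp flip: x(1))
    have "(w - u) * ((1 - x) * t + x) + u = (w - u) * t - (w - u) * (x * t) + (w - u) * x + u"
      by (simp add: algebra_simps)
    thus "(w - u) * ((1 - x) * t + x) + u = (w - v) * t + v"
      unfolding first x(1) by (simp add: algebra_simps)
  qed
  have "subpath 0 x ?g = subpath u v \<gamma>" "subpath x 1 ?g = subpath v w \<gamma>"
    by (simp_all add: subpath_def fun_eq_iff reparam)
  thus ?thesis using winding_number_subpath_combine[OF g, of 0 x 1] x(2) by simp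
qed

locale pole_contour =
  fixes k :: int and X :: "complex set" and \<gamma> :: "real \<Rightarrow> complex"
  assumes regular: "regular_contour \<gamma>"
    and sparse: "X sparse_in UNIV"
    and disjoint: "right_poles k \<inter> X = {}"
    and avoids: "range \<gamma> \<inter> (right_poles k \<union> X) = {}"
begin

abbreviation poles :: "complex set" where "poles \<equiv> right_poles k \<union> X"

lemma contour_integrable_gamma_kernel:
  assumes "H holomorphic_on - X" "valid_path g" "path_image g \<inter> poles = {}"
  shows "gamma_kernel k H contour_integrable_on g"
proof (rule contour_integrable_holomorphic_simple[OF holomorphic_gamma_kernel[OF assms(1)]])
  show "open (- poles)"
    by (intro open_Compl sparse_in_UNIV_imp_closed sparse_in_union' sparse_right_poles sparse)
qed (use assms in auto)

lemma has_integral_pullback_gamma_kernel: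
  assumes "H holomorphic_on - X" "R > 0"
  shows "(pullback (gamma_kernel k H) \<gamma> has_integral contour_integral (trunc_path \<gamma> R) (gamma_kernel k H)) {-R..R}"
  unfolding trunc_path_eq_subpath using assms avoids
  by (intro has_integral_pullback_subpath contour_integrable_gamma_kernel valid_path_subpath_regular_contour regular)
     (auto simp: path_image_subpath_real)

lemma path_trunc_path: "R \<ge> 0 \<Longrightarrow> valid_path (trunc_path \<gamma> R)" "R \<ge> 0 \<Longrightarrow> path (trunc_path \<gamma> R)"
  unfolding trunc_path_eq_subpath by (auto intro: path_subpath_regular_contour valid_path_subpath_regular_contour regular)

lemma closed_contour_expansion:
  assumes hol: "H holomorphic_on - X" and "R > 0"
    and h: "valid_path h" "pathstart h = \<gamma> R" "pathfinish h = \<gamma> (- R)" "path_image h \<inter> poles = {}"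
    and left: "\<And>z. z \<in> \<gamma> ` {-R..R} \<union> path_image h \<Longrightarrow> Re z \<le> gap_abscissa k N"
    and inside: "\<And>n. n < N \<Longrightarrow> winding_number (trunc_path \<gamma> R +++ h) (right_pole k n) = -1"
    and outside: "\<And>p. p \<in> X \<Longrightarrow> winding_number (trunc_path \<gamma> R +++ h) p = 0"
  shows "integral {-R..R} (pullback (gamma_kernel k H) \<gamma>) + contour_integral h (gamma_kernel k H)
      = 2 * of_real pi * \<i> * (\<Sum>n<N. residue_term k H n)"
proof -
  let ?P = "trunc_path \<gamma> R +++ h"
  have ends: "pathfinish (trunc_path \<gamma> R) = pathstart h" "pathstart (trunc_path \<gamma> R) = \<gamma> (- R)"
    using h by (simp_all add: trunc_path_eq_subpath)
  have image: "path_image ?P = \<gamma> ` {-R..R} \<union> path_image h"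
    using ends \<open>R > 0\<close> by (simp add: path_image_join trunc_path_eq_subpath path_image_subpath_real)
  have P: "valid_path ?P" "pathfinish ?P = pathstart ?P" "path_image ?P \<inter> poles = {}"
    using h ends path_trunc_path[of R] avoids \<open>R > 0\<close> unfolding image by auto
  have far: "winding_number ?P (right_pole k n) = 0" if "N \<le> n" for n
  proof (rule winding_number_zero_outside[OF valid_path_imp_path[OF P(1)] convex_halfspace_Re_le P(2)])
    show "right_pole k n \<notin> {z. Re z \<le> gap_abscissa k N}" using that by (simp add: gap_abscissa_def)
    show "path_image ?P \<subseteq> {z. Re z \<le> gap_abscissa k N}" unfolding image using left by auto
  qed
  have "contour_integral (trunc_path \<gamma> R) (gamma_kernel k H) + contour_integral h (gamma_kernel k H)
      = contour_integral ?P (gamma_kernel k H)"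
    using ends h avoids path_trunc_path[of R] \<open>R > 0\<close>
    by (intro contour_integral_join[symmetric] contour_integrable_gamma_kernel[OF hol])
       (auto simp: trunc_path_eq_subpath path_image_subpath_real)
  also have "\<dots> = 2 * of_real pi * \<i> * (\<Sum>n<N. residue_term k H n)"
    by (rule contour_integral_gamma_kernel_loop[OF hol sparse disjoint P inside far outside])
  finally show ?thesis using has_integral_pullback_gamma_kernel[OF hol \<open>R > 0\<close>] by (simp add: integral_unique)
qed

end

section \<open>Vertical contours\<close>

definition right_of_left_poles :: "nat \<Rightarrow> complex \<Rightarrow> (nat \<Rightarrow> complex) \<Rightarrow> real \<Rightarrow> bool" where
  "right_of_left_poles L \<beta> c b \<longleftrightarrow> (\<forall>p\<in>left_poles L \<beta> c. Re p < b)"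

lemma eventually_right_of_left_poles: "\<forall>\<^sub>F N in sequentially. right_of_left_poles L \<beta> c (gap_abscissa k N)"
proof -
  have "\<forall>\<^sub>F N in sequentially. (\<Sum>l<L. norm (1 / (\<beta> * c l))) < gap_abscissa k N"
    by (rule eventually_gap_abscissa_gt)
  thus ?thesis
  proof eventually_elim
    case (elim N)
    thus ?case using Re_left_pole_le unfolding right_of_left_poles_def by (meson le_less_trans)
  qed
qed

lemma exp_decay_gap_line:
  assumes hol: "H holomorphic_on - left_poles L \<beta> c" and right: "right_of_left_poles L \<beta> c (gap_abscissa k N)"
    and decay: "strip_decay \<mu> (gamma_kernel k H)"
  shows "exp_decay \<mu> (\<lambda>t. gamma_kernel k H (Complex (gap_abscissa k N) t))"
proof (rule strip_decay_imp_exp_decay[OF decay])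
  have "Complex (gap_abscissa k N) t \<notin> right_poles k \<union> left_poles L \<beta> c" for t
    using gap_line_not_Ints[of "Complex (gap_abscissa k N) t" k N] right_poles_subset_Ints right
    by (auto simp: right_of_left_poles_def)
  thus "continuous_on UNIV (\<lambda>t. gamma_kernel k H (Complex (gap_abscissa k N) t))"
    by (intro continuous_on_compose2[OF holomorphic_on_imp_continuous_on[OF holomorphic_gamma_kernel[OF hol]]] continuous_intros) auto
qed

definition right_box :: "real \<Rightarrow> real \<Rightarrow> real \<Rightarrow> real \<Rightarrow> complex" where
  "right_box a b R = linepath (Complex a R) (Complex b R) +++
     linepath (Complex b R) (Complex b (- R)) +++ linepath (Complex b (- R)) (Complex a (- R))"

lemma valid_path_right_box [simp]: "valid_path (right_box a b R)"
  and path_right_box [simp]: "path (right_box a b R)"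
  and pathstart_right_box [simp]: "pathstart (right_box a b R) = Complex a R"
  and pathfinish_right_box [simp]: "pathfinish (right_box a b R) = Complex a (- R)"
  by (simp_all add: right_box_def)

lemma path_image_right_box:
  assumes "a \<le> b" "0 \<le> R" "z \<in> path_image (right_box a b R)"
  shows "a \<le> Re z" "Re z \<le> b" "\<bar>Im z\<bar> = R \<or> Re z = b"
  using assms by (auto simp: right_box_def path_image_join closed_segment_same_Re closed_segment_same_Im
      closed_segment_eq_real_ivl split: if_splits)

lemma contour_integral_right_box:
  assumes "0 < R" "f contour_integrable_on linepath (Complex a R) (Complex b R)"
    "f contour_integrable_on linepath (Complex b R) (Complex b (- R))"
    "f contour_integrable_on linepath (Complex b (- R)) (Complex a (- R))"
  shows "contour_integral (right_box a b R) f = contour_integral (linepath (Complex a R) (Complex b R)) f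
    - \<i> * integral {-R..R} (\<lambda>t. f (Complex b t)) + contour_integral (linepath (Complex b (- R)) (Complex a (- R))) f"
proof -
  have "contour_integral (linepath (Complex b R) (Complex b (- R))) f
      = - contour_integral (linepath (Complex b (- R)) (Complex b R)) f"
    using contour_integral_reversepath[of "linepath (Complex b R) (Complex b (- R))" f] by simp
  also have "\<dots> = - (\<i> * integral {-R..R} (\<lambda>t. f (Complex b t)))"
    using contour_integral_linepath_same_Re[of "Complex b (-R)" b "Complex b R" "-R" R f] \<open>0 < R\<close> by simp
  finally show ?thesis using assms by (simp add: right_box_def contour_integrable_joinI)
qed

locale vertical_pole_contour = pole_contour k "left_poles L \<beta> c" \<gamma>
  for L \<beta> c k \<gamma> +
  fixes a T :: real
  assumes tail: "\<And>t. T \<le> \<bar>t\<bar> \<Longrightarrow> \<gamma> t = Complex a t"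
    and winding_right: "\<And>p. p \<in> right_poles k \<Longrightarrow> \<forall>\<^sub>F R in at_top. winding_number (vclose \<gamma> R) p = -1"
    and winding_left: "\<And>p. p \<in> left_poles L \<beta> c \<Longrightarrow> \<forall>\<^sub>F R in at_top. winding_number (vclose \<gamma> R) p = 0"
begin

definition right_of_contour :: "real \<Rightarrow> bool" where
  "right_of_contour b \<longleftrightarrow> a < b \<and> (\<forall>t. Re (\<gamma> t) \<le> b) \<and> right_of_left_poles L \<beta> c b"

lemma abs_Re_contour_bounded: obtains A where "\<And>t. \<bar>Re (\<gamma> t)\<bar> \<le> A"
proof -
  obtain K where K: "\<And>t. \<bar>t\<bar> \<le> T \<Longrightarrow> norm (\<gamma> t) \<le> K" using regular_contour_bounded[OF regular] by metis
  have "\<bar>Re (\<gamma> t)\<bar> \<le> max K \<bar>a\<bar>" for t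
    using K[of t] tail[of t] abs_Re_le_cmod[of "\<gamma> t"] by (cases "\<bar>t\<bar> \<le> T") auto
  thus ?thesis by (rule that)
qed

lemma eventually_right_of_contour: "\<forall>\<^sub>F N in sequentially. right_of_contour (gap_abscissa k N)"
proof -
  obtain A where A: "\<And>t. \<bar>Re (\<gamma> t)\<bar> \<le> A" using abs_Re_contour_bounded by metis
  have "\<forall>\<^sub>F N in sequentially. max a A < gap_abscissa k N"
    by (rule eventually_gap_abscissa_gt)
  with eventually_right_of_left_poles[of L \<beta> c k] show ?thesis
  proof eventually_elim
    case (elim N)
    have "Re (\<gamma> t) \<le> gap_abscissa k N" for t using A[of t] elim by auto
    thus ?case using elim by (simp add: right_of_contour_def)
  qed
qed

lemma winding_number_right_box:
  assumes "p \<in> poles" "Re p < b" "\<bar>Im p\<bar> < R" "max T (max a b) < R" "a < b"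
  shows "winding_number (trunc_path \<gamma> R +++ right_box a b R) p = winding_number (vclose \<gamma> R) p"
proof -
  let ?S = "{z. Im z \<noteq> Im p \<or> Re p < Re z}"
  have ends: "\<gamma> R = Complex a R" "\<gamma> (- R) = Complex a (- R)" using tail assms(4) by auto
  have image: "path_image (right_box a b' R) \<subseteq> ?S" if "b \<le> b'" for b'
  proof
    fix z assume "z \<in> path_image (right_box a b' R)"
    hence "\<bar>Im z\<bar> = R \<or> Re z = b'" by (rule path_image_right_box(3)[rotated 2]) (use assms that in auto)
    thus "z \<in> ?S" using assms that by auto
  qed
  have join: "winding_number (trunc_path \<gamma> R +++ right_box a b' R) p
      = winding_number (trunc_path \<gamma> R) p + winding_number (right_box a b' R) p" if "b \<le> b'" for b'
  proof (rule winding_number_join)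
    show "path (trunc_path \<gamma> R)" by (rule path_trunc_path) (use assms in auto)
    show "p \<notin> path_image (trunc_path \<gamma> R)"
      using avoids assms by (auto simp: trunc_path_eq_subpath path_image_subpath_real)
    show "pathfinish (trunc_path \<gamma> R) = pathstart (right_box a b' R)" by (simp add: trunc_path_eq_subpath ends)
  qed (use image[OF that] in auto)
  have "vclose \<gamma> R = trunc_path \<gamma> R +++ right_box a R R" by (simp add: vclose_def right_box_def ends)
  moreover have "winding_number (right_box a b R) p = winding_number (right_box a R R) p"
    by (rule winding_number_eq_in_simply_connected[OF simply_connected_slit_plane[of p]]) (use image assms in auto)
  ultimately show ?thesis using join[of b] join[of R] assms by simp
qed

lemma winding_number_right_box_left:
  assumes "\<And>t. A \<le> Re (\<gamma> t)" "A \<le> a" "Re p < A" "a \<le> b" "max 0 T < R"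
  shows "winding_number (trunc_path \<gamma> R +++ right_box a b R) p = 0"
proof -
  have ends: "\<gamma> R = Complex a R" "\<gamma> (- R) = Complex a (- R)" using tail assms(5) by auto
  have "A \<le> Re z" if "z \<in> path_image (right_box a b R)" for z
    using path_image_right_box(1)[OF _ _ that] assms by auto
  hence "path_image (trunc_path \<gamma> R +++ right_box a b R) \<subseteq> {z. A \<le> Re z}"
    using assms by (intro subset_path_image_join) (auto simp: trunc_path_eq_subpath path_image_subpath_real)
  thus ?thesis using path_trunc_path[of R] assms
    by (intro winding_number_zero_outside[of _ "{z. A \<le> Re z}"])
       (auto simp: convex_halfspace_Re_ge trunc_path_eq_subpath ends)
qed

lemma path_image_right_box_Int_poles:
  assumes right: "right_of_contour (gap_abscissa k N)" and "0 < R"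
    and low: "\<And>p. p \<in> left_poles L \<beta> c \<Longrightarrow> a \<le> Re p \<Longrightarrow> \<bar>Im p\<bar> < R"
  shows "path_image (right_box a (gap_abscissa k N) R) \<inter> poles = {}"
proof -
  have "z \<notin> poles" if "z \<in> path_image (right_box a (gap_abscissa k N) R)" for z
  proof -
    have box: "a \<le> Re z" "\<bar>Im z\<bar> = R \<or> Re z = gap_abscissa k N"
      using path_image_right_box[OF _ _ that] right \<open>0 < R\<close> by (auto simp: right_of_contour_def)
    hence "z \<notin> right_poles k"
      using \<open>0 < R\<close> gap_line_not_Ints[of z k N] right_poles_subset_Ints by (auto simp: right_poles_eq_range)
    moreover have "z \<notin> left_poles L \<beta> c"
      using box low[of z] right by (auto simp: right_of_contour_def right_of_left_poles_def)
    ultimately show ?thesis by blast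
  qed
  thus ?thesis by blast
qed

lemma right_box_expansion:
  assumes hol: "H holomorphic_on - left_poles L \<beta> c" and right: "right_of_contour (gap_abscissa k N)"
  defines "b \<equiv> gap_abscissa k N"
  shows "\<forall>\<^sub>F R in at_top. path_image (right_box a b R) \<inter> poles = {} \<and>
     integral {-R..R} (pullback (gamma_kernel k H) \<gamma>) + contour_integral (right_box a b R) (gamma_kernel k H)
       = 2 * of_real pi * \<i> * (\<Sum>n<N. residue_term k H n)"
proof -
  obtain A where A: "\<And>t. \<bar>Re (\<gamma> t)\<bar> \<le> A" using abs_Re_contour_bounded by metis
  define A' where "A' = - max A \<bar>a\<bar>"
  define F where "F = left_poles L \<beta> c \<inter> {s. A' \<le> Re s}"
  have A': "A' \<le> Re (\<gamma> t)" "A' \<le> a" for t using A[of t] by (auto simp: A'_def)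
  have b: "a < b" "\<And>t. Re (\<gamma> t) \<le> b" "\<And>p. p \<in> left_poles L \<beta> c \<Longrightarrow> Re p < b"
    using right by (auto simp: right_of_contour_def right_of_left_poles_def b_def)
  have "finite F" unfolding F_def by (rule finite_left_poles_Re_ge)
  hence "\<forall>\<^sub>F R in at_top. max 0 (max T (max a b)) < R \<and> (\<forall>p\<in>F. \<bar>Im p\<bar> < R) \<and>
      (\<forall>n\<in>{..<N}. winding_number (vclose \<gamma> R) (right_pole k n) = -1) \<and> (\<forall>p\<in>F. winding_number (vclose \<gamma> R) p = 0)"
    by (intro eventually_conj eventually_ball_finite ballI eventually_gt_at_top winding_right winding_left)
       (auto simp: F_def right_poles_eq_range)
  thus ?thesis
  proof eventually_elim
    case (elim R)
    have box_poles: "path_image (right_box a b R) \<inter> poles = {}"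
      unfolding b_def using elim A'(2) by (intro path_image_right_box_Int_poles right) (auto simp: F_def)
    have "integral {-R..R} (pullback (gamma_kernel k H) \<gamma>) + contour_integral (right_box a b R) (gamma_kernel k H)
        = 2 * of_real pi * \<i> * (\<Sum>n<N. residue_term k H n)"
    proof (rule closed_contour_expansion[OF hol])
      show "Re z \<le> gap_abscissa k N" if "z \<in> \<gamma> ` {-R..R} \<union> path_image (right_box a b R)" for z
        using that b(1,2) path_image_right_box(2)[of a b R z] elim by (auto simp: b_def)
      show "winding_number (trunc_path \<gamma> R +++ right_box a b R) (right_pole k n) = -1" if "n < N" for n
        using winding_number_right_box[of "right_pole k n" b R] that elim b(1)
        by (auto simp: right_poles_eq_range Re_right_pole_less_gap_iff b_def simp del: Re_right_pole)
      show "winding_number (trunc_path \<gamma> R +++ right_box a b R) p = 0" if "p \<in> left_poles L \<beta> c" for p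
        using winding_number_right_box[of p b R] winding_number_right_box_left[OF A', of p b R] that elim b
        by (cases "p \<in> F") (auto simp: F_def)
    qed (use elim tail box_poles in auto)
    with box_poles show ?case by blast
  qed
qed

lemma norm_pullback_tail:
  assumes "T < \<bar>t\<bar>"
  shows "norm (pullback f \<gamma> t) = norm (f (Complex a t))"
proof -
  have "vector_derivative \<gamma> (at t) = \<i>"
    by (rule vector_derivative_eq_if_eq_on_open[of "- {-T..T}" _ _ "Complex a"])
       (use assms in \<open>auto intro!: tail has_vector_derivative_Complex\<close>)
  thus ?thesis using tail[of t] assms by (simp add: pullback_def norm_mult)
qed

lemma integrable_pullback_gamma_kernel:
  assumes hol: "H holomorphic_on - left_poles L \<beta> c" and decay: "strip_decay \<mu> (gamma_kernel k H)" "0 < \<mu>"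
  shows "pullback (gamma_kernel k H) \<gamma> integrable_on UNIV"
proof -
  have "\<mu>/2 < \<mu>" using decay(2) by simp
  then obtain C D where C: "\<And>s. \<bar>Re s\<bar> \<le> \<bar>a\<bar> \<Longrightarrow> D \<le> \<bar>Im s\<bar> \<Longrightarrow> norm (gamma_kernel k H s) \<le> C * exp (- (\<mu>/2) * \<bar>Im s\<bar>)"
    using strip_decayE[OF decay(1)] by metis
  show ?thesis
  proof (rule integrable_on_UNIV_exp_tails)
    show "pullback (gamma_kernel k H) \<gamma> integrable_on {-R..R}" if "R > 0" for R
      using has_integral_pullback_gamma_kernel[OF hol that] by (rule has_integral_integrable)
    show "norm (pullback (gamma_kernel k H) \<gamma> t) \<le> C * exp (- (\<mu>/2) * \<bar>t\<bar>)" if "max D T + 1 \<le> \<bar>t\<bar>" for t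
      using C[of "Complex a t"] that by (simp add: norm_pullback_tail)
  qed (use decay(2) in simp)
qed

lemma line_integral_eq_gap_line:
  assumes hol: "H holomorphic_on - left_poles L \<beta> c" and right: "right_of_contour (gap_abscissa k N)"
    and decay: "strip_decay \<mu> (gamma_kernel k H)" "0 < \<mu>"
  shows "line_integral (gamma_kernel k H) \<gamma> =
     \<i> * integral UNIV (\<lambda>t. gamma_kernel k H (Complex (gap_abscissa k N) t))
     + 2 * of_real pi * \<i> * (\<Sum>n<N. residue_term k H n)"
proof -
  let ?f = "gamma_kernel k H" and ?b = "gap_abscissa k N"
  let ?box = "\<lambda>R. contour_integral (linepath (Complex a R) (Complex ?b R)) ?f
    - \<i> * integral {-R..R} (\<lambda>t. ?f (Complex ?b t)) + contour_integral (linepath (Complex ?b (- R)) (Complex a (- R))) ?f"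
  have "\<forall>\<^sub>F R in at_top. 2 * of_real pi * \<i> * (\<Sum>n<N. residue_term k H n) = integral {-R..R} (pullback ?f \<gamma>) + ?box R"
    using right_box_expansion[OF hol right] eventually_gt_at_top[of 0]
  proof eventually_elim
    case (elim R)
    have "contour_integral (right_box a ?b R) ?f = ?box R"
      using elim by (intro contour_integral_right_box contour_integrable_gamma_kernel hol)
        (auto simp: right_box_def path_image_join)
    with elim show ?case by simp
  qed
  hence "((\<lambda>R. integral {-R..R} (pullback ?f \<gamma>) + ?box R) \<longlongrightarrow> 2 * of_real pi * \<i> * (\<Sum>n<N. residue_term k H n)) at_top"
    by (rule Lim_transform_eventually[OF tendsto_const])
  moreover have "((\<lambda>R. integral {-R..R} (pullback ?f \<gamma>) + ?box R) \<longlongrightarrow>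
      integral UNIV (pullback ?f \<gamma>) + (0 - \<i> * integral UNIV (\<lambda>t. ?f (Complex ?b t)) + 0)) at_top"
    by (intro tendsto_intros integral_symmetric_tendsto integrable_pullback_gamma_kernel[OF hol decay]
        exp_decay_integrable[OF exp_decay_gap_line[OF hol _ decay(1)] decay(2)]
        strip_decay_horizontal_integral_tendsto_0[OF decay]) (use right in \<open>real_asymp | simp add: right_of_contour_def\<close>)+
  ultimately have "integral UNIV (pullback ?f \<gamma>) + (0 - \<i> * integral UNIV (\<lambda>t. ?f (Complex ?b t)) + 0)
      = 2 * of_real pi * \<i> * (\<Sum>n<N. residue_term k H n)"
    by (intro tendsto_unique[OF trivial_limit_at_top_linorder])
  thus ?thesis by (simp add: line_integral_eq_pullback algebra_simps)
qed

end

lemma vertical_contour_imp_vertical_pole_contour: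
  assumes "vertical_contour L \<beta> c k \<gamma>" "right_poles k \<inter> left_poles L \<beta> c = {}"
  obtains a T where "vertical_pole_contour L \<beta> c k \<gamma> a T"
proof -
  obtain T a where "\<And>t. T \<le> \<bar>t\<bar> \<Longrightarrow> \<gamma> t = Complex a t" using assms(1) unfolding vertical_contour_def by blast
  hence "vertical_pole_contour L \<beta> c k \<gamma> a T"
    using assms sparse_left_poles by unfold_locales (auto simp: vertical_contour_def)
  thus ?thesis by (rule that)
qed

theorem line_integral_vertical_contour:
  assumes "vertical_contour L \<beta> c k \<gamma>" "right_poles k \<inter> left_poles L \<beta> c = {}"
  shows "\<forall>\<^sub>F N in sequentially. \<forall>H \<mu>. H holomorphic_on - left_poles L \<beta> c \<longrightarrow> strip_decay \<mu> (gamma_kernel k H) \<longrightarrow> 0 < \<mu> \<longrightarrow>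
     line_integral (gamma_kernel k H) \<gamma> = \<i> * integral UNIV (\<lambda>t. gamma_kernel k H (Complex (gap_abscissa k N) t))
       + 2 * of_real pi * \<i> * (\<Sum>n<N. residue_term k H n)"
proof -
  obtain a T where "vertical_pole_contour L \<beta> c k \<gamma> a T"
    using vertical_contour_imp_vertical_pole_contour[OF assms] by metis
  then interpret vertical_pole_contour L \<beta> c k \<gamma> a T .
  show ?thesis
    using eventually_right_of_contour by eventually_elim (blast intro: line_integral_eq_gap_line)
qed

section \<open>Hankel contours\<close>

definition half_strip_decay :: "(complex \<Rightarrow> complex) \<Rightarrow> bool" where
  "half_strip_decay h \<longleftrightarrow> (\<forall>\<eta>. \<exists>C \<delta> x. 0 < \<delta> \<and> (\<forall>s. x \<le> Re s \<longrightarrow> \<bar>Im s\<bar> \<le> \<eta> \<longrightarrow> norm (h s) \<le> C * exp (- \<delta> * Re s)))"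

lemma half_strip_decayE:
  assumes "half_strip_decay h"
  obtains C \<delta> x where "0 < \<delta>" "0 \<le> C" "\<And>s. x \<le> Re s \<Longrightarrow> \<bar>Im s\<bar> \<le> \<eta> \<Longrightarrow> norm (h s) \<le> C * exp (- \<delta> * Re s)"
proof -
  obtain C \<delta> x where "0 < \<delta>" and bound: "\<And>s. x \<le> Re s \<Longrightarrow> \<bar>Im s\<bar> \<le> \<eta> \<Longrightarrow> norm (h s) \<le> C * exp (- \<delta> * Re s)"
    using assms unfolding half_strip_decay_def by metis
  have "norm (h s) \<le> \<bar>C\<bar> * exp (- \<delta> * Re s)" if "x \<le> Re s" "\<bar>Im s\<bar> \<le> \<eta>" for s
    using bound[OF that] by (rule order_trans) (simp add: mult_right_mono)
  with \<open>0 < \<delta>\<close> show ?thesis using that by (metis abs_ge_zero)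
qed

lemma half_strip_decay_shift:
  assumes "half_strip_decay h"
  shows "half_strip_decay (\<lambda>s. h (s + 1))"
  unfolding half_strip_decay_def
proof
  fix \<eta>
  obtain C \<delta> x where "0 < \<delta>"
    and bound: "\<And>s. x \<le> Re s \<Longrightarrow> \<bar>Im s\<bar> \<le> \<eta> \<Longrightarrow> norm (h s) \<le> C * exp (- \<delta> * Re s)"
    using half_strip_decayE[OF assms] by metis
  have "norm (h (s + 1)) \<le> (C * exp (- \<delta>)) * exp (- \<delta> * Re s)" if "x \<le> Re s" "\<bar>Im s\<bar> \<le> \<eta>" for s
    using bound[of "s + 1"] that by (simp add: distrib_left exp_add exp_diff exp_minus field_simps)
  with \<open>0 < \<delta>\<close> show "\<exists>C \<delta> x. 0 < \<delta> \<and> (\<forall>s. x \<le> Re s \<longrightarrow> \<bar>Im s\<bar> \<le> \<eta> \<longrightarrow> norm (h (s + 1)) \<le> C * exp (- \<delta> * Re s))"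
    by blast
qed

lemma half_strip_decay_if_contraction:
  assumes q: "0 < q" "q < 1"
    and cont: "continuous_on {s. R \<le> Re s} h"
    and step: "\<And>s. R \<le> Re s \<Longrightarrow> norm (h (s + 1)) \<le> q * norm (h s)"
  shows "half_strip_decay h"
  unfolding half_strip_decay_def
proof
  fix \<eta>
  define \<delta> where "\<delta> = - ln q"
  have \<delta>: "0 < \<delta>" "q = exp (- \<delta>)" using q by (auto simp: \<delta>_def)
  have iterate: "norm (h (s + of_nat n)) \<le> q ^ n * norm (h s)" if "R \<le> Re s" for s n
  proof (induction n)
    case (Suc n)
    have "norm (h (s + of_nat n + 1)) \<le> q * norm (h (s + of_nat n))" using that by (intro step) simp
    also have "\<dots> \<le> q * (q ^ n * norm (h s))" using Suc q by (intro mult_left_mono) auto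
    finally show ?case by (simp add: add_ac)
  qed simp
  define B where "B = cbox (Complex R (- \<eta>)) (Complex (R + 1) \<eta>)"
  have "continuous_on B h" by (rule continuous_on_subset[OF cont]) (auto simp: B_def in_cbox_complex_iff)
  hence "bounded (h ` B)" by (intro compact_imp_bounded compact_continuous_image) (auto simp: B_def)
  then obtain K where K: "\<And>s. s \<in> B \<Longrightarrow> norm (h s) \<le> K" unfolding bounded_iff by (metis imageI)
  have "norm (h s) \<le> (\<bar>K\<bar> * exp (\<delta> * (R + 1))) * exp (- \<delta> * Re s)" if s: "R \<le> Re s" "\<bar>Im s\<bar> \<le> \<eta>" for s
  proof -
    define n where "n = nat \<lfloor>Re s - R\<rfloor>"
    define s' where "s' = s - of_nat n"
    have n: "real n \<le> Re s - R" "Re s - R < real n + 1" using s by (auto simp: n_def)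
    hence "s' \<in> B" using s by (auto simp: s'_def B_def in_cbox_complex_iff)
    have "norm (h s) \<le> q ^ n * norm (h s')" using iterate[of s' n] n by (simp add: s'_def)
    also have "\<dots> \<le> q ^ n * \<bar>K\<bar>" using K[OF \<open>s' \<in> B\<close>] q by (intro mult_left_mono) auto
    also have "q ^ n = exp (- \<delta> * real n)" unfolding \<delta>(2) by (simp add: exp_of_nat_mult[symmetric] mult.commute)
    also have "\<dots> \<le> exp (\<delta> * (R + 1) + - \<delta> * Re s)"
      using mult_left_mono[of "Re s - R - 1" "real n" \<delta>] n \<delta>(1) by (simp add: algebra_simps)
    finally show ?thesis unfolding exp_add by (simp add: mult_ac mult_right_mono)
  qed
  with \<delta>(1) show "\<exists>C \<delta> x. 0 < \<delta> \<and> (\<forall>s. x \<le> Re s \<longrightarrow> \<bar>Im s\<bar> \<le> \<eta> \<longrightarrow> norm (h s) \<le> C * exp (- \<delta> * Re s))"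
    by blast
qed

lemma norm_gamma_kernel_le:
  assumes "0 < m" "m \<le> norm (sin (of_real pi * (of_int k + s)))"
  shows "norm (gamma_kernel k H s) \<le> pi / m * norm (rGamma (of_int k + s) * H s)"
proof -
  let ?z = "of_int k + s"
  have "1 - of_int k - s = 1 - ?z" by simp
  moreover have "sin (of_real pi * ?z) \<noteq> 0" using assms by auto
  moreover have "rGamma ?z * rGamma (1 - ?z) = sin (of_real pi * ?z) / of_real pi" by (rule rGamma_reflection_complex)
  ultimately have "Gamma (1 - of_int k - s) = of_real pi / sin (of_real pi * ?z) * rGamma ?z"
    by (cases "rGamma (1 - ?z) = 0") (auto simp: Gamma_def field_simps)
  hence "norm (gamma_kernel k H s) = pi / norm (sin (of_real pi * ?z)) * norm (rGamma ?z * H s)"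
    by (simp add: gamma_kernel_def norm_mult norm_divide)
  also have "\<dots> \<le> pi / m * norm (rGamma ?z * H s)" using assms by (intro mult_right_mono divide_left_mono mult_pos_pos) auto
  finally show ?thesis .
qed

lemma abs_sinh_Im_le_norm_sin: "\<bar>sinh (Im z)\<bar> \<le> norm (sin z)"
  by (rule power2_le_imp_le) (simp_all add: norm_sin_squared_sinh)

lemma norm_sin_gap_line_ge_1:
  assumes "Re s = gap_abscissa k N"
  shows "1 \<le> norm (sin (of_real pi * (of_int k + s)))"
proof (rule power2_le_imp_le)
  have "Re (of_real pi * (of_int k + s)) = real N * pi + pi / 2"
    by (simp add: assms gap_abscissa_def algebra_simps)
  hence "(sin (Re (of_real pi * (of_int k + s))))\<^sup>2 = 1"
    by (simp add: sin_add flip: power_mult power_mult_distrib)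
  thus "1\<^sup>2 \<le> (norm (sin (of_real pi * (of_int k + s))))\<^sup>2" unfolding norm_sin_squared_sinh by simp
qed simp

definition hankel_loop :: "(real \<Rightarrow> complex) \<Rightarrow> real \<Rightarrow> real \<Rightarrow> complex" where
  "hankel_loop \<gamma> R = trunc_path \<gamma> R +++ linepath (\<gamma> R) (\<gamma> (- R))"

locale hankel_pole_contour = pole_contour k "left_poles L \<beta> c" \<gamma>
  for L \<beta> c k \<gamma> +
  fixes T \<eta> :: real
  assumes T_pos: "0 < T"
    and upper: "\<And>t. T \<le> t \<Longrightarrow> \<gamma> t = Complex t \<eta>"
    and lower: "\<And>t. t \<le> - T \<Longrightarrow> \<gamma> t = Complex (- t) (- \<eta>)"
    and \<eta>_pos: "0 < \<eta>"
    and winding_right: "\<And>p. p \<in> right_poles k \<Longrightarrow> \<forall>\<^sub>F R in at_top. winding_number (hankel_loop \<gamma> R) p = -1"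
    and winding_left: "\<And>p. p \<in> left_poles L \<beta> c \<Longrightarrow> \<forall>\<^sub>F R in at_top. winding_number (hankel_loop \<gamma> R) p = 0"
begin

lemma Re_contour_end: "T \<le> \<bar>t\<bar> \<Longrightarrow> Re (\<gamma> t) = \<bar>t\<bar>"
  using upper[of t] lower[of t] T_pos by (cases "0 \<le> t") auto

lemma Im_contour_end: "T \<le> \<bar>t\<bar> \<Longrightarrow> \<bar>Im (\<gamma> t)\<bar> = \<eta>"
  using upper[of t] lower[of t] T_pos \<eta>_pos by (cases "0 \<le> t") auto

lemma norm_pullback_end:
  assumes "T < \<bar>t\<bar>"
  shows "norm (pullback f \<gamma> t) = norm (f (\<gamma> t))"
proof (cases "0 \<le> t")
  case True
  have "vector_derivative \<gamma> (at t) = 1"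
    by (rule vector_derivative_eq_if_eq_on_open[of "{T<..}"]) (use True assms upper has_vector_derivative_Complex in auto)
  thus ?thesis by (simp add: pullback_def norm_mult)
next
  case False
  have "vector_derivative \<gamma> (at t) = -1"
    by (rule vector_derivative_eq_if_eq_on_open[of "{..<-T}"]) (use False assms lower has_vector_derivative_Complex in auto)
  thus ?thesis by (simp add: pullback_def norm_mult)
qed

lemma winding_number_hankel_ends:
  assumes p: "Re p < b" and "T < b" "b \<le> R"
  shows "winding_number (subpath b R \<gamma>) p + winding_number (linepath (\<gamma> R) (\<gamma> (- R))) p + winding_number (subpath (- R) (- b) \<gamma>) p
    = winding_number (linepath (\<gamma> b) (\<gamma> (- b))) p"
proof -
  let ?S = "{z. Re p < Re z}"
  let ?up = "subpath b R \<gamma>" and ?down = "subpath (- R) (- b) \<gamma>" and ?close = "\<lambda>r. linepath (\<gamma> r) (\<gamma> (- r))"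
  have far: "\<gamma> t \<in> ?S" if "b \<le> \<bar>t\<bar>" for t using that assms Re_contour_end[of t] by simp
  have close: "path_image (?close r) \<subseteq> ?S" if "b \<le> r" for r
    unfolding path_image_linepath using that T_pos \<open>T < b\<close>
    by (intro closed_segment_subset far convex_halfspace_Re_gt) auto
  have arcs: "path_image ?up \<subseteq> ?S" "path_image ?down \<subseteq> ?S"
    unfolding path_image_subpath_real[OF \<open>b \<le> R\<close>] path_image_subpath_real[OF le_imp_neg_le[OF \<open>b \<le> R\<close>]]
    using far T_pos assms by auto
  have paths: "path ?up" "path ?down" using assms by (auto intro: path_subpath_regular_contour regular)
  have "winding_number (?up +++ ?close R +++ ?down) p = winding_number (?close b) p"
  proof (rule winding_number_eq_in_simply_connected[of ?S])
    show "simply_connected ?S" by (intro convex_imp_simply_connected convex_halfspace_Re_gt)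
    show "path_image (?up +++ ?close R +++ ?down) \<subseteq> ?S"
      using arcs close[OF \<open>b \<le> R\<close>] by (intro subset_path_image_join) auto
    show "path_image (?close b) \<subseteq> ?S" by (rule close) simp
    show "path (?up +++ ?close R +++ ?down)" using paths by (intro path_join_imp) auto
  qed auto
  moreover have "p \<notin> path_image ?up" "p \<notin> path_image ?down" "p \<notin> path_image (?close R)"
    using arcs close[OF \<open>b \<le> R\<close>] by blast+
  ultimately show ?thesis
    using paths by (simp add: winding_number_join not_in_path_image_join add.assoc)
qed

lemma winding_number_hankel_loop_eq:
  assumes p: "p \<in> poles" "Re p < b" and b: "T < b" "b \<le> R"
  shows "winding_number (hankel_loop \<gamma> R) p = winding_number (hankel_loop \<gamma> b) p"
proof -
  have notin: "p \<notin> range \<gamma>" using p avoids by blast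
  have loop: "winding_number (hankel_loop \<gamma> r) p
      = winding_number (trunc_path \<gamma> r) p + winding_number (linepath (\<gamma> r) (\<gamma> (- r))) p" if "b \<le> r" for r
    unfolding hankel_loop_def
  proof (rule winding_number_join)
    show "path (trunc_path \<gamma> r)" using that b T_pos by (intro path_trunc_path) auto
    show "p \<notin> path_image (trunc_path \<gamma> r)"
      using notin that b T_pos by (auto simp: trunc_path_eq_subpath path_image_subpath_real)
    have "closed_segment (\<gamma> r) (\<gamma> (- r)) \<subseteq> {z. Re p < Re z}"
      using Re_contour_end[of r] Re_contour_end[of "- r"] that p(2) b T_pos by (intro closed_segment_subset convex_halfspace_Re_gt) auto
    thus "p \<notin> path_image (linepath (\<gamma> r) (\<gamma> (- r)))" by auto
  qed (auto simp: trunc_path_eq_subpath)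
  have "winding_number (trunc_path \<gamma> R) p
      = winding_number (subpath (- R) (- b) \<gamma>) p + winding_number (trunc_path \<gamma> b) p + winding_number (subpath b R \<gamma>) p"
    using winding_number_subpath_add[OF regular notin, of "- R" "- b" b]
      winding_number_subpath_add[OF regular notin, of "- R" b R] b T_pos by (simp add: trunc_path_eq_subpath)
  thus ?thesis
    using loop[OF order_refl] loop[OF \<open>b \<le> R\<close>] winding_number_hankel_ends[OF p(2) b] by (simp add: algebra_simps)
qed

lemma winding_number_hankel_loop:
  assumes "Re p < b" "T < b"
  shows "p \<in> right_poles k \<Longrightarrow> winding_number (hankel_loop \<gamma> b) p = -1"
    and "p \<in> left_poles L \<beta> c \<Longrightarrow> winding_number (hankel_loop \<gamma> b) p = 0"
proof -
  have loop: "winding_number (hankel_loop \<gamma> b) p = w" if p: "p \<in> poles" and ev: "\<forall>\<^sub>F R in at_top. winding_number (hankel_loop \<gamma> R) p = w" for w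
  proof -
    have "\<forall>\<^sub>F R in at_top. winding_number (hankel_loop \<gamma> R) p = w \<and> b \<le> R"
      by (intro eventually_conj ev eventually_ge_at_top)
    from eventually_happens'[OF trivial_limit_at_top_linorder this]
    obtain R where R: "winding_number (hankel_loop \<gamma> R) p = w" "b \<le> R" by blast
    show ?thesis using winding_number_hankel_loop_eq[OF p assms R(2)] R(1) by simp
  qed
  show "winding_number (hankel_loop \<gamma> b) p = -1" if "p \<in> right_poles k"
    by (rule loop[OF UnI1 winding_right]) fact+
  show "winding_number (hankel_loop \<gamma> b) p = 0" if "p \<in> left_poles L \<beta> c"
    by (rule loop[OF UnI2 winding_left]) fact+
qed

abbreviation closing :: "nat \<Rightarrow> real \<Rightarrow> complex" where
  "closing N \<equiv> linepath (Complex (gap_abscissa k N) \<eta>) (Complex (gap_abscissa k N) (- \<eta>))"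

lemma closing_segment: "z \<in> path_image (closing N) \<Longrightarrow> Re z = gap_abscissa k N \<and> \<bar>Im z\<bar> \<le> \<eta>"
  using \<eta>_pos by (auto simp: closed_segment_same_Re closed_segment_eq_real_ivl split: if_splits)

lemma eventually_closing_expansion:
  assumes hol: "H holomorphic_on - left_poles L \<beta> c"
  shows "\<forall>\<^sub>F N in sequentially.
     integral {- gap_abscissa k N..gap_abscissa k N} (pullback (gamma_kernel k H) \<gamma>)
       + contour_integral (closing N) (gamma_kernel k H) = 2 * of_real pi * \<i> * (\<Sum>n<N. residue_term k H n)"
proof -
  obtain K where K: "\<And>t. \<bar>t\<bar> \<le> T \<Longrightarrow> norm (\<gamma> t) \<le> K" using regular_contour_bounded[OF regular] by metis
  have "\<forall>\<^sub>F N in sequentially. max (max T K) (\<Sum>l<L. norm (1 / (\<beta> * c l))) < gap_abscissa k N"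
    by (rule eventually_gap_abscissa_gt)
  thus ?thesis
  proof eventually_elim
    case (elim N)
    let ?b = "gap_abscissa k N"
    have b: "T < ?b" "0 < ?b" "K < ?b" using elim T_pos by auto
    have left: "Re p < ?b" if "p \<in> left_poles L \<beta> c" for p using Re_left_pole_le[OF that] elim by auto
    have ends: "\<gamma> ?b = Complex ?b \<eta>" "\<gamma> (- ?b) = Complex ?b (- \<eta>)" using upper[of ?b] lower[of "- ?b"] b by auto
    have loop: "hankel_loop \<gamma> ?b = trunc_path \<gamma> ?b +++ closing N" by (simp add: hankel_loop_def ends)
    show ?case
    proof (rule closed_contour_expansion[OF hol b(2)])
      have "z \<notin> poles" if "z \<in> path_image (closing N)" for z
        using closing_segment[OF that] gap_line_not_Ints[of z k N] right_poles_subset_Ints left[of z] by auto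
      thus "path_image (closing N) \<inter> poles = {}" by blast
      show "Re z \<le> ?b" if "z \<in> \<gamma> ` {- ?b..?b} \<union> path_image (closing N)" for z
      proof -
        have "Re (\<gamma> t) \<le> ?b" if "t \<in> {- ?b..?b}" for t
          using that K[of t] Re_contour_end[of t] complex_Re_le_cmod[of "\<gamma> t"] b(3) by (cases "\<bar>t\<bar> \<le> T") auto
        thus ?thesis using that closing_segment[of z N] by auto
      qed
      show "winding_number (trunc_path \<gamma> ?b +++ closing N) (right_pole k n) = -1" if "n < N" for n
        unfolding loop[symmetric] using that b
        by (intro winding_number_hankel_loop(1)) (auto simp: Re_right_pole_less_gap_iff right_poles_eq_range simp del: Re_right_pole)
      show "winding_number (trunc_path \<gamma> ?b +++ closing N) p = 0" if "p \<in> left_poles L \<beta> c" for p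
        unfolding loop[symmetric] using that b left by (intro winding_number_hankel_loop(2)) auto
    qed (auto simp: ends)
  qed
qed

lemma integrable_pullback_gamma_kernel:
  assumes hol: "H holomorphic_on - left_poles L \<beta> c" and decay: "half_strip_decay (\<lambda>s. rGamma (of_int k + s) * H s)"
  shows "pullback (gamma_kernel k H) \<gamma> integrable_on UNIV"
proof -
  obtain C \<delta> x where C: "0 < \<delta>" "\<And>s. x \<le> Re s \<Longrightarrow> \<bar>Im s\<bar> \<le> \<eta> \<Longrightarrow> norm (rGamma (of_int k + s) * H s) \<le> C * exp (- \<delta> * Re s)"
    using half_strip_decayE[OF decay] by metis
  let ?m = "sinh (pi * \<eta>)"
  have m: "0 < ?m" using \<eta>_pos by simp
  show ?thesis
  proof (rule integrable_on_UNIV_exp_tails[OF _ _ C(1)])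
    show "pullback (gamma_kernel k H) \<gamma> integrable_on {-R..R}" if "R > 0" for R
      using has_integral_pullback_gamma_kernel[OF hol that] by (rule has_integral_integrable)
    fix t assume t: "max T x + 1 \<le> \<bar>t\<bar>"
    have "\<bar>Im (of_real pi * (of_int k + \<gamma> t))\<bar> = pi * \<eta>" using Im_contour_end[of t] t by (simp add: abs_mult)
    hence "\<bar>sinh (Im (of_real pi * (of_int k + \<gamma> t)))\<bar> = ?m" by (simp only: flip: sinh_real_abs)
    hence "?m \<le> norm (sin (of_real pi * (of_int k + \<gamma> t)))"
      using abs_sinh_Im_le_norm_sin[of "of_real pi * (of_int k + \<gamma> t)"] by simp
    hence "norm (gamma_kernel k H (\<gamma> t)) \<le> pi / ?m * norm (rGamma (of_int k + \<gamma> t) * H (\<gamma> t))"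
      by (rule norm_gamma_kernel_le[OF m])
    also have "\<dots> \<le> pi / ?m * (C * exp (- \<delta> * \<bar>t\<bar>))"
      using C(2)[of "\<gamma> t"] Re_contour_end[of t] Im_contour_end[of t] t m by (intro mult_left_mono) auto
    finally show "norm (pullback (gamma_kernel k H) \<gamma> t) \<le> (pi / ?m * C) * exp (- \<delta> * \<bar>t\<bar>)"
      using t by (simp add: norm_pullback_end)
  qed
qed

lemma closing_integral_tendsto_0:
  assumes decay: "half_strip_decay (\<lambda>s. rGamma (of_int k + s) * H s)"
  shows "(\<lambda>N. contour_integral (closing N) (gamma_kernel k H)) \<longlonglongrightarrow> 0"
proof -
  obtain C \<delta> x where C: "0 < \<delta>" "0 \<le> C" "\<And>s. x \<le> Re s \<Longrightarrow> \<bar>Im s\<bar> \<le> \<eta> \<Longrightarrow> norm (rGamma (of_int k + s) * H s) \<le> C * exp (- \<delta> * Re s)"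
    using half_strip_decayE[OF decay] by metis
  have "((\<lambda>b. (pi * (C * exp (- \<delta> * b))) * (2 * \<eta>)) \<longlongrightarrow> 0) at_top" using C(1) by real_asymp
  from filterlim_compose[OF this gap_abscissa_at_top]
  have "(\<lambda>N. (pi * (C * exp (- \<delta> * gap_abscissa k N))) * (2 * \<eta>)) \<longlonglongrightarrow> 0" .
  moreover have "\<forall>\<^sub>F N in sequentially. norm (contour_integral (closing N) (gamma_kernel k H))
      \<le> (pi * (C * exp (- \<delta> * gap_abscissa k N))) * (2 * \<eta>)"
  proof -
    have "\<forall>\<^sub>F N in sequentially. x < gap_abscissa k N"
      by (rule eventually_gap_abscissa_gt)
    thus ?thesis
    proof eventually_elim
      case (elim N)
      have "norm (gamma_kernel k H z) \<le> pi * (C * exp (- \<delta> * gap_abscissa k N))" if "z \<in> path_image (closing N)" for z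
      proof -
        have "norm (gamma_kernel k H z) \<le> pi / 1 * norm (rGamma (of_int k + z) * H z)"
          by (rule norm_gamma_kernel_le[OF _ norm_sin_gap_line_ge_1]) (use closing_segment[OF that] in auto)
        also have "\<dots> \<le> pi / 1 * (C * exp (- \<delta> * Re z))"
          using closing_segment[OF that] elim by (intro mult_left_mono C(3)) auto
        finally show ?thesis using closing_segment[OF that] by simp
      qed
      hence "norm (contour_integral (closing N) (gamma_kernel k H)) \<le> (pi * (C * exp (- \<delta> * gap_abscissa k N)))
          * norm (Complex (gap_abscissa k N) (- \<eta>) - Complex (gap_abscissa k N) \<eta>)"
        by (intro norm_contour_integral_linepath_le) (use C(2) in auto)
      also have "norm (Complex (gap_abscissa k N) (- \<eta>) - Complex (gap_abscissa k N) \<eta>) = 2 * \<eta>"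
        using \<eta>_pos by (simp add: cmod_def real_sqrt_mult)
      finally show ?case .
    qed
  qed
  ultimately show ?thesis by (rule Lim_null_comparison[rotated])
qed

lemma residue_series_sums:
  assumes hol: "H holomorphic_on - left_poles L \<beta> c" and decay: "half_strip_decay (\<lambda>s. rGamma (of_int k + s) * H s)"
  shows "residue_term k H sums (line_integral (gamma_kernel k H) \<gamma> / (2 * of_real pi * \<i>))"
proof -
  let ?f = "gamma_kernel k H"
  let ?closed = "\<lambda>N. (integral {- gap_abscissa k N..gap_abscissa k N} (pullback ?f \<gamma>) + contour_integral (closing N) ?f)
       / (2 * of_real pi * \<i>)"
  have "(\<lambda>N. integral {- gap_abscissa k N..gap_abscissa k N} (pullback ?f \<gamma>)) \<longlonglongrightarrow> line_integral ?f \<gamma>"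
    unfolding line_integral_eq_pullback
    by (rule filterlim_compose[OF integral_symmetric_tendsto[OF integrable_pullback_gamma_kernel[OF hol decay]] gap_abscissa_at_top])
  hence "?closed \<longlonglongrightarrow> (line_integral ?f \<gamma> + 0) / (2 * of_real pi * \<i>)"
    by (intro tendsto_intros closing_integral_tendsto_0[OF decay]) auto
  moreover have "\<forall>\<^sub>F N in sequentially. ?closed N = (\<Sum>n<N. residue_term k H n)"
    using eventually_closing_expansion[OF hol] by eventually_elim simp
  ultimately have "(\<lambda>N. \<Sum>n<N. residue_term k H n) \<longlonglongrightarrow> (line_integral ?f \<gamma> + 0) / (2 * of_real pi * \<i>)"
    by (rule Lim_transform_eventually)
  thus ?thesis by (simp add: sums_def)
qed

end

lemma hankel_contour_imp_hankel_pole_contour: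
  assumes "hankel_contour L \<beta> c k \<gamma>" "right_poles k \<inter> left_poles L \<beta> c = {}"
  obtains T \<eta> where "hankel_pole_contour L \<beta> c k \<gamma> T \<eta>"
proof -
  obtain T \<eta> where ends: "0 < T" "0 < \<eta>" "\<forall>t\<ge>T. \<gamma> t = of_real t + \<i> * of_real \<eta>"
    "\<forall>t\<le>-T. \<gamma> t = of_real (- t) - \<i> * of_real \<eta>"
    using assms(1) unfolding hankel_contour_def by blast
  have "hankel_pole_contour L \<beta> c k \<gamma> T \<eta>"
  proof unfold_locales
    show "regular_contour \<gamma>" "range \<gamma> \<inter> (right_poles k \<union> left_poles L \<beta> c) = {}"
      using assms(1) unfolding hankel_contour_def by blast+
    show "\<gamma> t = Complex t \<eta>" if "T \<le> t" for t using ends that by (simp add: Complex_eq)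
    show "\<gamma> t = Complex (- t) (- \<eta>)" if "t \<le> - T" for t using ends that by (simp add: Complex_eq)
    show "\<forall>\<^sub>F R in at_top. winding_number (hankel_loop \<gamma> R) p = -1" if "p \<in> right_poles k" for p
      using assms(1) that unfolding hankel_contour_def hankel_loop_def by blast
    show "\<forall>\<^sub>F R in at_top. winding_number (hankel_loop \<gamma> R) p = 0" if "p \<in> left_poles L \<beta> c" for p
      using assms(1) that unfolding hankel_contour_def hankel_loop_def by blast
  qed (use ends assms(2) sparse_left_poles in auto)
  thus ?thesis by (rule that)
qed

theorem residue_series_sums_hankel_contour:
  assumes "hankel_contour L \<beta> c k \<gamma>" "right_poles k \<inter> left_poles L \<beta> c = {}"
    and "H holomorphic_on - left_poles L \<beta> c" "half_strip_decay (\<lambda>s. rGamma (of_int k + s) * H s)"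
  shows "residue_term k H sums (line_integral (gamma_kernel k H) \<gamma> / (2 * of_real pi * \<i>))"
proof -
  obtain T \<eta> where "hankel_pole_contour L \<beta> c k \<gamma> T \<eta>"
    using hankel_contour_imp_hankel_pole_contour[OF assms(1,2)] by metis
  then interpret hankel_pole_contour L \<beta> c k \<gamma> T \<eta> .
  show ?thesis by (rule residue_series_sums) fact+
qed

section \<open>The Mellin-Barnes integrand\<close>

definition gamma_quotient :: "nat \<Rightarrow> nat \<Rightarrow> complex \<Rightarrow> (nat \<Rightarrow> complex) \<Rightarrow> (nat \<Rightarrow> complex) \<Rightarrow> complex \<Rightarrow> complex" where
  "gamma_quotient L M \<beta> c d s = (\<Prod>l<L. Gamma (s + 1 / (\<beta> * c l))) * (\<Prod>m<M. rGamma (s - 1 / (\<beta> * d m)))"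

lemma prod_rGamma: "(\<Prod>x\<in>A. rGamma (f x)) = inverse (\<Prod>x\<in>A. Gamma (f x))"
  by (simp add: rGamma_inverse_Gamma prod_inversef[symmetric] o_def)

lemma integrand_eq_gamma_kernel:
  "integrand L M \<beta> c d k \<zeta> = gamma_kernel k (\<lambda>s. gamma_quotient L M \<beta> c d s * exp (s * \<zeta>))"
  by (simp add: fun_eq_iff integrand_def gamma_kernel_def gamma_quotient_def prod_rGamma divide_inverse[of _ "prod _ _"] mult_ac)

lemma not_left_pole_imp_not_nonpos_Int:
  assumes "s \<notin> left_poles L \<beta> c" "l < L"
  shows "s + 1 / (\<beta> * c l) \<notin> \<int>\<^sub>\<le>\<^sub>0"
proof
  assume "s + 1 / (\<beta> * c l) \<in> \<int>\<^sub>\<le>\<^sub>0"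
  then obtain n where "s + 1 / (\<beta> * c l) = - of_nat n" by (auto elim!: nonpos_Ints_cases')
  hence "s = - of_nat n - 1 / (\<beta> * c l)" by (simp add: algebra_simps)
  thus False using assms unfolding left_poles_def by blast
qed

lemma left_poles_minus_1:
  assumes "s \<in> left_poles L \<beta> c"
  shows "s - 1 \<in> left_poles L \<beta> c"
proof -
  obtain i l where "s = - of_nat i - 1 / (\<beta> * c l)" "l < L" using assms by (auto simp: left_poles_def)
  hence "s - 1 = - of_nat (Suc i) - 1 / (\<beta> * c l)" by simp
  thus ?thesis unfolding left_poles_def using \<open>l < L\<close> by blast
qed

lemma holomorphic_gamma_quotient: "gamma_quotient L M \<beta> c d holomorphic_on - left_poles L \<beta> c"
  unfolding gamma_quotient_def by (intro holomorphic_intros) (use not_left_pole_imp_not_nonpos_Int in auto)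

lemma gamma_quotient_plus1:
  assumes "s \<notin> left_poles L \<beta> c"
  shows "gamma_quotient L M \<beta> c d (s + 1) * (\<Prod>m<M. s - 1 / (\<beta> * d m))
    = (\<Prod>l<L. s + 1 / (\<beta> * c l)) * gamma_quotient L M \<beta> c d s"
proof -
  have "Gamma (s + 1 + 1 / (\<beta> * c l)) = (s + 1 / (\<beta> * c l)) * Gamma (s + 1 / (\<beta> * c l))" if "l < L" for l
    using Gamma_plus1[OF not_left_pole_imp_not_nonpos_Int[OF assms that]] by (simp add: add_ac)
  hence numerator: "(\<Prod>l<L. Gamma (s + 1 + 1 / (\<beta> * c l))) = (\<Prod>l<L. s + 1 / (\<beta> * c l)) * (\<Prod>l<L. Gamma (s + 1 / (\<beta> * c l)))"
    by (simp add: prod.distrib)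
  have "rGamma (s - 1 / (\<beta> * d m)) = (s - 1 / (\<beta> * d m)) * rGamma (s + 1 - 1 / (\<beta> * d m))" for m
    using rGamma_plus1[of "s - 1 / (\<beta> * d m)"] by (simp add: algebra_simps)
  hence denominator: "(\<Prod>m<M. rGamma (s - 1 / (\<beta> * d m))) = (\<Prod>m<M. s - 1 / (\<beta> * d m)) * (\<Prod>m<M. rGamma (s + 1 - 1 / (\<beta> * d m)))"
    by (simp flip: prod.distrib)
  show ?thesis unfolding gamma_quotient_def numerator denominator by (simp add: mult_ac)
qed

lemma strip_decay_gamma_quotient: "strip_decay ((real L - real M) * (pi/2)) (gamma_quotient L M \<beta> c d)"
proof -
  have "strip_decay (real L * (pi/2) + real M * (- pi/2))
     (\<lambda>s. (\<Prod>l<L. Gamma (s + 1 / (\<beta> * c l))) * (\<Prod>m<M. rGamma (s + - (1 / (\<beta> * d m)))))"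
    by (intro strip_decay_mult strip_decay_prod strip_decay_shift strip_decay_Gamma strip_decay_rGamma)
  moreover have "real L * (pi/2) + real M * (- pi/2) = (real L - real M) * (pi/2)"
    by (simp add: algebra_simps)
  ultimately show ?thesis unfolding gamma_quotient_def[abs_def] by (simp only: diff_conv_add_uminus)
qed

lemma Gcd_eq_kappa_mult:
  assumes "\<beta> \<noteq> 0" "\<forall>l<L. c l \<noteq> 0" "\<forall>m<M. d m \<noteq> 0"
  shows "Gcd L M c d (\<beta> * s) = kappa L M \<beta> c d * (\<Prod>l<L. s + 1 / (\<beta> * c l)) / (\<Prod>m<M. s - 1 / (\<beta> * d m))"
proof -
  have numerator: "(\<Prod>l<L. 1 + c l * (\<beta> * s)) = (\<Prod>l<L. \<beta> * c l) * (\<Prod>l<L. s + 1 / (\<beta> * c l))"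
    unfolding prod.distrib[symmetric] using assms by (intro prod.cong refl) (auto simp: field_simps)
  have "(\<Prod>m<M. 1 - d m * (\<beta> * s)) = (\<Prod>m<M. - (\<beta> * d m) * (s - 1 / (\<beta> * d m)))"
    using assms by (intro prod.cong refl) (auto simp: field_simps)
  also have "\<dots> = (-1) ^ M * (\<Prod>m<M. \<beta> * d m) * (\<Prod>m<M. s - 1 / (\<beta> * d m))"
    unfolding prod.distrib[of "\<lambda>m. - (\<beta> * d m)"] by (subst prod_uminus) simp
  finally show ?thesis unfolding Gcd_def kappa_def numerator by (cases "even M") simp_all
qed

locale mellin_barnes =
  fixes L M :: nat and \<beta> :: complex and c d :: "nat \<Rightarrow> complex"
  assumes beta: "\<beta> \<noteq> 0"
    and c_nz: "\<forall>l<L. c l \<noteq> 0" and d_nz: "\<forall>m<M. d m \<noteq> 0"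
    and c_gen: "\<forall>l<L. 1 / (\<beta> * c l) \<notin> \<int>"
    and d_gen: "\<forall>m<M. 1 / (\<beta> * d m) \<notin> \<int>"
begin

abbreviation quot :: "complex \<Rightarrow> complex" where "quot \<equiv> gamma_quotient L M \<beta> c d"
abbreviation \<kappa> :: complex where "\<kappa> \<equiv> kappa L M \<beta> c d"
abbreviation x_of :: "complex \<Rightarrow> complex" where "x_of \<equiv> xof L M \<beta> c d"
abbreviation prefactor :: "int \<Rightarrow> complex" where "prefactor \<equiv> Ck L M \<beta> c d"
abbreviation series_term :: "int \<Rightarrow> complex \<Rightarrow> nat \<Rightarrow> complex" where
  "series_term k \<zeta> \<equiv> phi_term L M \<beta> c d k (x_of \<zeta>)"
abbreviation mb_integral :: "(real \<Rightarrow> complex) \<Rightarrow> int \<Rightarrow> complex \<Rightarrow> complex" where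
  "mb_integral \<equiv> phitilde L M \<beta> c d"
abbreviation GD_mb_integral :: "(real \<Rightarrow> complex) \<Rightarrow> int \<Rightarrow> complex \<Rightarrow> complex" where
  "GD_mb_integral \<equiv> GD_phitilde L M \<beta> c d"

definition weight :: "complex \<Rightarrow> complex \<Rightarrow> complex" where
  "weight \<zeta> s = quot s * exp (s * \<zeta>)"

lemma kappa_nonzero: "\<kappa> \<noteq> 0"
  unfolding kappa_def using beta c_nz d_nz by auto

lemma of_int_not_left_pole: "of_int j \<notin> left_poles L \<beta> c"
proof
  assume "of_int j \<in> left_poles L \<beta> c"
  then obtain i l where "l < L" "of_int j = - of_nat i - 1 / (\<beta> * c l)" by (auto simp: left_poles_def)
  hence "1 / (\<beta> * c l) = of_int (- int i - j)" by (simp add: algebra_simps)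
  thus False using c_gen \<open>l < L\<close> Ints_of_int by metis
qed

lemma poles_disjoint: "right_poles k \<inter> left_poles L \<beta> c = {}"
  using right_poles_subset_Ints of_int_not_left_pole by (fastforce elim: Ints_cases)

lemma quot_of_int_nonzero: "quot (of_int j) \<noteq> 0"
proof -
  have "Gamma (of_int j + 1 / (\<beta> * c l)) \<noteq> 0" if "l < L" for l
    using not_left_pole_imp_not_nonpos_Int[OF of_int_not_left_pole that] by (simp add: Gamma_eq_zero_iff)
  moreover have "rGamma (of_int j - 1 / (\<beta> * d m)) \<noteq> 0" if "m < M" for m
  proof
    assume "rGamma (of_int j - 1 / (\<beta> * d m)) = 0"
    hence "of_int j - 1 / (\<beta> * d m) \<in> \<int>"
      unfolding rGamma_eq_zero_iff using nonpos_Ints_subset_Ints by blast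
    from Ints_diff[OF Ints_of_int[of j] this] show False using d_gen that by simp
  qed
  ultimately show ?thesis unfolding gamma_quotient_def by auto
qed

lemma Gcd_mult_quot:
  assumes "s \<notin> left_poles L \<beta> c" "\<forall>m<M. s \<noteq> 1 / (\<beta> * d m)"
  shows "Gcd L M c d (\<beta> * s) * quot s = \<kappa> * quot (s + 1)"
proof -
  have "(\<Prod>m<M. s - 1 / (\<beta> * d m)) \<noteq> 0" using assms(2) by auto
  thus ?thesis unfolding Gcd_eq_kappa_mult[OF beta c_nz d_nz] using gamma_quotient_plus1[OF assms(1), of M d]
    by (simp add: divide_simps mult.assoc mult.commute)
qed

lemma Gcd_of_int: "Gcd L M c d (of_int i * \<beta>) = \<kappa> * quot (of_int i + 1) / quot (of_int i)"
proof -
  have "of_int i \<noteq> 1 / (\<beta> * d m)" if "m < M" for m using d_gen that Ints_of_int by metis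
  hence "Gcd L M c d (\<beta> * of_int i) * quot (of_int i) = \<kappa> * quot (of_int i + 1)"
    by (intro Gcd_mult_quot of_int_not_left_pole) auto
  thus ?thesis using quot_of_int_nonzero[of i] by (simp add: field_simps)
qed

lemma quot_0: "quot 0 = \<kappa> * quot 1"
  using Gcd_of_int[of 0] quot_of_int_nonzero[of 0] by (simp add: Gcd_def)

lemma rr_eq: "rr L M \<beta> c d i = \<beta> * \<kappa> * quot (of_int (i + 1)) / quot (of_int i)"
  by (simp add: rr_def Gcd_of_int)

lemma rho_plus1: "0 \<le> i \<Longrightarrow> rho L M \<beta> c d (i + 1) = rr L M \<beta> c d (i + 1) * rho L M \<beta> c d i"
  by (simp add: rho_def nat_add_distrib mult.commute add.commute)

lemma rho_minus1:
  assumes "i \<le> 0"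
  shows "rho L M \<beta> c d (i - 1) = rho L M \<beta> c d i / rr L M \<beta> c d i"
proof -
  define n where "n = nat (- i)"
  have "i = - int n" using assms by (simp add: n_def)
  thus ?thesis by (simp add: rho_def divide_inverse nat_add_distrib)
qed

lemma rho_eq: "rho L M \<beta> c d i = (\<beta> * \<kappa>) powi i * quot (of_int (i + 1)) / quot 1"
proof (induction i rule: int_induct[where k = 0])
  case base
  show ?case using quot_of_int_nonzero[of 1] by (simp add: rho_def)
next
  case (step1 i)
  show ?case unfolding rho_plus1[OF step1(1)] rr_eq step1(2)
    using beta kappa_nonzero quot_of_int_nonzero[of "i + 1"] by (simp add: power_int_add_1)
next
  case (step2 i)
  show ?case unfolding rho_minus1[OF step2(1)] rr_eq step2(2)
    using beta kappa_nonzero quot_of_int_nonzero[of "i + 1"] quot_of_int_nonzero[of i] by (simp add: power_int_diff)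
qed

lemma prefactor_eq: "prefactor k = (- \<beta>) powi (1 - k) / quot 0"
proof -
  have "(- \<beta>) powi (1 - k) = inverse ((- \<beta>) powi (k - 1))"
    using power_int_minus[of "-\<beta>" "k - 1"] by simp
  thus ?thesis unfolding Ck_def gamma_quotient_def prod_rGamma by (simp add: field_simps)
qed

lemma prefactor_pred: "prefactor (k - 1) = - \<beta> * prefactor k"
proof -
  have shift: "1 - (k - 1) = (1 - k) + 1" by simp
  have "(- \<beta>) powi (1 - (k - 1)) = (- \<beta>) powi (1 - k) * (- \<beta>)"
    unfolding shift by (rule power_int_add_1) (use beta in simp)
  thus ?thesis by (simp add: prefactor_eq)
qed

lemma exp_eq_x_of: "exp \<zeta> = - \<kappa> * x_of \<zeta>"
  unfolding xof_def using kappa_nonzero by simp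

lemma x_of_nonzero: "x_of \<zeta> \<noteq> 0"
  unfolding xof_def using kappa_nonzero by simp

lemma series_term_eq_residue_term: "series_term k \<zeta> n = prefactor k * residue_term k (weight \<zeta>) n"
proof -
  define x i where "x = x_of \<zeta>" and "i = int n - k + 1"
  have x: "x \<noteq> 0" by (simp add: x_def x_of_nonzero)
  have n: "1 - k = i - int n" by (simp add: i_def)
  have pole: "right_pole k n = of_int i" by (simp add: right_pole_def i_def)
  have sign: "(- \<beta>) powi (1 - k) * (-1) ^ n = (- \<beta>) powi i / \<beta> ^ n"
    unfolding n using beta by (simp add: power_int_diff power_minus[of \<beta> n])
  have "exp (right_pole k n * \<zeta>) = (- \<kappa> * x) powi i"
    unfolding pole x_def exp_eq_x_of[symmetric] by (simp add: exp_power_int)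
  hence "prefactor k * residue_term k (weight \<zeta>) n
      = ((- \<beta>) powi (1 - k) * (-1) ^ n) * (- \<kappa> * x) powi i * quot (of_int i) / (fact n * quot 0)"
    unfolding residue_term_def weight_def prefactor_eq pole by (simp add: mult_ac)
  also have "\<dots> = (- \<beta> * (- \<kappa> * x)) powi i / \<beta> ^ n * quot (of_int i) / (fact n * quot 0)"
    unfolding sign by (simp only: power_int_mult_distrib) simp
  also have "- \<beta> * (- \<kappa> * x) = \<beta> * \<kappa> * x" by simp
  also have "(\<beta> * \<kappa> * x) powi i = \<beta> * \<kappa> * (\<beta> * \<kappa>) powi (i - 1) * (x powi (1 - k) * x ^ n)"
    unfolding n power_int_mult_distrib using x beta kappa_nonzero by (simp add: power_int_diff power_int_mult_distrib)
  also have "\<beta> * \<kappa> * (\<beta> * \<kappa>) powi (i - 1) * (x powi (1 - k) * x ^ n) / \<beta> ^ n * quot (of_int i) / (fact n * quot 0)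
      = phi_term L M \<beta> c d k x n"
    unfolding phi_term_def rho_eq quot_0 using kappa_nonzero by (simp add: i_def power_divide mult_ac)
  finally show ?thesis by (simp add: x_def)
qed

lemma series_term_pred: "series_term (k - 1) \<zeta> n = \<beta> * of_nat (Suc n) * series_term k \<zeta> (Suc n)"
  unfolding series_term_eq_residue_term residue_term_def prefactor_pred right_pole_pred_Suc
  by (simp add: field_simps del: of_nat_Suc)

lemma holomorphic_weight: "weight \<zeta> holomorphic_on - left_poles L \<beta> c"
  unfolding weight_def by (intro holomorphic_intros holomorphic_gamma_quotient)

lemma holomorphic_weight_shift: "(\<lambda>s. weight \<zeta> (s + 1)) holomorphic_on - left_poles L \<beta> c"
proof (rule holomorphic_on_compose_gen[unfolded o_def, OF _ holomorphic_weight])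
  show "(\<lambda>s. s + 1) ` (- left_poles L \<beta> c) \<subseteq> - left_poles L \<beta> c"
    using left_poles_minus_1[of _ L \<beta> c] by force
qed (intro holomorphic_intros)

lemma mb_integral_eq: "mb_integral \<gamma> k \<zeta> = prefactor k / (2 * of_real pi * \<i>) * line_integral (gamma_kernel k (weight \<zeta>)) \<gamma>"
  by (simp add: phitilde_def integrand_eq_gamma_kernel weight_def[abs_def])

text \<open>The contour may pass through, or even rest at, a zero of the denominator of \<open>Gcd\<close>, where the
  quotient takes the junk value 0.\<close>

lemma x_mult_GD_mb_integral:
  assumes reg: "regular_contour \<gamma>" and avoid: "\<forall>p\<in>left_poles L \<beta> c. p \<notin> range \<gamma>"
  shows "\<beta> * x_of \<zeta> * GD_mb_integral \<gamma> k \<zeta>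
     = prefactor (k - 1) / (2 * of_real pi * \<i>) * line_integral (gamma_kernel k (\<lambda>s. weight \<zeta> (s + 1))) \<gamma>"
proof -
  let ?f = "gamma_kernel k (\<lambda>s. weight \<zeta> (s + 1))"
  have "line_integral (\<lambda>s. Gcd L M c d (\<beta> * s) * integrand L M \<beta> c d k \<zeta> s) \<gamma> = line_integral (\<lambda>s. \<kappa> * exp (- \<zeta>) * ?f s) \<gamma>"
  proof (rule line_integral_cong_off_finite[OF reg, where X = "(\<lambda>m. 1 / (\<beta> * d m)) ` {..<M}"])
    fix t assume t: "\<gamma> t \<notin> (\<lambda>m. 1 / (\<beta> * d m)) ` {..<M}"
    define s where "s = \<gamma> t"
    have quot_step: "Gcd L M c d (\<beta> * s) * quot s = \<kappa> * quot (s + 1)"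
      by (rule Gcd_mult_quot) (use avoid t in \<open>auto simp: s_def\<close>)
    have "Gcd L M c d (\<beta> * s) * integrand L M \<beta> c d k \<zeta> s
        = Gamma (1 - of_int k - s) * exp (s * \<zeta>) * (Gcd L M c d (\<beta> * s) * quot s)"
      unfolding integrand_eq_gamma_kernel gamma_kernel_def by (simp add: mult_ac)
    also have "\<dots> = \<kappa> * exp (- \<zeta>) * ?f s"
      unfolding quot_step gamma_kernel_def weight_def by (simp add: distrib_right exp_add exp_minus)
    finally show "Gcd L M c d (\<beta> * \<gamma> t) * integrand L M \<beta> c d k \<zeta> (\<gamma> t) = \<kappa> * exp (- \<zeta>) * ?f (\<gamma> t)"
      by (simp add: s_def)
  qed auto
  also have "\<dots> = \<kappa> * exp (- \<zeta>) * line_integral ?f \<gamma>"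
    unfolding line_integral_def by (simp add: mult.assoc)
  finally show ?thesis unfolding GD_phitilde_def prefactor_pred xof_def using kappa_nonzero
    by (simp add: exp_minus field_simps)
qed

lemma relations_holdI:
  assumes derivative: "\<And>k \<zeta>. \<zeta> \<in> \<Omega> \<Longrightarrow> (mb_integral (\<gamma> k) k has_field_derivative
      mb_integral (\<gamma> (k - 1)) (k - 1) \<zeta> / \<beta> - of_int (k - 1) * mb_integral (\<gamma> k) k \<zeta>) (at \<zeta>)"
    and GD: "\<And>k \<zeta>. \<zeta> \<in> \<Omega> \<Longrightarrow> \<beta> * x_of \<zeta> * GD_mb_integral (\<gamma> k) k \<zeta> = mb_integral (\<gamma> (k - 1)) (k - 1) \<zeta>"
  shows "relations_hold L M \<beta> c d \<gamma> \<Omega>"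
  unfolding relations_hold_def
proof (intro allI ballI)
  fix k \<zeta> assume \<zeta>: "\<zeta> \<in> \<Omega>"
  have "x_of \<zeta> * GD_mb_integral (\<gamma> k) k \<zeta> = mb_integral (\<gamma> (k - 1)) (k - 1) \<zeta> / \<beta>"
    using GD[OF \<zeta>, of k] beta by (simp add: field_simps)
  thus "mb_integral (\<gamma> k) k field_differentiable at \<zeta> \<and>
       \<beta> * (deriv (mb_integral (\<gamma> k) k) \<zeta> + of_int (k - 1) * mb_integral (\<gamma> k) k \<zeta>) = mb_integral (\<gamma> (k - 1)) (k - 1) \<zeta> \<and>
       \<beta> * x_of \<zeta> * GD_mb_integral (\<gamma> k) k \<zeta> = mb_integral (\<gamma> (k - 1)) (k - 1) \<zeta> \<and>
       x_of \<zeta> * GD_mb_integral (\<gamma> k) k \<zeta> - deriv (mb_integral (\<gamma> k) k) \<zeta> = of_int (k - 1) * mb_integral (\<gamma> k) k \<zeta>"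
    using derivative[OF \<zeta>, of k] DERIV_imp_deriv[OF derivative[OF \<zeta>, of k]] GD[OF \<zeta>, of k] beta
    by (auto simp: field_differentiable_def)
qed

section \<open>The residue series and the Hankel contour\<close>

lemma tendsto_inverse_shift_at_infinity: "((\<lambda>s. inverse (s + z)) \<longlongrightarrow> 0) at_infinity" for z :: complex
  by (rule filterlim_compose[OF tendsto_inverse_0 tendsto_add_filterlim_at_infinity'[OF filterlim_ident tendsto_const]])

lemma tendsto_ratio_shift_at_infinity: "((\<lambda>s. (s + w) / (s + z)) \<longlongrightarrow> 1) at_infinity" for w z :: complex
proof (rule Lim_transform_eventually)
  have "((\<lambda>s. 1 + (w - z) * inverse (s + z)) \<longlongrightarrow> 1 + (w - z) * 0) at_infinity"
    by (intro tendsto_add tendsto_mult tendsto_const tendsto_inverse_shift_at_infinity)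
  thus "((\<lambda>s. 1 + (w - z) * inverse (s + z)) \<longlongrightarrow> 1) at_infinity" by simp
  have "\<forall>\<^sub>F s in at_infinity. s \<noteq> - z" by (rule eventually_not_equal_at_infinity)
  thus "\<forall>\<^sub>F s in at_infinity. 1 + (w - z) * inverse (s + z) = (s + w) / (s + z)"
    by eventually_elim (simp add: field_simps eq_neg_iff_add_eq_0)
qed

definition step_ratio :: "int \<Rightarrow> complex \<Rightarrow> complex" where
  "step_ratio k s = (\<Prod>l<L. s + 1 / (\<beta> * c l)) / ((of_int k + s) * (\<Prod>m<M. s - 1 / (\<beta> * d m)))"

lemma step_ratio_tendsto:
  assumes "L \<le> M + 1"
  shows "(step_ratio k \<longlongrightarrow> (if L = M + 1 then 1 else 0)) at_infinity"
proof -
  define e where "e = (\<lambda>m. if m < M then - 1 / (\<beta> * d m) else of_int k)"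
  have eq: "step_ratio k s = (\<Prod>l<L. (s + 1 / (\<beta> * c l)) / (s + e l)) * (\<Prod>m\<in>{L..<Suc M}. inverse (s + e m))" for s
  proof -
    have "(\<Prod>m<M. s - 1 / (\<beta> * d m)) = (\<Prod>m<M. s + e m)" by (intro prod.cong) (auto simp: e_def)
    hence "(of_int k + s) * (\<Prod>m<M. s - 1 / (\<beta> * d m)) = (\<Prod>m<Suc M. s + e m)"
      by (simp add: e_def add_ac mult_ac)
    also have "{..<Suc M} = {..<L} \<union> {L..<Suc M}" using assms by auto
    also have "(\<Prod>m\<in>{..<L} \<union> {L..<Suc M}. s + e m) = (\<Prod>m<L. s + e m) * (\<Prod>m\<in>{L..<Suc M}. s + e m)"
      by (rule prod.union_disjoint) auto
    finally show ?thesis unfolding step_ratio_def prod_dividef prod_inversef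
      by (simp only: divide_inverse inverse_mult_distrib mult.assoc prod_inversef[symmetric] o_def)
  qed
  have "((\<lambda>s. (\<Prod>l<L. (s + 1 / (\<beta> * c l)) / (s + e l)) * (\<Prod>m\<in>{L..<Suc M}. inverse (s + e m)))
     \<longlongrightarrow> (\<Prod>l<L. 1) * (\<Prod>m\<in>{L..<Suc M}. 0)) at_infinity"
    by (intro tendsto_mult tendsto_prod tendsto_ratio_shift_at_infinity tendsto_inverse_shift_at_infinity)
  moreover have "(\<Prod>l<L. 1) * (\<Prod>m\<in>{L..<Suc M}. 0) = (if L = M + 1 then 1 else 0 :: complex)"
    using assms by (auto simp: power_0_left)
  ultimately show ?thesis unfolding eq[abs_def] by (simp only:)
qed

definition convergence_domain :: "complex set" where
  "convergence_domain = (if L \<le> M then UNIV else if L = M + 1 then {\<zeta>. Re \<zeta> < 0} else {})"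

lemma convergence_domain_eq:
  "L \<le> M \<Longrightarrow> convergence_domain = UNIV" "L = M + 1 \<Longrightarrow> convergence_domain = {\<zeta>. Re \<zeta> < 0}"
  unfolding convergence_domain_def by simp_all

lemma open_convergence_domain: "open convergence_domain"
  by (auto simp: convergence_domain_def open_halfspace_Re_lt)

lemma convergence_domain_larger_Re:
  assumes "\<zeta> \<in> convergence_domain"
  obtains \<zeta>' where "\<zeta>' \<in> convergence_domain" "Re \<zeta> < Re \<zeta>'"
proof (cases "L \<le> M")
  case True
  thus ?thesis using that[of "\<zeta> + 1"] by (auto simp: convergence_domain_def)
next
  case False
  thus ?thesis using that[of "\<zeta> / 2"] assms by (auto simp: convergence_domain_def split: if_splits)
qed

definition regular_at :: "int \<Rightarrow> complex \<Rightarrow> bool" where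
  "regular_at k s \<longleftrightarrow> s \<notin> left_poles L \<beta> c \<and> (\<forall>m<M. s \<noteq> 1 / (\<beta> * d m)) \<and> of_int k + s \<noteq> 0"

lemma regular_at_if_Re_large:
  obtains R where "\<And>s. R \<le> Re s \<Longrightarrow> regular_at k s"
proof -
  define B where "B = (\<Sum>l<L. norm (1 / (\<beta> * c l)))"
  define D where "D = (\<Sum>m<M. norm (1 / (\<beta> * d m)))"
  have D: "Re (1 / (\<beta> * d m)) \<le> D" if "m < M" for m
    unfolding D_def using complex_Re_le_cmod[of "1 / (\<beta> * d m)"]
      member_le_sum[of m "{..<M}" "\<lambda>m. norm (1 / (\<beta> * d m))"] that by auto
  show ?thesis
  proof (rule that[of "max B (max D \<bar>of_int k\<bar>) + 1"])
    fix s assume s: "max B (max D \<bar>of_int k\<bar>) + 1 \<le> Re s"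
    have "Re (of_int k + s) > 0" using s by auto
    hence "of_int k + s \<noteq> 0" by (metis less_irrefl zero_complex.sel(1))
    moreover have "s \<notin> left_poles L \<beta> c" using Re_left_pole_le[of s L \<beta> c] s by (auto simp: B_def)
    moreover have "s \<noteq> 1 / (\<beta> * d m)" if "m < M" for m using D[OF that] s by auto
    ultimately show "regular_at k s" by (simp add: regular_at_def)
  qed
qed

lemma step_ratio_contraction:
  assumes "\<zeta> \<in> convergence_domain"
  obtains q R where "0 < q" "q < 1" "\<And>s. R \<le> Re s \<Longrightarrow> regular_at k s" "\<And>s. R \<le> Re s \<Longrightarrow> norm (exp \<zeta> * step_ratio k s) \<le> q"
proof -
  define l where "l = norm (exp \<zeta> * (if L = M + 1 then 1 else 0))"
  have l: "0 \<le> l" "l < 1" using assms by (auto simp: l_def convergence_domain_def split: if_splits)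
  have "((\<lambda>s. norm (exp \<zeta> * step_ratio k s)) \<longlongrightarrow> l) at_infinity"
    unfolding l_def using assms
    by (intro tendsto_intros step_ratio_tendsto) (auto simp: convergence_domain_def split: if_splits)
  hence "\<forall>\<^sub>F s in at_infinity. norm (exp \<zeta> * step_ratio k s) < (1 + l) / 2"
    by (rule order_tendstoD(2)) (use l in simp)
  then obtain R where R: "\<And>s. R \<le> norm s \<Longrightarrow> norm (exp \<zeta> * step_ratio k s) < (1 + l) / 2"
    unfolding eventually_at_infinity by blast
  obtain R' where R': "\<And>s. R' \<le> Re s \<Longrightarrow> regular_at k s" using regular_at_if_Re_large by metis
  show ?thesis
  proof (rule that[of "(1 + l) / 2" "max R R'"])
    show "norm (exp \<zeta> * step_ratio k s) \<le> (1 + l) / 2" if "max R R' \<le> Re s" for s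
      using R[of s] that complex_Re_le_cmod[of s] by simp
  qed (use l R' in auto)
qed

lemma weight_plus1:
  assumes "regular_at k s"
  shows "weight \<zeta> (s + 1) = exp \<zeta> * step_ratio k s * (of_int k + s) * weight \<zeta> s"
proof -
  have "(\<Prod>m<M. s - 1 / (\<beta> * d m)) \<noteq> 0" using assms by (auto simp: regular_at_def)
  hence "quot (s + 1) = (\<Prod>l<L. s + 1 / (\<beta> * c l)) * quot s / (\<Prod>m<M. s - 1 / (\<beta> * d m))"
    using gamma_quotient_plus1[of s L \<beta> c M d] assms by (simp add: regular_at_def eq_divide_eq)
  also have "\<dots> = step_ratio k s * (of_int k + s) * quot s"
    using assms by (simp add: step_ratio_def regular_at_def)
  finally have quot_step: "quot (s + 1) = step_ratio k s * (of_int k + s) * quot s" .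
  have "exp ((s + 1) * \<zeta>) = exp (s * \<zeta>) * exp \<zeta>" by (simp add: distrib_right exp_add)
  thus ?thesis unfolding weight_def quot_step by (simp only: mult_ac)
qed

text \<open>By the reflection formula the integrand is \<open>pi / sin (pi (k + s))\<close> times this function.\<close>

definition reflected :: "int \<Rightarrow> complex \<Rightarrow> complex \<Rightarrow> complex" where
  "reflected k \<zeta> s = rGamma (of_int k + s) * weight \<zeta> s"

lemma reflected_plus1:
  assumes "regular_at k s"
  shows "reflected k \<zeta> (s + 1) = exp \<zeta> * step_ratio k s * reflected k \<zeta> s"
proof -
  have "(of_int k + s) * rGamma (of_int k + (s + 1)) = rGamma (of_int k + s)"
    using rGamma_plus1[of "of_int k + s"] by (simp add: add.assoc)
  thus ?thesis unfolding reflected_def weight_plus1[OF assms] by (metis mult.assoc mult.commute)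
qed

lemma half_strip_decay_reflected:
  assumes "\<zeta> \<in> convergence_domain"
  shows "half_strip_decay (reflected k \<zeta>)"
proof -
  obtain q R where q: "0 < q" "q < 1" and regular: "\<And>s. R \<le> Re s \<Longrightarrow> regular_at k s"
    and ratio: "\<And>s. R \<le> Re s \<Longrightarrow> norm (exp \<zeta> * step_ratio k s) \<le> q"
    using step_ratio_contraction[OF assms] by metis
  show ?thesis
  proof (rule half_strip_decay_if_contraction[OF q])
    have "continuous_on {s. R \<le> Re s} (weight \<zeta>)"
      using regular by (intro continuous_on_subset[OF holomorphic_on_imp_continuous_on[OF holomorphic_weight]])
        (auto simp: regular_at_def)
    moreover have "continuous_on {s. R \<le> Re s} (\<lambda>s. rGamma (of_int k + s))"
      by (intro holomorphic_on_imp_continuous_on holomorphic_intros)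
    ultimately show "continuous_on {s. R \<le> Re s} (reflected k \<zeta>)"
      unfolding reflected_def[abs_def] by (intro continuous_intros)
    show "norm (reflected k \<zeta> (s + 1)) \<le> q * norm (reflected k \<zeta> s)" if "R \<le> Re s" for s
      unfolding reflected_plus1[OF regular[OF that]] norm_mult[of "exp \<zeta> * step_ratio k s"]
      by (intro mult_right_mono ratio that norm_ge_zero)
  qed
qed

lemma norm_series_term: "norm (series_term k \<zeta> n) = norm (prefactor k) * norm (reflected k \<zeta> (right_pole k n))"
proof -
  have "of_int k + right_pole k n = of_nat (Suc n)" by (simp add: right_pole_def)
  hence "rGamma (of_int k + right_pole k n) = inverse (fact n)"
    unfolding rGamma_inverse_Gamma using Gamma_fact[of n, where 'a = complex] by simp
  thus ?thesis unfolding series_term_eq_residue_term residue_term_def reflected_def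
    by (simp add: norm_mult norm_divide norm_inverse norm_power divide_inverse)
qed

lemma summable_norm_series_term:
  assumes "\<zeta> \<in> convergence_domain"
  shows "summable (\<lambda>n. norm (series_term k \<zeta> n))"
proof -
  obtain C \<delta> x where C: "0 < \<delta>" "\<And>s. x \<le> Re s \<Longrightarrow> \<bar>Im s\<bar> \<le> 0 \<Longrightarrow> norm (reflected k \<zeta> s) \<le> C * exp (- \<delta> * Re s)"
    using half_strip_decayE[OF half_strip_decay_reflected[OF assms]] by metis
  let ?K = "norm (prefactor k) * (C * exp (- \<delta> * (1 - of_int k)))"
  have geometric: "summable (\<lambda>n. ?K * exp (- \<delta>) ^ n)" using C(1) by (intro summable_mult summable_geometric) simp
  have "\<forall>\<^sub>F n in sequentially. x \<le> 1 - of_int k + real n" by real_asymp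
  hence "\<forall>\<^sub>F n in sequentially. norm (norm (series_term k \<zeta> n)) \<le> ?K * exp (- \<delta>) ^ n"
  proof eventually_elim
    case (elim n)
    have "norm (reflected k \<zeta> (right_pole k n)) \<le> C * exp (- \<delta> * (1 - of_int k + real n))"
      using C(2)[of "right_pole k n"] elim by simp
    also have "- \<delta> * (1 - of_int k + real n) = - \<delta> * (1 - of_int k) + real n * (- \<delta>)" by (simp add: algebra_simps)
    finally have "norm (reflected k \<zeta> (right_pole k n)) \<le> C * exp (- \<delta> * (1 - of_int k)) * exp (- \<delta>) ^ n"
      by (simp only: exp_add exp_of_nat_mult mult.assoc)
    from mult_left_mono[OF this norm_ge_zero[of "prefactor k"]] show ?case
      unfolding norm_series_term by (simp add: mult.assoc)
  qed
  thus ?thesis using geometric by (rule summable_comparison_test_ev)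
qed

lemma hankel_sums:
  assumes "hankel_contour L \<beta> c k \<gamma>" "\<zeta> \<in> convergence_domain"
  shows "series_term k \<zeta> sums mb_integral \<gamma> k \<zeta>"
proof -
  have "residue_term k (weight \<zeta>) sums (line_integral (gamma_kernel k (weight \<zeta>)) \<gamma> / (2 * of_real pi * \<i>))"
    using half_strip_decay_reflected[OF assms(2), of k]
    by (intro residue_series_sums_hankel_contour[OF assms(1) poles_disjoint holomorphic_weight]) (simp add: reflected_def[abs_def])
  from sums_mult[OF this, of "prefactor k"] show ?thesis
    by (simp add: mb_integral_eq series_term_eq_residue_term[abs_def])
qed

lemma hankel_GD_sums:
  assumes hc: "hankel_contour L \<beta> c k \<gamma>" and "\<zeta> \<in> convergence_domain"
  shows "series_term (k - 1) \<zeta> sums (\<beta> * x_of \<zeta> * GD_mb_integral \<gamma> k \<zeta>)"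
proof -
  have "half_strip_decay (\<lambda>s. rGamma (of_int k + s) * weight \<zeta> (s + 1))"
    using half_strip_decay_shift[OF half_strip_decay_reflected[OF assms(2), of "k - 1"]]
    by (simp add: reflected_def algebra_simps)
  from residue_series_sums_hankel_contour[OF hc poles_disjoint holomorphic_weight_shift this]
  have "residue_term (k - 1) (weight \<zeta>) sums
      (line_integral (gamma_kernel k (\<lambda>s. weight \<zeta> (s + 1))) \<gamma> / (2 * of_real pi * \<i>))"
    unfolding residue_term_shift .
  moreover have "\<beta> * x_of \<zeta> * GD_mb_integral \<gamma> k \<zeta>
      = prefactor (k - 1) / (2 * of_real pi * \<i>) * line_integral (gamma_kernel k (\<lambda>s. weight \<zeta> (s + 1))) \<gamma>"
    by (rule x_mult_GD_mb_integral) (use hc in \<open>auto simp: hankel_contour_def\<close>)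
  ultimately show ?thesis
    using sums_mult[of _ _ "prefactor (k - 1)"] by (fastforce simp: series_term_eq_residue_term[abs_def])
qed

definition power_coeff :: "int \<Rightarrow> nat \<Rightarrow> complex" where
  "power_coeff k n = prefactor k * ((-1) ^ n / fact n * quot (right_pole k n))"

definition power_series :: "int \<Rightarrow> complex \<Rightarrow> complex" where
  "power_series k w = (\<Sum>n. power_coeff k n * w ^ n)"

lemma series_term_eq_power: "series_term k \<zeta> n = exp (of_int (1 - k) * \<zeta>) * (power_coeff k n * exp \<zeta> ^ n)"
  unfolding series_term_eq_residue_term residue_term_def weight_def power_coeff_def right_pole_def
    distrib_right exp_add exp_of_nat_mult by (simp add: mult_ac)

lemma diffs_power_coeff: "diffs (power_coeff k) n = power_coeff (k - 1) n / \<beta>"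
  unfolding diffs_def power_coeff_def prefactor_pred right_pole_pred_Suc using beta
  by (simp add: field_simps del: of_nat_Suc)

lemma summable_power_coeff:
  assumes "\<zeta> \<in> convergence_domain"
  shows "summable (\<lambda>n. power_coeff k n * exp \<zeta> ^ n)"
proof -
  have "summable (\<lambda>n. exp (- (of_int (1 - k) * \<zeta>)) * series_term k \<zeta> n)"
    by (intro summable_mult summable_norm_cancel[OF summable_norm_series_term[OF assms]])
  thus ?thesis unfolding series_term_eq_power mult.assoc[symmetric] exp_add[symmetric] by simp
qed

lemma mb_integral_eq_power_series:
  assumes "hankel_contour L \<beta> c k \<gamma>" "\<zeta> \<in> convergence_domain"
  shows "mb_integral \<gamma> k \<zeta> = exp (of_int (1 - k) * \<zeta>) * power_series k (exp \<zeta>)"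
proof -
  have "series_term k \<zeta> sums (exp (of_int (1 - k) * \<zeta>) * power_series k (exp \<zeta>))"
    unfolding series_term_eq_power[abs_def] power_series_def
    by (intro sums_mult summable_sums summable_power_coeff assms(2))
  with hankel_sums[OF assms] show ?thesis by (rule sums_unique2)
qed

lemma has_field_derivative_power_series:
  assumes "\<zeta> \<in> convergence_domain"
  shows "(power_series k has_field_derivative power_series (k - 1) (exp \<zeta>) / \<beta>) (at (exp \<zeta>))"
proof -
  obtain \<zeta>' where "\<zeta>' \<in> convergence_domain" "Re \<zeta> < Re \<zeta>'" using convergence_domain_larger_Re[OF assms] by metis
  hence "(power_series k has_field_derivative (\<Sum>n. diffs (power_coeff k) n * exp \<zeta> ^ n)) (at (exp \<zeta>))"
    unfolding power_series_def[abs_def] by (intro termdiffs_strong[OF summable_power_coeff[of \<zeta>']]) auto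
  also have "(\<Sum>n. diffs (power_coeff k) n * exp \<zeta> ^ n) = power_series (k - 1) (exp \<zeta>) / \<beta>"
    unfolding power_series_def diffs_power_coeff suminf_divide[OF summable_power_coeff[OF assms], symmetric] by simp
  finally show ?thesis .
qed

lemma hankel_derivative:
  assumes hc: "\<And>k. hankel_contour L \<beta> c k (\<gamma> k)" and \<zeta>: "\<zeta> \<in> convergence_domain"
  shows "(mb_integral (\<gamma> k) k has_field_derivative
    mb_integral (\<gamma> (k - 1)) (k - 1) \<zeta> / \<beta> - of_int (k - 1) * mb_integral (\<gamma> k) k \<zeta>) (at \<zeta>)"
proof (rule has_field_derivative_transform_within_open[OF _ open_convergence_domain \<zeta>])
  have "((\<lambda>z. power_series k (exp z)) has_field_derivative power_series (k - 1) (exp \<zeta>) / \<beta> * exp \<zeta>) (at \<zeta>)"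
    by (rule DERIV_chain2[OF has_field_derivative_power_series[OF \<zeta>] DERIV_exp])
  hence derivative: "((\<lambda>z. exp (of_int (1 - k) * z) * power_series k (exp z)) has_field_derivative
      of_int (1 - k) * exp (of_int (1 - k) * \<zeta>) * power_series k (exp \<zeta>)
        + exp (of_int (1 - k) * \<zeta>) * exp \<zeta> * power_series (k - 1) (exp \<zeta>) / \<beta>) (at \<zeta>)"
    by (auto intro!: derivative_eq_intros simp: algebra_simps)
  have shift: "exp (of_int (1 - (k - 1)) * \<zeta>) = exp (of_int (1 - k) * \<zeta>) * exp \<zeta>"
    by (simp add: algebra_simps flip: exp_add)
  have "mb_integral (\<gamma> (k - 1)) (k - 1) \<zeta> / \<beta> - of_int (k - 1) * mb_integral (\<gamma> k) k \<zeta>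
      = of_int (1 - k) * exp (of_int (1 - k) * \<zeta>) * power_series k (exp \<zeta>)
        + exp (of_int (1 - k) * \<zeta>) * exp \<zeta> * power_series (k - 1) (exp \<zeta>) / \<beta>"
    unfolding mb_integral_eq_power_series[OF hc \<zeta>] shift by (simp add: algebra_simps)
  with derivative show "((\<lambda>z. exp (of_int (1 - k) * z) * power_series k (exp z)) has_field_derivative
      mb_integral (\<gamma> (k - 1)) (k - 1) \<zeta> / \<beta> - of_int (k - 1) * mb_integral (\<gamma> k) k \<zeta>) (at \<zeta>)"
    by (simp only:)
qed (simp add: mb_integral_eq_power_series[OF hc])

theorem hankel_relations:
  assumes "\<And>k. hankel_contour L \<beta> c k (\<gamma> k)"
  shows "relations_hold L M \<beta> c d \<gamma> convergence_domain"
  using hankel_derivative[OF assms] sums_unique2[OF hankel_GD_sums[OF assms] hankel_sums[OF assms]]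
  by (intro relations_holdI) auto

lemma summable_norm_phi_term:
  assumes "L \<le> M" "x \<noteq> 0"
  shows "summable (\<lambda>n. norm (phi_term L M \<beta> c d k x n))"
proof -
  have "x_of (Ln (- \<kappa> * x)) = x" using assms(2) kappa_nonzero by (simp add: xof_def)
  thus ?thesis using summable_norm_series_term[of "Ln (- \<kappa> * x)" k] assms(1) by (simp add: convergence_domain_def)
qed

section \<open>The vertical contour\<close>

definition half_angle :: real where
  "half_angle = (real L - real M + 1) * pi / 2"

lemma half_angle_eq: "M + 1 \<le> L \<Longrightarrow> half_angle = real (L - M + 1) * pi / 2"
  by (simp add: half_angle_def of_nat_diff)

lemma strip_decay_gamma_kernel_quot: "strip_decay half_angle (gamma_kernel k quot)"
proof -
  have "strip_decay (pi/2 + (real L - real M) * (pi/2)) (gamma_kernel k quot)"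
    unfolding gamma_kernel_def[abs_def]
    by (intro strip_decay_mult strip_decay_reflect strip_decay_Gamma strip_decay_gamma_quotient)
  moreover have "pi/2 + (real L - real M) * (pi/2) = half_angle"
    by (simp add: half_angle_def field_simps)
  ultimately show ?thesis by (simp only:)
qed

lemma gamma_kernel_weight: "gamma_kernel k (weight \<zeta>) s = gamma_kernel k quot s * exp (s * \<zeta>)"
  by (simp add: gamma_kernel_def weight_def)

lemma strip_decay_gamma_kernel_weight: "strip_decay (half_angle - \<bar>Im \<zeta>\<bar>) (gamma_kernel k (weight \<zeta>))"
  using strip_decay_mult[OF strip_decay_gamma_kernel_quot strip_decay_exp]
  by (simp add: gamma_kernel_weight[abs_def])

definition line_kernel :: "int \<Rightarrow> nat \<Rightarrow> real \<Rightarrow> complex" where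
  "line_kernel k N t = gamma_kernel k quot (Complex (gap_abscissa k N) t)"

definition line_remainder :: "int \<Rightarrow> nat \<Rightarrow> complex \<Rightarrow> complex" where
  "line_remainder k N = line_transform (gap_abscissa k N) (line_kernel k N)"

definition line_expansion :: "int \<Rightarrow> nat \<Rightarrow> complex \<Rightarrow> complex" where
  "line_expansion k N \<zeta> = prefactor k / (2 * of_real pi) * line_remainder k N \<zeta> + (\<Sum>n<N. series_term k \<zeta> n)"

lemma line_remainder_eq_integral:
  "line_remainder k N \<zeta> = integral UNIV (\<lambda>t. gamma_kernel k (weight \<zeta>) (Complex (gap_abscissa k N) t))"
  by (simp add: line_remainder_def line_transform_def line_kernel_def gamma_kernel_weight)

lemma exp_decay_line_kernel:
  "right_of_left_poles L \<beta> c (gap_abscissa k N) \<Longrightarrow> exp_decay half_angle (line_kernel k N)"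
  unfolding line_kernel_def[abs_def]
  by (rule exp_decay_gap_line[OF holomorphic_gamma_quotient _ strip_decay_gamma_kernel_quot])

lemma residue_expansion_eq_line_expansion:
  "prefactor k / (2 * of_real pi * \<i>) * (\<i> * line_remainder k N \<zeta> + 2 * of_real pi * \<i> * (\<Sum>n<N. residue_term k (weight \<zeta>) n))
    = line_expansion k N \<zeta>"
  by (simp add: line_expansion_def series_term_eq_residue_term field_simps flip: sum_distrib_left)

lemma mb_integral_eq_line_expansion:
  assumes "vertical_contour L \<beta> c k \<gamma>"
  shows "\<forall>\<^sub>F N in sequentially. \<forall>\<zeta>. \<bar>Im \<zeta>\<bar> < half_angle \<longrightarrow> mb_integral \<gamma> k \<zeta> = line_expansion k N \<zeta>"
  using line_integral_vertical_contour[OF assms poles_disjoint]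
proof eventually_elim
  case (elim N)
  show ?case
  proof (intro allI impI)
    fix \<zeta> assume "\<bar>Im \<zeta>\<bar> < half_angle"
    hence "line_integral (gamma_kernel k (weight \<zeta>)) \<gamma>
        = \<i> * line_remainder k N \<zeta> + 2 * of_real pi * \<i> * (\<Sum>n<N. residue_term k (weight \<zeta>) n)"
      unfolding line_remainder_eq_integral using holomorphic_weight strip_decay_gamma_kernel_weight
      by (intro elim[rule_format, of _ "half_angle - \<bar>Im \<zeta>\<bar>"]) auto
    thus "mb_integral \<gamma> k \<zeta> = line_expansion k N \<zeta>"
      by (simp only: mb_integral_eq residue_expansion_eq_line_expansion)
  qed
qed

lemma GD_mb_integral_eq_line_expansion:
  assumes vc: "vertical_contour L \<beta> c k \<gamma>"
  shows "\<forall>\<^sub>F N in sequentially. \<forall>\<zeta>. \<bar>Im \<zeta>\<bar> < half_angle \<longrightarrow>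
    \<beta> * x_of \<zeta> * GD_mb_integral \<gamma> k \<zeta> = line_expansion (k - 1) N \<zeta>"
  using line_integral_vertical_contour[OF vc poles_disjoint]
proof eventually_elim
  case (elim N)
  show ?case
  proof (intro allI impI)
    fix \<zeta> assume \<zeta>: "\<bar>Im \<zeta>\<bar> < half_angle"
    have gap_shift: "Complex (gap_abscissa k N) t + 1 = Complex (gap_abscissa (k - 1) N) t" for t
      by (simp add: gap_abscissa_pred complex_eq_iff)
    have "strip_decay (half_angle - \<bar>Im \<zeta>\<bar>) (gamma_kernel k (\<lambda>s. weight \<zeta> (s + 1)))"
      unfolding gamma_kernel_shift by (intro strip_decay_shift strip_decay_gamma_kernel_weight)
    hence "line_integral (gamma_kernel k (\<lambda>s. weight \<zeta> (s + 1))) \<gamma>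
        = \<i> * line_remainder (k - 1) N \<zeta> + 2 * of_real pi * \<i> * (\<Sum>n<N. residue_term (k - 1) (weight \<zeta>) n)"
      using elim[rule_format, OF holomorphic_weight_shift] \<zeta>
      unfolding line_remainder_eq_integral gap_shift[symmetric] residue_term_shift[symmetric] gamma_kernel_shift by auto
    moreover have "\<beta> * x_of \<zeta> * GD_mb_integral \<gamma> k \<zeta>
        = prefactor (k - 1) / (2 * of_real pi * \<i>) * line_integral (gamma_kernel k (\<lambda>s. weight \<zeta> (s + 1))) \<gamma>"
      by (rule x_mult_GD_mb_integral) (use vc in \<open>auto simp: vertical_contour_def\<close>)
    ultimately show "\<beta> * x_of \<zeta> * GD_mb_integral \<gamma> k \<zeta> = line_expansion (k - 1) N \<zeta>"
      by (simp only: residue_expansion_eq_line_expansion)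
  qed
qed

lemma vertical_GD:
  assumes vc: "\<And>k. vertical_contour L \<beta> c k (\<gamma> k)" and \<zeta>: "\<bar>Im \<zeta>\<bar> < half_angle"
  shows "\<beta> * x_of \<zeta> * GD_mb_integral (\<gamma> k) k \<zeta> = mb_integral (\<gamma> (k - 1)) (k - 1) \<zeta>"
proof -
  have "\<forall>\<^sub>F N in sequentially. \<beta> * x_of \<zeta> * GD_mb_integral (\<gamma> k) k \<zeta> = mb_integral (\<gamma> (k - 1)) (k - 1) \<zeta>"
    using GD_mb_integral_eq_line_expansion[OF vc, of k] mb_integral_eq_line_expansion[OF vc, of "k - 1"]
    by eventually_elim (use \<zeta> in simp)
  thus ?thesis by simp
qed

lemma line_kernel_pred:
  "Complex (gap_abscissa k (Suc N)) t * line_kernel k (Suc N) t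
    = - 1 * line_kernel (k - 1) N t + - of_int (k - 1) * line_kernel k (Suc N) t"
proof -
  have "Complex (gap_abscissa k (Suc N)) t \<notin> \<int>" by (rule gap_line_not_Ints[of _ k "Suc N"]) simp
  from gamma_kernel_pred[OF this, of k quot] show ?thesis
    unfolding line_kernel_def gap_abscissa_pred_Suc by (simp add: algebra_simps)
qed

lemma has_field_derivative_line_remainder:
  assumes right: "right_of_left_poles L \<beta> c (gap_abscissa k (Suc N))" and \<zeta>: "\<bar>Im \<zeta>\<bar> < half_angle"
  shows "(line_remainder k (Suc N) has_field_derivative
    - line_remainder (k - 1) N \<zeta> - of_int (k - 1) * line_remainder k (Suc N) \<zeta>) (at \<zeta>)"
proof -
  let ?b = "gap_abscissa k (Suc N)"
  have kernels: "exp_decay half_angle (line_kernel k (Suc N))" "exp_decay half_angle (line_kernel (k - 1) N)"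
    using right by (auto intro!: exp_decay_line_kernel simp: gap_abscissa_pred_Suc)
  have "line_transform ?b (\<lambda>t. Complex ?b t * line_kernel k (Suc N) t) \<zeta>
      = - line_transform ?b (line_kernel (k - 1) N) \<zeta> - of_int (k - 1) * line_transform ?b (line_kernel k (Suc N)) \<zeta>"
    unfolding line_kernel_pred line_transform_add[OF exp_decay_cmult[OF kernels(2)] exp_decay_cmult[OF kernels(1)] \<zeta>]
    unfolding line_transform_cmult by (simp add: algebra_simps)
  with has_field_derivative_line_transform[OF kernels(1) \<zeta>, of ?b] show ?thesis
    unfolding line_remainder_def gap_abscissa_pred_Suc by simp
qed

lemma has_field_derivative_series_term:
  "((\<lambda>\<zeta>. series_term k \<zeta> n) has_field_derivative right_pole k n * series_term k \<zeta> n) (at \<zeta>)"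
  unfolding series_term_eq_residue_term[abs_def] residue_term_def weight_def by (auto intro!: derivative_eq_intros)

lemma sum_series_term_derivative:
  "(\<Sum>n<Suc N. right_pole k n * series_term k \<zeta> n)
    = (\<Sum>n<N. series_term (k - 1) \<zeta> n) / \<beta> - of_int (k - 1) * (\<Sum>n<Suc N. series_term k \<zeta> n)"
proof -
  have "(\<Sum>n<N. series_term (k - 1) \<zeta> n) / \<beta> = (\<Sum>n<N. of_nat (Suc n) * series_term k \<zeta> (Suc n))"
    unfolding series_term_pred sum_divide_distrib using beta by (simp del: of_nat_Suc)
  also have "\<dots> = (\<Sum>n<Suc N. of_nat n * series_term k \<zeta> n)" by (subst sum.lessThan_Suc_shift) simp
  also have "\<dots> = (\<Sum>n<Suc N. right_pole k n * series_term k \<zeta> n) + of_int (k - 1) * (\<Sum>n<Suc N. series_term k \<zeta> n)"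
    unfolding sum_distrib_left sum.distrib[symmetric] by (intro sum.cong) (simp_all add: right_pole_def algebra_simps)
  finally show ?thesis by simp
qed

lemma has_field_derivative_line_expansion:
  assumes "right_of_left_poles L \<beta> c (gap_abscissa k (Suc N))" "\<bar>Im \<zeta>\<bar> < half_angle"
  shows "(line_expansion k (Suc N) has_field_derivative
    line_expansion (k - 1) N \<zeta> / \<beta> - of_int (k - 1) * line_expansion k (Suc N) \<zeta>) (at \<zeta>)"
proof -
  let ?D = "prefactor k / (2 * of_real pi) * (- line_remainder (k - 1) N \<zeta> - of_int (k - 1) * line_remainder k (Suc N) \<zeta>)
        + (\<Sum>n<Suc N. right_pole k n * series_term k \<zeta> n)"
  have "?D = line_expansion (k - 1) N \<zeta> / \<beta> - of_int (k - 1) * line_expansion k (Suc N) \<zeta>"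
    unfolding sum_series_term_derivative line_expansion_def prefactor_pred using beta
    by (simp add: add_divide_distrib diff_divide_distrib right_diff_distrib distrib_left mult_ac del: sum.lessThan_Suc)
  moreover have "(line_expansion k (Suc N) has_field_derivative ?D) (at \<zeta>)"
    unfolding line_expansion_def[abs_def]
    by (intro DERIV_add DERIV_cmult DERIV_sum has_field_derivative_line_remainder has_field_derivative_series_term assms)
  ultimately show ?thesis by (simp only:)
qed

lemma vertical_derivative:
  assumes vc: "\<And>k. vertical_contour L \<beta> c k (\<gamma> k)" and \<zeta>: "\<bar>Im \<zeta>\<bar> < half_angle"
  shows "(mb_integral (\<gamma> k) k has_field_derivative
    mb_integral (\<gamma> (k - 1)) (k - 1) \<zeta> / \<beta> - of_int (k - 1) * mb_integral (\<gamma> k) k \<zeta>) (at \<zeta>)"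
proof -
  note eventually_Suc = eventually_sequentially_Suc[THEN iffD2]
  have "\<forall>\<^sub>F N in sequentially. right_of_left_poles L \<beta> c (gap_abscissa k (Suc N))
      \<and> (\<forall>z. \<bar>Im z\<bar> < half_angle \<longrightarrow> mb_integral (\<gamma> k) k z = line_expansion k (Suc N) z)
      \<and> (\<forall>z. \<bar>Im z\<bar> < half_angle \<longrightarrow> mb_integral (\<gamma> (k - 1)) (k - 1) z = line_expansion (k - 1) N z)"
    using eventually_Suc[OF eventually_right_of_left_poles[of L \<beta> c k]] eventually_Suc[OF mb_integral_eq_line_expansion[OF vc]]
      mb_integral_eq_line_expansion[OF vc] by (rule eventually_conj[OF _ eventually_conj])
  from eventually_happens'[OF sequentially_bot this]
  obtain N where right: "right_of_left_poles L \<beta> c (gap_abscissa k (Suc N))"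
    and expansion: "\<And>z. \<bar>Im z\<bar> < half_angle \<Longrightarrow> mb_integral (\<gamma> k) k z = line_expansion k (Suc N) z"
      "\<And>z. \<bar>Im z\<bar> < half_angle \<Longrightarrow> mb_integral (\<gamma> (k - 1)) (k - 1) z = line_expansion (k - 1) N z"
    by blast
  have "open {z. \<bar>Im z\<bar> < half_angle}" by (intro open_Collect_less continuous_intros)
  with has_field_derivative_line_expansion[OF right \<zeta>] show ?thesis
    unfolding expansion(2)[OF \<zeta>] expansion(1)[OF \<zeta>]
    by (rule has_field_derivative_transform_within_open) (use \<zeta> expansion(1) in auto)
qed

theorem vertical_relations:
  assumes "\<And>k. vertical_contour L \<beta> c k (\<gamma> k)"
  shows "relations_hold L M \<beta> c d \<gamma> {\<zeta>. \<bar>Im \<zeta>\<bar> < half_angle}"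
  using vertical_derivative[OF assms] vertical_GD[OF assms] by (intro relations_holdI) auto

lemma gamma_kernel_weight_plus1:
  assumes "regular_at k s" "s \<notin> \<int>"
  shows "gamma_kernel k (weight \<zeta>) (s + 1) = - (exp \<zeta> * step_ratio k s) * gamma_kernel k (weight \<zeta>) s"
proof -
  have "s + 1 \<notin> \<int>" using assms(2) Ints_diff[of "s + 1" 1] by auto
  hence "- (of_int k + s) * gamma_kernel k (weight \<zeta>) (s + 1) = gamma_kernel k (\<lambda>s. weight \<zeta> (s + 1)) s"
    unfolding gamma_kernel_shift by (simp add: gamma_kernel_pred add_ac)
  also have "\<dots> = - (of_int k + s) * (- (exp \<zeta> * step_ratio k s) * gamma_kernel k (weight \<zeta>) s)"
    unfolding gamma_kernel_def weight_plus1[OF assms(1)]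
    by (simp only: mult_ac mult_minus_left mult_minus_right minus_minus)
  finally show ?thesis using assms(1) unfolding regular_at_def by (metis mult_left_cancel neg_equal_0_iff_equal)
qed

lemma norm_gamma_kernel_weight_gap_line_le:
  assumes "0 \<le> q" "R \<le> gap_abscissa k N"
    and regular: "\<And>s. R \<le> Re s \<Longrightarrow> regular_at k s"
    and ratio: "\<And>s. R \<le> Re s \<Longrightarrow> norm (exp \<zeta> * step_ratio k s) \<le> q"
  shows "norm (gamma_kernel k (weight \<zeta>) (Complex (gap_abscissa k (N + n)) t))
    \<le> q ^ n * norm (gamma_kernel k (weight \<zeta>) (Complex (gap_abscissa k N) t))"
proof (induction n)
  case (Suc n)
  let ?s = "Complex (gap_abscissa k (N + n)) t"
  have "?s \<notin> \<int>" by (rule gap_line_not_Ints) simp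
  moreover have R: "R \<le> Re ?s" using assms(2) by (simp add: gap_abscissa_def)
  moreover have next_line: "Complex (gap_abscissa k (N + Suc n)) t = ?s + 1" by (simp add: gap_abscissa_def complex_eq_iff)
  ultimately have "norm (gamma_kernel k (weight \<zeta>) (Complex (gap_abscissa k (N + Suc n)) t))
      = norm (exp \<zeta> * step_ratio k ?s) * norm (gamma_kernel k (weight \<zeta>) ?s)"
    unfolding next_line by (subst gamma_kernel_weight_plus1) (auto intro: regular simp: norm_mult)
  also have "\<dots> \<le> q * (q ^ n * norm (gamma_kernel k (weight \<zeta>) (Complex (gap_abscissa k N) t)))"
    by (intro mult_mono ratio R Suc.IH assms(1)) auto
  finally show ?case by (simp add: mult.assoc)
qed simp

lemma line_remainder_tendsto_0:
  assumes dom: "\<zeta> \<in> convergence_domain" and \<zeta>: "\<bar>Im \<zeta>\<bar> < half_angle"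
  shows "(\<lambda>N. line_remainder k N \<zeta>) \<longlonglongrightarrow> 0"
proof -
  obtain q R where q: "0 < q" "q < 1" and regular: "\<And>s. R \<le> Re s \<Longrightarrow> regular_at k s"
    and ratio: "\<And>s. R \<le> Re s \<Longrightarrow> norm (exp \<zeta> * step_ratio k s) \<le> q"
    using step_ratio_contraction[OF dom] by metis
  obtain N where N: "\<And>n. N \<le> n \<Longrightarrow> right_of_left_poles L \<beta> c (gap_abscissa k n) \<and> R < gap_abscissa k n"
    using eventually_conj[OF eventually_right_of_left_poles eventually_gap_abscissa_gt] unfolding eventually_sequentially by blast
  let ?kernel = "\<lambda>n t. gamma_kernel k (weight \<zeta>) (Complex (gap_abscissa k n) t)"
  have decay: "exp_decay (half_angle - \<bar>Im \<zeta>\<bar>) (?kernel n)" if "N \<le> n" for n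
    using N[OF that] by (intro exp_decay_gap_line[OF holomorphic_weight _ strip_decay_gamma_kernel_weight]) auto
  define \<delta> where "\<delta> = (half_angle - \<bar>Im \<zeta>\<bar>) / 2"
  have \<delta>: "0 < \<delta>" "\<delta> < half_angle - \<bar>Im \<zeta>\<bar>" using \<zeta> by (auto simp: \<delta>_def)
  obtain C where C: "\<And>t. norm (?kernel N t) \<le> C * exp (- \<delta> * \<bar>t\<bar>)" using exp_decayE[OF decay[OF order_refl] \<delta>(2)] by metis
  have bound: "norm (?kernel (N + n) t) \<le> q ^ n * (C * exp (- \<delta> * \<bar>t\<bar>))" for n t
    by (rule order_trans[OF norm_gamma_kernel_weight_gap_line_le[OF _ _ regular ratio] mult_left_mono[OF C]])
       (use q N[of N] in auto)
  define K where "K = integral UNIV (\<lambda>t. C * exp (- \<delta> * \<bar>t\<bar>))"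
  have "norm (line_remainder k (N + n) \<zeta>) \<le> integral UNIV (\<lambda>t. q ^ n * (C * exp (- \<delta> * \<bar>t\<bar>)))" for n
    unfolding line_remainder_eq_integral using \<delta> \<zeta>
    by (intro integral_norm_bound_integral bound exp_decay_integrable[OF decay] integrable_on_mult_right integrable_exp_minus_abs) auto
  hence "\<forall>\<^sub>F n in sequentially. norm (line_remainder k (n + N) \<zeta>) \<le> q ^ n * K"
    unfolding K_def by (simp add: add.commute)
  moreover have "(\<lambda>n. q ^ n * K) \<longlonglongrightarrow> 0" using q by (intro tendsto_mult_left_zero LIMSEQ_realpow_zero) auto
  ultimately have "(\<lambda>n. line_remainder k (n + N) \<zeta>) \<longlonglongrightarrow> 0" by (rule Lim_null_comparison)
  thus ?thesis by (rule LIMSEQ_offset)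
qed

theorem vertical_sums:
  assumes vc: "vertical_contour L \<beta> c k \<gamma>" and \<zeta>: "\<zeta> \<in> convergence_domain" "\<bar>Im \<zeta>\<bar> < half_angle"
  shows "series_term k \<zeta> sums mb_integral \<gamma> k \<zeta>"
proof -
  have "(\<lambda>N. mb_integral \<gamma> k \<zeta> - prefactor k / (2 * of_real pi) * line_remainder k N \<zeta>)
      \<longlonglongrightarrow> mb_integral \<gamma> k \<zeta> - prefactor k / (2 * of_real pi) * 0"
    by (intro tendsto_intros line_remainder_tendsto_0 \<zeta>)
  moreover have "\<forall>\<^sub>F N in sequentially.
      mb_integral \<gamma> k \<zeta> - prefactor k / (2 * of_real pi) * line_remainder k N \<zeta> = (\<Sum>n<N. series_term k \<zeta> n)"
    using mb_integral_eq_line_expansion[OF vc] by eventually_elim (use \<zeta>(2) in \<open>simp add: line_expansion_def\<close>)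
  ultimately show ?thesis unfolding sums_def using Lim_transform_eventually by fastforce
qed

lemma bigo_x_of_powi:
  assumes F: "F \<le> filtercomap Re at_bot" and "of_int m \<le> p"
    and bound: "\<forall>\<^sub>F \<zeta> in F. norm (f \<zeta>) \<le> C * exp (p * Re \<zeta>)"
  shows "f \<in> O[F](\<lambda>\<zeta>. x_of \<zeta> powi m)"
proof (rule bigoI)
  have "\<forall>\<^sub>F \<zeta> in filtercomap Re at_bot. Re \<zeta> \<le> 0"
    by (rule eventually_filtercomapI[OF eventually_le_at_bot])
  hence "\<forall>\<^sub>F \<zeta> in F. Re \<zeta> \<le> 0" by (rule filter_leD[OF F])
  with bound show "\<forall>\<^sub>F \<zeta> in F. norm (f \<zeta>) \<le> (\<bar>C\<bar> * norm \<kappa> powi m) * norm (x_of \<zeta> powi m)"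
  proof eventually_elim
    case (elim \<zeta>)
    have "norm \<kappa> powi m * norm (x_of \<zeta> powi m) = norm ((- \<kappa> * x_of \<zeta>) powi m)"
      by (simp add: norm_power_int norm_mult power_int_mult_distrib)
    hence modulus: "norm \<kappa> powi m * norm (x_of \<zeta> powi m) = exp (of_int m * Re \<zeta>)"
      unfolding exp_eq_x_of[symmetric] by (simp add: norm_power_int exp_power_int)
    have "norm (f \<zeta>) \<le> C * exp (p * Re \<zeta>)" by (rule elim)
    also have "\<dots> \<le> \<bar>C\<bar> * exp (of_int m * Re \<zeta>)"
      using elim \<open>of_int m \<le> p\<close> by (intro mult_mono) (auto intro: mult_right_mono_neg)
    finally show ?case unfolding modulus[symmetric] by (simp add: mult.assoc)
  qed
qed

lemma series_term_bigo:
  assumes "F \<le> filtercomap Re at_bot" "m \<le> 1 - k + int j"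
  shows "(\<lambda>\<zeta>. series_term k \<zeta> j) \<in> O[F](\<lambda>\<zeta>. x_of \<zeta> powi m)"
proof (rule bigo_x_of_powi[OF assms(1)])
  show "of_int m \<le> Re (right_pole k j)" using assms(2) by simp
  have "norm (series_term k \<zeta> j) = norm (power_coeff k j) * exp (Re (right_pole k j) * Re \<zeta>)" for \<zeta>
    unfolding series_term_eq_residue_term residue_term_def weight_def power_coeff_def
    by (simp add: norm_mult norm_divide norm_exp_eq_Re)
  thus "\<forall>\<^sub>F \<zeta> in F. norm (series_term k \<zeta> j) \<le> norm (power_coeff k j) * exp (Re (right_pole k j) * Re \<zeta>)" by simp
qed

lemma line_remainder_bigo:
  assumes right: "right_of_left_poles L \<beta> c (gap_abscissa k N)" and "\<theta> < half_angle" "m \<le> int N - k"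
    and F: "F \<le> filtercomap Re at_bot" "\<forall>\<^sub>F \<zeta> in F. \<bar>Im \<zeta>\<bar> \<le> \<theta>"
  shows "line_remainder k N \<in> O[F](\<lambda>\<zeta>. x_of \<zeta> powi m)"
proof -
  obtain C where C: "\<And>\<zeta>. \<bar>Im \<zeta>\<bar> \<le> \<theta> \<Longrightarrow> norm (line_remainder k N \<zeta>) \<le> C * exp (gap_abscissa k N * Re \<zeta>)"
    using norm_line_transform_le[OF exp_decay_line_kernel[OF right] \<open>\<theta> < half_angle\<close>] unfolding line_remainder_def by metis
  show ?thesis
  proof (rule bigo_x_of_powi[OF F(1)])
    show "of_int m \<le> gap_abscissa k N" using \<open>m \<le> int N - k\<close> by (simp add: gap_abscissa_def)
    show "\<forall>\<^sub>F \<zeta> in F. norm (line_remainder k N \<zeta>) \<le> C * exp (gap_abscissa k N * Re \<zeta>)"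
      using F(2) by eventually_elim (rule C)
  qed
qed

theorem vertical_asymptotic:
  fixes N :: nat
  assumes vc: "vertical_contour L \<beta> c k \<gamma>" and \<theta>: "0 < \<theta>1" "\<theta>2 < half_angle"
  shows "(\<lambda>\<zeta>. mb_integral \<gamma> k \<zeta> - (\<Sum>j<N. series_term k \<zeta> j))
     \<in> O[inf (filtercomap Re at_bot) (principal {\<zeta>. \<theta>1 \<le> Im \<zeta> \<and> Im \<zeta> \<le> \<theta>2})](\<lambda>\<zeta>. x_of \<zeta> powi (int N + 1 - k))"
proof -
  define F where "F = inf (filtercomap Re at_bot) (principal {\<zeta>. \<theta>1 \<le> Im \<zeta> \<and> Im \<zeta> \<le> \<theta>2})"
  have F: "F \<le> filtercomap Re at_bot" "\<forall>\<^sub>F \<zeta> in F. \<bar>Im \<zeta>\<bar> \<le> \<theta>2"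
    using \<theta>(1) by (auto simp: F_def eventually_inf_principal)
  have "\<forall>\<^sub>F n in sequentially. N < n \<and> right_of_left_poles L \<beta> c (gap_abscissa k n)
      \<and> (\<forall>\<zeta>. \<bar>Im \<zeta>\<bar> < half_angle \<longrightarrow> mb_integral \<gamma> k \<zeta> = line_expansion k n \<zeta>)"
    by (intro eventually_conj eventually_gt_at_top eventually_right_of_left_poles mb_integral_eq_line_expansion vc)
  from eventually_happens'[OF sequentially_bot this]
  obtain n where n: "N < n" "right_of_left_poles L \<beta> c (gap_abscissa k n)"
    and expansion: "\<And>\<zeta>. \<bar>Im \<zeta>\<bar> < half_angle \<Longrightarrow> mb_integral \<gamma> k \<zeta> = line_expansion k n \<zeta>"
    by blast
  have "(\<lambda>\<zeta>. prefactor k / (2 * of_real pi) * line_remainder k n \<zeta> + (\<Sum>j\<in>{N..<n}. series_term k \<zeta> j))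
      \<in> O[F](\<lambda>\<zeta>. x_of \<zeta> powi (int N + 1 - k))"
    using n F \<theta>(2) by (intro sum_in_bigo(1) big_sum_in_bigo series_term_bigo) (auto intro: line_remainder_bigo)
  moreover have "\<forall>\<^sub>F \<zeta> in F. prefactor k / (2 * of_real pi) * line_remainder k n \<zeta> + (\<Sum>j\<in>{N..<n}. series_term k \<zeta> j)
      = mb_integral \<gamma> k \<zeta> - (\<Sum>j<N. series_term k \<zeta> j)"
    using F(2)
  proof eventually_elim
    case (elim \<zeta>)
    have "(\<Sum>j<n. series_term k \<zeta> j) = (\<Sum>j<N. series_term k \<zeta> j) + (\<Sum>j\<in>{N..<n}. series_term k \<zeta> j)"
      using sum.atLeastLessThan_concat[of 0 N n "series_term k \<zeta>"] n(1) by (simp add: atLeast0LessThan)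
    thus ?case using expansion[of \<zeta>] elim \<theta>(2) by (simp add: line_expansion_def)
  qed
  ultimately show ?thesis unfolding F_def[symmetric] by (simp only: landau_o.big.in_cong)
qed

end

theorem theorem3p1:
  fixes L M :: nat and \<beta> :: complex and c d :: "nat \<Rightarrow> complex"
    and \<gamma>H \<gamma>V :: "int \<Rightarrow> real \<Rightarrow> complex"
  assumes beta: "\<beta> \<noteq> 0"
    and c_nz: "\<forall>l<L. c l \<noteq> 0" and d_nz: "\<forall>m<M. d m \<noteq> 0"
    and c_gen: "\<forall>l<L. 1 / (\<beta> * c l) \<notin> \<int>"
    and d_gen: "\<forall>m<M. 1 / (\<beta> * d m) \<notin> \<int>"
    and hankel: "L \<le> M + 1 \<Longrightarrow> \<forall>k. hankel_contour L \<beta> c k (\<gamma>H k)"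
    and vertical: "M + 1 \<le> L \<Longrightarrow> \<forall>k. vertical_contour L \<beta> c k (\<gamma>V k)"
  shows
    "(L \<le> M \<longrightarrow> relations_hold L M \<beta> c d \<gamma>H UNIV)
   \<and> (L = M + 1 \<longrightarrow> relations_hold L M \<beta> c d \<gamma>H {\<zeta>. Re \<zeta> < 0})
   \<and> (M + 1 \<le> L \<longrightarrow> relations_hold L M \<beta> c d \<gamma>V
          {\<zeta>. \<bar>Im \<zeta>\<bar> < real (L - M + 1) * pi / 2})
   \<and> (L \<le> M \<longrightarrow>
        (\<forall>k x. x \<noteq> 0 \<longrightarrow> summable (\<lambda>j. norm (phi_term L M \<beta> c d k x j))) \<and>
        (\<forall>k \<zeta>. phitilde L M \<beta> c d (\<gamma>H k) k \<zeta> = phi L M \<beta> c d k (xof L M \<beta> c d \<zeta>)))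
   \<and> (L = M + 1 \<longrightarrow>
        (\<forall>k \<zeta>. Re \<zeta> < 0 \<longrightarrow>
           (phi_term L M \<beta> c d k (xof L M \<beta> c d \<zeta>)) sums (phitilde L M \<beta> c d (\<gamma>H k) k \<zeta>)) \<and>
        (\<forall>k \<zeta>. Re \<zeta> < 0 \<longrightarrow> \<bar>Im \<zeta>\<bar> < pi \<longrightarrow>
           (phi_term L M \<beta> c d k (xof L M \<beta> c d \<zeta>)) sums (phitilde L M \<beta> c d (\<gamma>V k) k \<zeta>)))
   \<and> (M + 1 < L \<longrightarrow>
        (\<forall>k (N::nat) \<theta>1 \<theta>2. 0 < \<theta>1 \<longrightarrow> \<theta>1 \<le> \<theta>2 \<longrightarrow> \<theta>2 < real (L - M + 1) * pi / 2 \<longrightarrow>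
           (\<lambda>\<zeta>. phitilde L M \<beta> c d (\<gamma>V k) k \<zeta>
                   - (\<Sum>j<N. phi_term L M \<beta> c d k (xof L M \<beta> c d \<zeta>) j))
           \<in> O[inf (filtercomap Re at_bot) (principal {\<zeta>. \<theta>1 \<le> Im \<zeta> \<and> Im \<zeta> \<le> \<theta>2})](\<lambda>\<zeta>. xof L M \<beta> c d \<zeta> powi (int N + 1 - k))))"
proof -
  interpret mellin_barnes L M \<beta> c d
    by unfold_locales (fact beta c_nz d_nz c_gen d_gen)+
  have H: "L \<le> M + 1 \<Longrightarrow> hankel_contour L \<beta> c k (\<gamma>H k)" and V: "M + 1 \<le> L \<Longrightarrow> vertical_contour L \<beta> c k (\<gamma>V k)" for k
    using hankel vertical by blast+
  show ?thesis
  proof (intro conjI impI allI)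
    show "relations_hold L M \<beta> c d \<gamma>H UNIV" if "L \<le> M"
      using hankel_relations[OF H] that by (simp add: convergence_domain_eq)
    show "relations_hold L M \<beta> c d \<gamma>H {\<zeta>. Re \<zeta> < 0}" if "L = M + 1"
      using hankel_relations[OF H] that unfolding convergence_domain_eq(2)[OF that] by simp
    show "relations_hold L M \<beta> c d \<gamma>V {\<zeta>. \<bar>Im \<zeta>\<bar> < real (L - M + 1) * pi / 2}" if "M + 1 \<le> L"
      using vertical_relations[OF V[OF that]] unfolding half_angle_eq[OF that] .
    show "mb_integral (\<gamma>H k) k \<zeta> = phi L M \<beta> c d k (x_of \<zeta>)" if "L \<le> M" for k \<zeta>
      using sums_unique[OF hankel_sums[OF H, of \<zeta> k]] that by (simp add: convergence_domain_eq phi_def)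
    show "series_term k \<zeta> sums mb_integral (\<gamma>H k) k \<zeta>" if "L = M + 1" "Re \<zeta> < 0" for k \<zeta>
      by (rule hankel_sums[OF H]) (use that convergence_domain_eq(2) in auto)
    show "series_term k \<zeta> sums mb_integral (\<gamma>V k) k \<zeta>" if "L = M + 1" "Re \<zeta> < 0" "\<bar>Im \<zeta>\<bar> < pi" for k \<zeta>
      by (rule vertical_sums[OF V]) (use that convergence_domain_eq(2) half_angle_eq in auto)
    show "(\<lambda>\<zeta>. mb_integral (\<gamma>V k) k \<zeta> - (\<Sum>j<N. series_term k \<zeta> j))
        \<in> O[inf (filtercomap Re at_bot) (principal {\<zeta>. \<theta>1 \<le> Im \<zeta> \<and> Im \<zeta> \<le> \<theta>2})](\<lambda>\<zeta>. x_of \<zeta> powi (int N + 1 - k))"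
      if "M + 1 < L" "0 < \<theta>1" "\<theta>2 < real (L - M + 1) * pi / 2" for k N \<theta>1 \<theta>2
      by (rule vertical_asymptotic[OF V]) (use that half_angle_eq in auto)
  qed (auto intro: summable_norm_phi_term)
qed

end
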